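(* Let $m\ge1$, $I\subset\{0,\dots,m\}$ nonempty, and $\mu\in X_*$ any cocharacter of $GSp_{2m}$. Then $\mathrm{Adm}_{GSp_{2m},I}(\mu)=\mathrm{Adm}_{GL_{2m},\pm I}(\mu)\cap\widetilde W/W_I$, where $\widetilde W/W_I$ is regarded as a subset of $\widetilde W_{GL_{2m}}/W_{GL_{2m},\pm I}$.
   Context: Notation: $(x^{(p)},y^{(q)})$ is $x$ repeated $p$ times then $y$ repeated $q$ times; $\mathbf b=(b,\dots,b)$. GL side: $\widetilde W_{GL_{2m}}=\mathbb Z^{2m}\rtimes S_{2m}$ acting on $\mathbb R^{2m}$ by affine transformations ($t_\lambda\sigma:x\mapsto\lambda+\sigma x$, $S_{2m}$ permuting coordinates); affine root hyperplanes are the zero loci of $x_i-x_j-k$ ($i<j$, $k\in\mathbb Z$); the affine Weyl group is generated by reflections across them; base alcove $A_{GL}=\{x\in\mathbb R^{2m}:x_1<x_2<\dots<x_{2m}<x_1+1\}$, whose vertices are the points $\omega_i$ below; Bruhat order on $\widetilde W_{GL_{2m}}$: Coxeter Bruhat order on the affine Weyl group (simple reflections = reflections across walls of $A_{GL}$), extended by $x\omega\le x'\omega'$ iff $\omega=\omega'$ and $x\le x'$, where $\omega,\omega'$ lie in the stabilizer of $A_{GL}$. For $i=2mb+c$, $0\le c<2m$, $\omega_i=((-1)^{(c)},0^{(2m-c)})-\mathbf b$. $W_{GL_{2m},\pm I}$ is the stabilizer in $\widetilde W_{GL_{2m}}$ of all $\omega_i$ with $i\in2m\mathbb Z\pm I$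 (integers congruent mod $2m$ to an element of $I\cup(-I)$). Bruhat order on cosets: compare minimal-length representatives. $\mathrm{Adm}_{GL_{2m},\pm I}(\mu)$ is the set of $w\in\widetilde W_{GL_{2m}}/W_{GL_{2m},\pm I}$ with $w\le t_{\sigma\mu}W_{GL_{2m},\pm I}$ for some $\sigma\in S_{2m}$. GSp side: $X_*=\{x\in\mathbb Z^{2m}:x_1+x_{2m}=\dots=x_m+x_{m+1}\}$, $V=X_*\otimes\mathbb R$, $S_{2m}^*=\{\sigma\in S_{2m}:\sigma(2m+1-j)=2m+1-\sigma(j)\ \forall j\}$, $\widetilde W=X_*\rtimes S_{2m}^*\subset\widetilde W_{GL_{2m}}$; affine Weyl group $W_a$ generated by affine reflections of $V$ in $\widetilde W$ across the zero loci in $V$ of $x_i-x_j-k$; base alcove $A=\{x\in V:x_{2m}-1<x_1<\dots<x_m<x_{m+1}\}$ with stabilizer $\Omega$, $\widetilde W=W_a\rtimes\Omega$, Bruhat order defined analogously. $W_I$ is the stabilizer in $\widetilde W$ of all $\omega_i$, $i\in2m\mathbb Z\pm I$; then $W_I=\widetilde W\cap W_{GL_{2m},\pm I}$, so $\widetilde W/W_I$ injects into $\widetilde W_{GL_{2m}}/W_{GL_{2m},\pm I}$. $\mathrm{Adm}_{GSp_{2m},I}(\mu)$ is the set of $w\in\widetilde W/W_I$ with $w\le t_{\sigma\mu}W_I$ for some $\sigma\in S_{2m}^*$ (Bruhat order on $\widetilde W/W_I$ via minimal-length representatives). *)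

theory Defs
  imports Complex_Main
begin

text \<open>Conventions. Coordinates are indexed 0..n-1 (paper index j corresponds to j-1),
  with n = 2m.  Points of R^n are functions nat => real vanishing outside {..<n}.
  An element t_lambda sigma of the extended affine Weyl group of GL_n is the pair
  (lambda, sigma), lambda :: nat => int vanishing outside {..<n}, sigma a permutation
  of {..<n} fixing every i >= n.  It acts by x |-> lambda + sigma x, where
  (sigma x)_i = x_(sigma^-1 i).\<close>

type_synonym pt = "nat \<Rightarrow> real"
type_synonym ewg = "(nat \<Rightarrow> int) \<times> (nat \<Rightarrow> nat)"

definition perms :: "nat \<Rightarrow> (nat \<Rightarrow> nat) set" where
  "perms n = {\<sigma>. bij_betw \<sigma> {..<n} {..<n} \<and> (\<forall>i\<ge>n. \<sigma> i = i)}"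

definition ewg_act :: "ewg \<Rightarrow> pt \<Rightarrow> pt" where
  "ewg_act w x = (\<lambda>i. real_of_int (fst w i) + x (inv (snd w) i))"

definition ewg_mult :: "ewg \<Rightarrow> ewg \<Rightarrow> ewg" where
  "ewg_mult w v = ((\<lambda>i. fst w i + fst v (inv (snd w) i)), snd w \<circ> snd v)"

definition ewg_one :: ewg where
  "ewg_one = ((\<lambda>_. 0), id)"

definition transl :: "(nat \<Rightarrow> int) \<Rightarrow> ewg" where
  "transl la = (la, id)"

definition perm_act :: "(nat \<Rightarrow> nat) \<Rightarrow> (nat \<Rightarrow> int) \<Rightarrow> (nat \<Rightarrow> int)" where
  "perm_act \<sigma> \<mu> = (\<lambda>i. \<mu> (inv \<sigma> i))"

section \<open>Generic Coxeter/Bruhat machinery, relative to a group G of elements,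
  an ambient affine space V, and a base alcove A\<close>

definition hyps :: "nat \<Rightarrow> pt set \<Rightarrow> pt set set" where
  "hyps n V = {H. \<exists>i j (k::int). i < j \<and> j < n \<and> H = {x\<in>V. x i - x j = real_of_int k}}"

definition sep_hyps :: "nat \<Rightarrow> pt set \<Rightarrow> pt set \<Rightarrow> pt set \<Rightarrow> pt set set" where
  "sep_hyps n V B C = {H \<in> hyps n V. \<exists>i j (k::int). i < j \<and> j < n \<and>
      H = {x\<in>V. x i - x j = real_of_int k} \<and>
      (\<exists>b\<in>B. \<exists>c\<in>C. (b i - b j - real_of_int k) * (c i - c j - real_of_int k) < 0)}"

definition alen :: "nat \<Rightarrow> pt set \<Rightarrow> pt set \<Rightarrow> ewg \<Rightarrow> nat" where
  "alen n V A w = card (sep_hyps n V A (ewg_act w ` A))"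

definition refls :: "ewg set \<Rightarrow> nat \<Rightarrow> pt set \<Rightarrow> ewg set" where
  "refls G n V = {r \<in> G. \<exists>H \<in> hyps n V. (\<forall>x\<in>H. ewg_act r x = x) \<and>
      (\<forall>x\<in>V. ewg_act r (ewg_act r x) = x) \<and> (\<exists>x\<in>V. ewg_act r x \<noteq> x)}"

text \<open>subgroup generated by a set of involutions (the affine Weyl group)\<close>
inductive_set gen_by :: "ewg set \<Rightarrow> ewg set" for T where
  gen_one: "ewg_one \<in> gen_by T"
| gen_step: "w \<in> gen_by T \<Longrightarrow> r \<in> T \<Longrightarrow> ewg_mult w r \<in> gen_by T"

definition affW :: "ewg set \<Rightarrow> nat \<Rightarrow> pt set \<Rightarrow> ewg set" where
  "affW G n V = gen_by (refls G n V)"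

definition stab_alc :: "ewg set \<Rightarrow> pt set \<Rightarrow> ewg set" where
  "stab_alc G A = {w \<in> G. ewg_act w ` A = A}"

text \<open>Bruhat order of the Coxeter group W_a (Bjorner--Brenti: reflexive transitive
  closure of u -> u t, t a reflection, l(u) < l(u t))\<close>
definition bruhat_aff :: "ewg set \<Rightarrow> nat \<Rightarrow> pt set \<Rightarrow> pt set \<Rightarrow> ewg \<Rightarrow> ewg \<Rightarrow> bool" where
  "bruhat_aff G n V A u w \<longleftrightarrow> u \<in> affW G n V \<and> w \<in> affW G n V \<and>
     (u, w) \<in> {(x, ewg_mult x r) | x r. r \<in> refls G n V \<and>
                  alen n V A x < alen n V A (ewg_mult x r)}\<^sup>*"

text \<open>extension to G = W_a \<rtimes> Omega: x w <= x' w' iff w = w' and x <= x'\<close>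
definition bruhat :: "ewg set \<Rightarrow> nat \<Rightarrow> pt set \<Rightarrow> pt set \<Rightarrow> ewg \<Rightarrow> ewg \<Rightarrow> bool" where
  "bruhat G n V A w w' \<longleftrightarrow> (\<exists>x x' \<omega>. x \<in> affW G n V \<and> x' \<in> affW G n V \<and>
     \<omega> \<in> stab_alc G A \<and> w = ewg_mult x \<omega> \<and> w' = ewg_mult x' \<omega> \<and> bruhat_aff G n V A x x')"

definition coset :: "ewg \<Rightarrow> ewg set \<Rightarrow> ewg set" where
  "coset w P = (\<lambda>p. ewg_mult w p) ` P"

definition quot :: "ewg set \<Rightarrow> ewg set \<Rightarrow> ewg set set" where
  "quot G P = (\<lambda>w. coset w P) ` G"

definition minrep :: "nat \<Rightarrow> pt set \<Rightarrow> pt set \<Rightarrow> ewg set \<Rightarrow> ewg \<Rightarrow> bool" where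
  "minrep n V A C u \<longleftrightarrow> u \<in> C \<and> (\<forall>v\<in>C. alen n V A u \<le> alen n V A v)"

definition coset_le :: "ewg set \<Rightarrow> nat \<Rightarrow> pt set \<Rightarrow> pt set \<Rightarrow> ewg set \<Rightarrow> ewg set \<Rightarrow> bool" where
  "coset_le G n V A C C' \<longleftrightarrow> (\<exists>u u'. minrep n V A C u \<and> minrep n V A C' u' \<and> bruhat G n V A u u')"

definition adm :: "ewg set \<Rightarrow> nat \<Rightarrow> pt set \<Rightarrow> pt set \<Rightarrow> ewg set \<Rightarrow> (nat \<Rightarrow> nat) set
                    \<Rightarrow> (nat \<Rightarrow> int) \<Rightarrow> ewg set set" where
  "adm G n V A P S \<mu> = {C \<in> quot G P. \<exists>\<sigma>\<in>S. coset_le G n V A C (coset (transl (perm_act \<sigma> \<mu>)) P)}"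

definition V_GL :: "nat \<Rightarrow> pt set" where
  "V_GL m = {x. \<forall>i\<ge>2*m. x i = 0}"

definition W_GL :: "nat \<Rightarrow> ewg set" where
  "W_GL m = {w. snd w \<in> perms (2*m) \<and> (\<forall>i\<ge>2*m. fst w i = 0)}"

definition A_GL :: "nat \<Rightarrow> pt set" where
  "A_GL m = {x \<in> V_GL m. (\<forall>j. j + 1 < 2*m \<longrightarrow> x j < x (j+1)) \<and> x (2*m - 1) < x 0 + 1}"

text \<open>omega_i, i = 2mb + c, 0 <= c < 2m: ((-1)^(c), 0^(2m-c)) - b\<close>
definition omega :: "nat \<Rightarrow> int \<Rightarrow> pt" where
  "omega m i = (\<lambda>t. if t < 2*m then
       (if int t < i mod int (2*m) then -1 else 0) - real_of_int (i div int (2*m)) else 0)"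

definition pmI :: "nat \<Rightarrow> nat set \<Rightarrow> int set" where
  "pmI m I = {i. \<exists>a\<in>I. i mod int (2*m) = int a mod int (2*m) \<or> i mod int (2*m) = (- int a) mod int (2*m)}"

definition W_GL_I :: "nat \<Rightarrow> nat set \<Rightarrow> ewg set" where
  "W_GL_I m I = {w \<in> W_GL m. \<forall>i\<in>pmI m I. ewg_act w (omega m i) = omega m i}"

definition Adm_GL :: "nat \<Rightarrow> nat set \<Rightarrow> (nat \<Rightarrow> int) \<Rightarrow> ewg set set" where
  "Adm_GL m I \<mu> = adm (W_GL m) (2*m) (V_GL m) (A_GL m) (W_GL_I m I) (perms (2*m)) \<mu>"

definition Xstar :: "nat \<Rightarrow> (nat \<Rightarrow> int) set" where
  "Xstar m = {x. (\<forall>i\<ge>2*m. x i = 0) \<and> (\<forall>j<m. x j + x (2*m - 1 - j) = x 0 + x (2*m - 1))}"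

definition V_Sp :: "nat \<Rightarrow> pt set" where
  "V_Sp m = {x. (\<forall>i\<ge>2*m. x i = 0) \<and> (\<forall>j<m. x j + x (2*m - 1 - j) = x 0 + x (2*m - 1))}"

definition S_star :: "nat \<Rightarrow> (nat \<Rightarrow> nat) set" where
  "S_star m = {\<sigma> \<in> perms (2*m). \<forall>j<2*m. \<sigma> (2*m - 1 - j) = 2*m - 1 - \<sigma> j}"

definition W_Sp :: "nat \<Rightarrow> ewg set" where
  "W_Sp m = {w. fst w \<in> Xstar m \<and> snd w \<in> S_star m}"

definition A_Sp :: "nat \<Rightarrow> pt set" where
  "A_Sp m = {x \<in> V_Sp m. x (2*m - 1) - 1 < x 0 \<and> (\<forall>j<m. x j < x (j+1))}"

definition W_Sp_I :: "nat \<Rightarrow> nat set \<Rightarrow> ewg set" where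
  "W_Sp_I m I = {w \<in> W_Sp m. \<forall>i\<in>pmI m I. ewg_act w (omega m i) = omega m i}"

definition Adm_Sp :: "nat \<Rightarrow> nat set \<Rightarrow> (nat \<Rightarrow> int) \<Rightarrow> ewg set set" where
  "Adm_Sp m I \<mu> = adm (W_Sp m) (2*m) (V_Sp m) (A_Sp m) (W_Sp_I m I) (S_star m) \<mu>"

text \<open>the map W~/W_I -> W~_GL/W_GL,pmI, w W_I |-> w W_GL,pmI\<close>
definition embed :: "nat \<Rightarrow> nat set \<Rightarrow> ewg set \<Rightarrow> ewg set" where
  "embed m I C = {ewg_mult g p | g p. g \<in> C \<and> p \<in> W_GL_I m I}"

end

theory Submission
  imports Defs
begin

text \<open>An element \<open>w\<close> of the extended affine Weyl group of \<open>GL\<^sub>n\<close>, \<open>n = 2m\<close>, is encoded by the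
  permutation \<open>\<pi>\<close> of the integers with \<open>Y (w x) = Y x \<circ> \<pi>\<close>, where a point \<open>x\<close> is extended to
  \<open>Y x\<close> by \<open>Y x (I + n) = Y x I + 1\<close>. Then \<open>\<pi> (I + n) = \<pi> I + n\<close>, length counts inversions, and
  the Bruhat order is generated by \<open>\<pi> < \<pi> \<circ> s I J\<close> for \<open>I < J\<close> and \<open>\<pi> I < \<pi> J\<close>. The group of
  \<open>GSp\<close> consists of the \<open>\<pi>\<close> commuting with \<open>I \<mapsto> -1 - I\<close> up to a multiple of \<open>n\<close>, and lifting
  along simple reflections shows that its Bruhat order is the restriction of that of \<open>GL\<^sub>n\<close>.

  The main point is that an element \<open>x\<close> of the symplectic group below some translation by a conjugate
  of \<open>\<mu>\<close> is below a translation by a symplectic conjugate. This uses the obtuse cones of Haines and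
  He: for every Weyl chamber, \<open>x\<close> is reached from the translations by conjugates of \<open>\<mu>\<close> by
  reflections going down in the direction of the chamber. One chooses a symplectic chamber in whose
  acute cone \<open>x\<close> lies. Sorting replaces the translation by the one dominant for that chamber,
  which is symplectic, and on the acute cone the chamber order implies the Bruhat order, because both
  agree far out in the chamber and a length additive left factor can be cancelled.

  Passage to the cosets rests on the fact that the reduced element of a \<open>GL\<close> coset that meets
  the symplectic group is itself symplectic.\<close>

section \<open>Affine permutations and their Bruhat order\<close>

text \<open>Two features force the shape of the argument. Sending a group element to a permutation
  of the integers pulls back functions and so reverses products: a coset \<open>w P\<close> becomes
  the set of all \<open>q \<circ> \<pi>\<close> with \<open>q\<close> block-preserving, and being
  reduced is a condition on inverses. And GL and GSp need the same Bruhat theory for different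
  reflections, so it is developed once from a few axioms; roots enter only through the fact that
  composing with a reflection changes every group element by a fixed integer multiple of its
  difference at the two reflected places.

  Restricting the Bruhat order does not settle the symplectic case, because a translation above
  \<open>x\<close> may be by a conjugate that is not symplectic. The chamber used to replace it is
  read off from the displacement \<open>x I - I\<close>, whose symmetry under
  \<open>I \<mapsto> -1 - I\<close> makes the chamber symplectic. Ties between displacements are
  broken by \<open>I mod n\<close>, which has the same kind of symmetry.\<close>

lemma shift_mult:
  fixes y :: "int \<Rightarrow> 'a::ring_1"
  assumes "\<And>K. y (K + n) = y K + e"
  shows "y (K + k * n) = y K + of_int k * e"
proof (induction k rule: int_induct[where k=0])
  case base show ?case by simp
next
  case (step1 i)
  have "y (K + (i + 1) * n) = y (K + i * n) + e" using assms[of "K + i * n"] by (simp add: algebra_simps)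
  then show ?case using step1 by (simp add: algebra_simps)
next
  case (step2 i)
  have "y (K + i * n) = y (K + (i - 1) * n) + e" using assms[of "K + (i-1) * n"] by (simp add: algebra_simps)
  then show ?case using step2 by (simp add: algebra_simps)
qed

section \<open>Periodic permutations of the integers and affine reflections\<close>

locale period =
  fixes n :: int
  assumes n_pos: "0 < n"
begin

abbreviation res_eq :: "int \<Rightarrow> int \<Rightarrow> bool" (infix "\<simeq>" 50)
  where "I \<simeq> J \<equiv> n dvd I - J"

lemma res_sym: "I \<simeq> J \<Longrightarrow> J \<simeq> I" by (simp add: dvd_diff_commute)
lemma res_trans: "I \<simeq> J \<Longrightarrow> J \<simeq> K \<Longrightarrow> I \<simeq> K" using dvd_add by fastforce
lemma resE: assumes "I \<simeq> J" obtains k where "I = J + k * n"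
proof -
  obtain k where "I - J = n * k" using assms by (auto simp: dvd_def)
  then have "I = J + k * n" by (simp add: algebra_simps)
  then show ?thesis using that by blast
qed

text \<open>No normalisation of the sum over a period is imposed, so this is the extended affine
  symmetric group; the shifts \<open>I \<mapsto> I + k\<close> play the role of the alcove
  stabiliser.\<close>

definition AP :: "(int \<Rightarrow> int) set"
  where "AP = {\<pi>. bij \<pi> \<and> (\<forall>I. \<pi> (I + n) = \<pi> I + n)}"

lemma AP_shift: "\<pi> \<in> AP \<Longrightarrow> \<pi> (I + k * n) = \<pi> I + k * n"
  using shift_mult[of \<pi> n n I k] by (simp add: AP_def)

lemma AP_bij: "\<pi> \<in> AP \<Longrightarrow> bij \<pi>" by (simp add: AP_def)

lemma AP_eq: "\<pi> \<in> AP \<Longrightarrow> \<pi> I = \<pi> J \<longleftrightarrow> I = J"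
  by (auto simp: AP_def bij_def inj_def)

lemma AP_inv_l: "\<pi> \<in> AP \<Longrightarrow> inv \<pi> (\<pi> I) = I" by (simp add: AP_def bij_is_inj)
lemma AP_inv_r: "\<pi> \<in> AP \<Longrightarrow> \<pi> (inv \<pi> I) = I" by (simp add: AP_def bij_is_surj surj_f_inv_f)

lemma AP_id: "id \<in> AP" by (simp add: AP_def)

lemma AP_comp: "\<pi> \<in> AP \<Longrightarrow> \<kappa> \<in> AP \<Longrightarrow> \<pi> \<circ> \<kappa> \<in> AP"
  by (auto simp: AP_def intro: bij_comp)

lemma AP_inv: assumes "\<pi> \<in> AP" shows "inv \<pi> \<in> AP"
proof -
  have "inv \<pi> (I + n) = inv \<pi> I + n" for I
  proof -
    have "\<pi> (inv \<pi> I + n) = I + n" using assms AP_inv_r by (auto simp: AP_def)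
    then show ?thesis using AP_inv_l[OF assms] by metis
  qed
  then show ?thesis using assms by (auto simp: AP_def bij_imp_bij_inv)
qed

lemma AP_res: assumes "\<pi> \<in> AP" shows "\<pi> I \<simeq> \<pi> J \<longleftrightarrow> I \<simeq> J"
proof -
  have *: "\<kappa> I \<simeq> \<kappa> J" if k: "\<kappa> \<in> AP" and "I \<simeq> J" for \<kappa> I J
  proof -
    obtain k where "I = J + k * n" using \<open>I \<simeq> J\<close> by (rule resE)
    then show ?thesis using AP_shift[OF k, of J k] by simp
  qed
  show ?thesis using *[OF assms] *[OF AP_inv[OF assms], of "\<pi> I" "\<pi> J"] AP_inv_l[OF assms] by auto
qed

text \<open>For incongruent \<open>I\<close> and \<open>J\<close> this is the affine reflection
  exchanging \<open>I + k * n\<close> and \<open>J + k * n\<close> for every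
  \<open>k\<close>.\<close>

definition rf :: "int \<Rightarrow> int \<Rightarrow> int \<Rightarrow> int"
  where "rf I J K = (if K \<simeq> I then K - I + J else if K \<simeq> J then K - J + I else K)"

definition ep :: "int \<Rightarrow> int \<Rightarrow> int \<Rightarrow> int"
  where "ep I J K = (if K \<simeq> I then 1 else 0) - (if K \<simeq> J then 1 else 0)"

text \<open>The reflection formula for a root: \<open>y J - y I\<close> is the value of the root at
  \<open>y\<close>, and its coefficient does not depend on \<open>y\<close>. The ring is general
  because \<open>y\<close> is a permutation of the integers in one use and a real point in
  another.\<close>

lemma rf_linear:
  fixes y :: "int \<Rightarrow> 'a::comm_ring_1"
  assumes y: "\<And>K. y (K + n) = y K + e" and IJ: "\<not> I \<simeq> J"
  shows "y (rf I J K) = y K + of_int (ep I J K) * (y J - y I)"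
proof -
  note sh = shift_mult[of y n e, OF y]
  consider (a) "K \<simeq> I" "\<not> K \<simeq> J" | (b) "\<not> K \<simeq> I" "K \<simeq> J" | (c) "\<not> K \<simeq> I" "\<not> K \<simeq> J"
    using IJ res_trans res_sym by blast
  then show ?thesis
  proof cases
    case a
    obtain k where k: "K = I + k * n" using a(1) by (rule resE)
    have "rf I J K = J + k * n" using a by (simp add: rf_def k)
    then show ?thesis using a by (simp add: k sh ep_def)
  next
    case b
    obtain k where k: "K = J + k * n" using b(2) by (rule resE)
    have "rf I J K = I + k * n" using b by (simp add: rf_def k)
    then show ?thesis using b by (simp add: k sh ep_def)
  next
    case c
    then show ?thesis by (simp add: rf_def ep_def)
  qed
qed

lemma rf_per: "rf I J (K + n) = rf I J K + n"
proof -
  have "K + n \<simeq> A \<longleftrightarrow> K \<simeq> A" for A using dvd_add_right_iff[of n n "K - A"] by (simp add: algebra_simps)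
  then show ?thesis by (simp add: rf_def)
qed

lemma rf_left: "rf I J I = J" by (simp add: rf_def)
lemma rf_right: "\<not> I \<simeq> J \<Longrightarrow> rf I J J = I" by (simp add: rf_def dvd_diff_commute)
lemma rf_other: "\<not> K \<simeq> I \<Longrightarrow> \<not> K \<simeq> J \<Longrightarrow> rf I J K = K" by (simp add: rf_def)

lemma rf_invol: assumes "\<not> I \<simeq> J" shows "rf I J (rf I J K) = K"
proof -
  have a: "K - I + J \<simeq> J \<longleftrightarrow> K \<simeq> I" "K - J + I \<simeq> I \<longleftrightarrow> K \<simeq> J" by (simp_all add: algebra_simps)
  have b: "K \<simeq> I \<Longrightarrow> \<not> K - I + J \<simeq> I"
  proof
    assume "K \<simeq> I" "K - I + J \<simeq> I"
    then have "n dvd (K - I + J - I) - (K - I)" using dvd_diff by blast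
    then have "J \<simeq> I" by (simp add: algebra_simps)
    then show False using assms res_sym by blast
  qed
  show ?thesis using a b by (simp add: rf_def)
qed

lemma rf_AP: assumes "\<not> I \<simeq> J" shows "rf I J \<in> AP"
proof -
  have "bij (rf I J)" by (rule involuntory_imp_bij) (simp add: rf_invol[OF assms])
  then show ?thesis by (simp add: AP_def rf_per)
qed

lemma rf_conj: assumes "\<pi> \<in> AP" shows "\<pi> (rf I J K) = rf (\<pi> I) (\<pi> J) (\<pi> K)"
proof -
  have 1: "K \<simeq> A \<Longrightarrow> \<pi> (K - A + B) = \<pi> K - \<pi> A + \<pi> B" for A B
  proof -
    assume "K \<simeq> A"
    then obtain k where "K = A + k * n" by (rule resE)
    then show ?thesis using AP_shift[OF assms, of A k] AP_shift[OF assms, of B k] by (simp add: add.commute)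
  qed
  show ?thesis using 1 AP_res[OF assms] by (simp add: rf_def)
qed

end

text \<open>\<open>s_lin\<close> replaces the calculus of roots: the coefficient function is common
  to all of \<open>\<Gamma>\<close>, so evaluating it at \<open>id\<close> and at
  \<open>\<pi>\<close> compares the order of two places with the order of their images.\<close>

locale refl_system = period n for n :: int +
  fixes \<Gamma> :: "(int \<Rightarrow> int) set" and s :: "int \<Rightarrow> int \<Rightarrow> int \<Rightarrow> int"
  assumes sub_AP: "\<Gamma> \<subseteq> AP"
    and G_comp: "\<pi> \<in> \<Gamma> \<Longrightarrow> \<kappa> \<in> \<Gamma> \<Longrightarrow> \<pi> \<circ> \<kappa> \<in> \<Gamma>"
    and G_inv: "\<pi> \<in> \<Gamma> \<Longrightarrow> inv \<pi> \<in> \<Gamma>"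
    and G_id: "id \<in> \<Gamma>"
    and s_in: "\<not> I \<simeq> J \<Longrightarrow> s I J \<in> \<Gamma>"
    and s_left: "\<not> I \<simeq> J \<Longrightarrow> s I J I = J"
    and s_invol: "\<not> I \<simeq> J \<Longrightarrow> s I J (s I J K) = K"
    and s_conj: "\<pi> \<in> \<Gamma> \<Longrightarrow> \<not> I \<simeq> J \<Longrightarrow> \<pi> (s I J K) = s (\<pi> I) (\<pi> J) (\<pi> K)"
    and s_shift: "s (I + n) (J + n) = s I J"
    and s_lin: "\<not> I \<simeq> J \<Longrightarrow> \<exists>\<epsilon>::int \<Rightarrow> int. \<forall>\<pi>\<in>\<Gamma>. \<forall>K. \<pi> (s I J K) = \<pi> K + \<epsilon> K * (\<pi> J - \<pi> I)"
begin

lemma s_right: "\<not> I \<simeq> J \<Longrightarrow> s I J J = I" using s_left s_invol by metis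

lemma G_AP: "\<pi> \<in> \<Gamma> \<Longrightarrow> \<pi> \<in> AP" using sub_AP by blast
lemma G_eq: "\<pi> \<in> \<Gamma> \<Longrightarrow> \<pi> I = \<pi> J \<longleftrightarrow> I = J" using AP_eq G_AP by blast
lemma G_res: "\<pi> \<in> \<Gamma> \<Longrightarrow> \<pi> I \<simeq> \<pi> J \<longleftrightarrow> I \<simeq> J" using AP_res G_AP by blast

lemma s_commute: assumes "\<not> I \<simeq> J" shows "s I J = s J I"
proof
  fix K
  have "s I J (s I J (s I J K)) = s J I (s I J (s I J K))"
    using s_conj[OF s_in[OF assms] assms, of "s I J K"] assms by (simp add: s_left s_right)
  then show "s I J K = s J I K" using s_invol[OF assms] by simp
qed

lemma comp_s_eq: assumes "\<pi> \<in> \<Gamma>" "\<not> I \<simeq> J" shows "\<pi> \<circ> s I J = s (\<pi> I) (\<pi> J) \<circ> \<pi>"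
  using s_conj[OF assms] by auto

lemma s_conj_s: assumes "\<not> A \<simeq> B" "\<not> I \<simeq> J"
  shows "s A B \<circ> s I J \<circ> s A B = s (s A B I) (s A B J)"
proof
  fix K
  show "(s A B \<circ> s I J \<circ> s A B) K = s (s A B I) (s A B J) K"
    using s_conj[OF s_in[OF assms(1)] assms(2), of "s A B K"] s_invol[OF assms(1)] by simp
qed

text \<open>Reflections are collected, not pairs: one reflection belongs to all period translates of
  a pair and, in the symplectic case, also to the mirrored pair \<open>bar J\<close>,
  \<open>bar I\<close>.\<close>

definition Inv :: "(int \<Rightarrow> int) \<Rightarrow> (int \<Rightarrow> int) set"
  where "Inv \<pi> = {s I J | I J. \<not> I \<simeq> J \<and> I < J \<and> \<pi> J < \<pi> I}"

text \<open>The identity shows that the coefficient at \<open>C\<close> is positive: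
  \<open>D - C\<close> is that coefficient times \<open>B - A\<close>. The same coefficient relates
  \<open>\<pi> D - \<pi> C\<close> to \<open>\<pi> B - \<pi> A\<close>, so being an inversion does
  not depend on the pair that represents a reflection.\<close>

lemma inversion_well_defined:
  assumes "\<pi> \<in> \<Gamma>" "\<not> A \<simeq> B" "\<not> C \<simeq> D" "A < B" "C < D" "s A B = s C D" "\<pi> A < \<pi> B"
  shows "\<pi> C < \<pi> D"
proof -
  obtain \<epsilon> :: "int \<Rightarrow> int" where e: "\<And>\<pi> K. \<pi> \<in> \<Gamma> \<Longrightarrow> \<pi> (s A B K) = \<pi> K + \<epsilon> K * (\<pi> B - \<pi> A)"
    using s_lin[OF assms(2)] by blast
  have 1: "s A B C = D" using assms s_left by simp
  have "D = C + \<epsilon> C * (B - A)" using e[OF G_id, of C] 1 by simp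
  then have "\<epsilon> C > 0" using assms(4,5) by (simp add: zero_less_mult_iff)
  then show ?thesis using e[OF assms(1), of C] 1 assms(7) by simp
qed

lemma in_Inv_iff: assumes "\<pi> \<in> \<Gamma>" "\<not> I \<simeq> J" "I < J"
  shows "s I J \<in> Inv \<pi> \<longleftrightarrow> \<pi> J < \<pi> I"
proof
  assume "s I J \<in> Inv \<pi>"
  then obtain A B where AB: "\<not> A \<simeq> B" "A < B" "\<pi> B < \<pi> A" "s I J = s A B" by (auto simp: Inv_def)
  have "\<not> \<pi> I < \<pi> J" using inversion_well_defined[OF assms(1,2) AB(1) assms(3) AB(2) AB(4)] AB(3) by auto
  then show "\<pi> J < \<pi> I" using G_eq[OF assms(1), of I J] assms(3) by auto
qed (use assms in \<open>auto simp: Inv_def\<close>)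

lemma s_shift_mult: "s (I + k * n) (J + k * n) = s I J"
proof (induction k rule: int_induct[where k=0])
  case base show ?case by simp
next
  case (step1 i)
  then show ?case using s_shift[of "I + i*n" "J + i*n"] by (simp add: algebra_simps)
next
  case (step2 i)
  then show ?case using s_shift[of "I + (i-1)*n" "J + (i-1)*n"] by (simp add: algebra_simps)
qed

text \<open>The displacement \<open>\<pi> i - i\<close> is periodic, hence bounded by some
  \<open>M\<close>, and an inversion \<open>I < J\<close> satisfies \<open>J < I + 2 * M\<close>.
  Shifting \<open>I\<close> into one period leaves finitely many pairs.\<close>

lemma finite_Inv: assumes "\<pi> \<in> \<Gamma>" shows "finite (Inv \<pi>)"
proof -
  have per: "\<pi> (I + k * n) = \<pi> I + k * n" for I k using AP_shift G_AP assms by blast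
  define M where "M = Max ((\<lambda>i. \<bar>\<pi> i - i\<bar>) ` {0..<n})"
  have M0: "\<bar>\<pi> i - i\<bar> \<le> M" if "i \<in> {0..<n}" for i unfolding M_def using that by (intro Max_ge) auto
  have M: "\<bar>\<pi> i - i\<bar> \<le> M" for i
  proof -
    define q where "q = i div n * n"
    have "i mod n + q = i" by (simp add: q_def)
    then have "\<pi> i - i = \<pi> (i mod n) - i mod n" using per[of "i mod n" "i div n", folded q_def] by simp
    then show ?thesis using M0[of "i mod n"] n_pos by simp
  qed
  have "Inv \<pi> \<subseteq> (\<lambda>(I,J). s I J) ` ({0..<n} \<times> {0..<n + 2 * M})"
  proof
    fix t assume "t \<in> Inv \<pi>"
    then obtain I J where IJ: "t = s I J" "I < J" "\<pi> J < \<pi> I" by (auto simp: Inv_def)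
    define k where "k = I div n"
    have I: "I - k * n \<in> {0..<n}" using n_pos unfolding k_def
      by (auto simp: minus_div_mult_eq_mod)
    have "J < I + 2 * M" using IJ M[of I] M[of J] by linarith
    then have J: "J - k * n \<in> {0..<n + 2 * M}" using I IJ by auto
    have "t = s (I - k * n) (J - k * n)" using s_shift_mult[of "I - k*n" k "J - k*n"] IJ by simp
    then show "t \<in> (\<lambda>(I,J). s I J) ` ({0..<n} \<times> {0..<n + 2 * M})" using I J by auto
  qed
  then show ?thesis by (rule finite_subset) auto
qed

text \<open>There is an injection of the old inversions into the new ones that misses
  \<open>t\<close>: an inversion that survives is kept, one that is lost is conjugated by
  \<open>t\<close>.\<close>

lemma card_Inv_less:
  assumes p: "\<pi> \<in> \<Gamma>" and IJ: "\<not> I \<simeq> J" "I < J" "\<pi> I < \<pi> J"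
  shows "card (Inv \<pi>) < card (Inv (\<pi> \<circ> s I J))"
proof -
  define t where "t = s I J"
  define \<pi>' where "\<pi>' = \<pi> \<circ> t"
  have tG: "t \<in> \<Gamma>" and p': "\<pi>' \<in> \<Gamma>" using s_in IJ p G_comp by (auto simp: t_def \<pi>'_def)
  have tt: "t (t K) = K" for K using s_invol IJ by (simp add: t_def)
  have tid: "t \<circ> (t \<circ> K \<circ> t) \<circ> t = K" for K by (auto simp: tt)
  obtain \<epsilon> :: "int \<Rightarrow> int" where e: "\<And>\<pi> K. \<pi> \<in> \<Gamma> \<Longrightarrow> \<pi> (t K) = \<pi> K + \<epsilon> K * (\<pi> J - \<pi> I)"
    using s_lin[OF IJ(1)] by (auto simp: t_def)
  \<comment> \<open>Comparing coefficients for \<open>\<pi>\<close> at a lost inversion on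
    \<open>A < B\<close> gives \<open>\<epsilon> A < \<epsilon> B\<close>, and then the identity
    gives \<open>t A < t B\<close>. So the conjugate belongs to an increasing pair on which
    \<open>\<pi>\<close> increases.\<close>
  have moved: "\<exists>A B. K = s A B \<and> \<not> A \<simeq> B \<and> A < B \<and> \<pi> B < \<pi> A \<and> t A < t B \<and> \<pi> (t A) < \<pi> (t B)
      \<and> \<not> t A \<simeq> t B \<and> t \<circ> K \<circ> t = s (t A) (t B)"
    if K: "K \<in> Inv \<pi>" "K \<notin> Inv \<pi>'" for K
  proof -
    obtain A B where AB: "K = s A B" "\<not> A \<simeq> B" "A < B" "\<pi> B < \<pi> A" using K(1) by (auto simp: Inv_def)
    have "\<not> \<pi>' B < \<pi>' A" using K(2) in_Inv_iff[OF p' AB(2,3)] AB(1) by simp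
    then have 1: "\<pi> (t A) < \<pi> (t B)" using G_eq[OF p', of A B] AB(3) by (auto simp: \<pi>'_def)
    have "0 < (\<epsilon> B - \<epsilon> A) * (\<pi> J - \<pi> I)" using 1 AB(4) e[OF p, of A] e[OF p, of B] by (simp add: algebra_simps)
    then have "0 < \<epsilon> B - \<epsilon> A" using IJ(3) by (simp add: zero_less_mult_iff)
    then have "0 < (\<epsilon> B - \<epsilon> A) * (J - I)" using IJ(2) by simp
    then have "t A < t B" using AB(3) e[OF G_id, of A] e[OF G_id, of B] by (simp add: algebra_simps)
    moreover have "t \<circ> K \<circ> t = s (t A) (t B)" using s_conj_s[OF IJ(1) AB(2)] by (simp add: t_def AB(1))
    ultimately show ?thesis using AB 1 G_res[OF tG] by blast
  qed
  define \<phi> where "\<phi> K = (if K \<in> Inv \<pi>' then K else t \<circ> K \<circ> t)" for K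
  have t_notin: "t \<notin> Inv \<pi>" using in_Inv_iff[OF p IJ(1,2)] IJ by (simp add: t_def)
  have t_in: "t \<in> Inv \<pi>'" using in_Inv_iff[OF p' IJ(1,2)] IJ s_left s_right by (simp add: t_def \<pi>'_def)
  \<comment> \<open>Conjugates of lost inversions lie outside \<open>Inv \<pi>\<close>, kept ones
    inside, so the two branches of \<open>\<phi>\<close> cannot collide.\<close>
  have cross: False if K: "K \<in> Inv \<pi>" "K \<notin> Inv \<pi>'" and L: "t \<circ> K \<circ> t \<in> Inv \<pi>" for K
  proof -
    obtain A B where AB: "t A < t B" "\<pi> (t A) < \<pi> (t B)" "\<not> t A \<simeq> t B" "t \<circ> K \<circ> t = s (t A) (t B)"
      using moved[OF K] by blast
    then show False using in_Inv_iff[OF p AB(3) AB(1)] L by simp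
  qed
  have inj: "inj_on \<phi> (Inv \<pi>)"
  proof (rule inj_onI)
    fix K L assume K: "K \<in> Inv \<pi>" and L: "L \<in> Inv \<pi>" and eq: "\<phi> K = \<phi> L"
    show "K = L"
    proof (cases "K \<in> Inv \<pi>'"; cases "L \<in> Inv \<pi>'")
      assume "K \<notin> Inv \<pi>'" "L \<notin> Inv \<pi>'"
      then have "t \<circ> (t \<circ> K \<circ> t) \<circ> t = t \<circ> (t \<circ> L \<circ> t) \<circ> t" using eq by (simp add: \<phi>_def)
      then show ?thesis using tid by metis
    qed (use K L eq cross in \<open>auto simp: \<phi>_def\<close>)
  qed
  have img: "\<phi> ` Inv \<pi> \<subseteq> Inv \<pi>' - {t}"
  proof
    fix K' assume "K' \<in> \<phi> ` Inv \<pi>"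
    then obtain K where K: "K \<in> Inv \<pi>" "K' = \<phi> K" by blast
    show "K' \<in> Inv \<pi>' - {t}"
    proof (cases "K \<in> Inv \<pi>'")
      case True
      then show ?thesis using K t_notin by (auto simp: \<phi>_def)
    next
      case False
      obtain A B where AB: "\<pi> B < \<pi> A" "t A < t B" "\<not> t A \<simeq> t B" "t \<circ> K \<circ> t = s (t A) (t B)"
        using moved[OF K(1) False] by blast
      have "s (t A) (t B) \<in> Inv \<pi>'" using in_Inv_iff[OF p' AB(3,2)] AB(1) by (simp add: \<pi>'_def tt)
      moreover have "t \<circ> K \<circ> t \<noteq> t"
      proof
        assume "t \<circ> K \<circ> t = t"
        then have "K = t \<circ> t \<circ> t" using tid[of K] by simp
        then have "K = t" by (auto simp: tt)
        then show False using K t_notin by simp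
      qed
      ultimately show ?thesis using K False AB by (simp add: \<phi>_def)
    qed
  qed
  have "card (Inv \<pi>) = card (\<phi> ` Inv \<pi>)" using inj by (simp add: card_image)
  also have "\<dots> \<le> card (Inv \<pi>' - {t})" using img finite_Inv[OF p'] by (intro card_mono) auto
  also have "\<dots> < card (Inv \<pi>')" using t_in finite_Inv[OF p'] by (intro psubset_card_mono) auto
  finally show ?thesis by (simp add: \<pi>'_def t_def)
qed

lemma comp_s_s: "\<not> I \<simeq> J \<Longrightarrow> \<pi> \<circ> s I J \<circ> s I J = \<pi>"
  by (auto simp: s_invol)

lemma card_Inv_less_iff:
  assumes p: "\<pi> \<in> \<Gamma>" and IJ: "\<not> I \<simeq> J" "I < J"
  shows "card (Inv \<pi>) < card (Inv (\<pi> \<circ> s I J)) \<longleftrightarrow> \<pi> I < \<pi> J"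
proof (cases "\<pi> I < \<pi> J")
  case True
  then show ?thesis using card_Inv_less[OF assms] by simp
next
  case False
  then have "\<pi> J < \<pi> I" using G_eq[OF p, of I J] IJ by auto
  then have "card (Inv (\<pi> \<circ> s I J)) < card (Inv (\<pi> \<circ> s I J \<circ> s I J))"
    using card_Inv_less[OF G_comp[OF p s_in[OF IJ(1)]] IJ] s_left[OF IJ(1)] s_right[OF IJ(1)] by simp
  then show ?thesis using False comp_s_s[OF IJ(1), of \<pi>] by simp
qed

section \<open>The Bruhat order and lifting along simple reflections\<close>

definition ST :: "((int \<Rightarrow> int) \<times> (int \<Rightarrow> int)) set"
  where "ST = {(\<pi>, \<pi> \<circ> s I J) | \<pi> I J. \<pi> \<in> \<Gamma> \<and> \<not> I \<simeq> J \<and> I < J \<and> \<pi> I < \<pi> J}"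

abbreviation le (infix "\<preceq>" 50) where "u \<preceq> v \<equiv> (u, v) \<in> ST\<^sup>*"

lemma STI: "\<pi> \<in> \<Gamma> \<Longrightarrow> \<not> I \<simeq> J \<Longrightarrow> I < J \<Longrightarrow> \<pi> I < \<pi> J \<Longrightarrow> (\<pi>, \<pi> \<circ> s I J) \<in> ST"
  by (auto simp: ST_def)

lemma STE: assumes "(u, v) \<in> ST"
  obtains I J where "u \<in> \<Gamma>" "v \<in> \<Gamma>" "\<not> I \<simeq> J" "I < J" "u I < u J" "v = u \<circ> s I J"
  using assms G_comp s_in by (auto simp: ST_def)

lemma le_G: "u \<preceq> v \<Longrightarrow> u \<in> \<Gamma> \<longleftrightarrow> v \<in> \<Gamma>"
  by (induction rule: rtrancl_induct) (auto elim: STE)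

lemma le_card: "u \<preceq> v \<Longrightarrow> u = v \<or> card (Inv u) < card (Inv v)"
proof (induction rule: rtrancl_induct)
  case (step y z)
  have "card (Inv y) < card (Inv z)" using step(2) by (auto elim!: STE intro: card_Inv_less)
  then show ?case using step by auto
qed simp

lemma le_mono_left: assumes "\<omega> \<in> \<Gamma>" "strict_mono \<omega>" "u \<preceq> v" shows "\<omega> \<circ> u \<preceq> \<omega> \<circ> v"
  using assms(3)
proof (induction rule: rtrancl_induct)
  case (step y z)
  obtain I J where IJ: "y \<in> \<Gamma>" "\<not> I \<simeq> J" "I < J" "y I < y J" "z = y \<circ> s I J" using step(2) by (rule STE)
  have "(\<omega> \<circ> y, \<omega> \<circ> y \<circ> s I J) \<in> ST"
    using IJ assms by (intro STI G_comp) (auto simp: strict_mono_less)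
  then have "(\<omega> \<circ> y, \<omega> \<circ> z) \<in> ST" using IJ by (simp add: comp_assoc)
  then show ?case using step by (metis rtrancl_into_rtrancl)
qed simp

lemma le_mono_right: assumes "\<omega> \<in> \<Gamma>" "strict_mono \<omega>" "u \<preceq> v" shows "u \<circ> \<omega> \<preceq> v \<circ> \<omega>"
  using assms(3)
proof (induction rule: rtrancl_induct)
  case (step y z)
  obtain I J where IJ: "y \<in> \<Gamma>" "\<not> I \<simeq> J" "I < J" "y I < y J" "z = y \<circ> s I J" using step(2) by (rule STE)
  define A where "A = inv \<omega> I"
  define B where "B = inv \<omega> J"
  have AB: "\<omega> A = I" "\<omega> B = J" using AP_inv_r G_AP assms by (auto simp: A_def B_def)
  then have AB2: "A < B" "\<not> A \<simeq> B"
    using IJ G_res[OF assms(1), of A B] strict_mono_less[OF assms(2), of A B] by simp_all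
  have "(y \<circ> \<omega>, y \<circ> \<omega> \<circ> s A B) \<in> ST" using AB AB2 IJ assms by (intro STI G_comp) auto
  moreover have "y \<circ> \<omega> \<circ> s A B = z \<circ> \<omega>" using comp_s_eq[OF assms(1) AB2(2)] AB IJ by (simp add: comp_assoc)
  ultimately show ?case using step by (metis rtrancl_into_rtrancl)
qed simp

text \<open>A simple reflection is recognised by reversing no pair except those of its own
  reflection. Lifting uses just this, without reference to generators.\<close>

definition simple :: "(int \<Rightarrow> int) \<Rightarrow> bool"
  where "simple t \<longleftrightarrow> (\<exists>A B. \<not> A \<simeq> B \<and> A < B \<and> t = s A B) \<and>
     (\<forall>I J. \<not> I \<simeq> J \<longrightarrow> I < J \<longrightarrow> t I < t J \<or> s I J = t)"

lemma simple_facts: assumes "simple t" shows "t \<in> \<Gamma>" "t \<circ> t = id" "\<And>K. t (t K) = K"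
  using assms s_in s_invol by (auto simp: simple_def)

text \<open>Conjugation by \<open>t\<close> carries the reflection at \<open>I\<close>,
  \<open>J\<close> to the one at \<open>t I\<close>, \<open>t J\<close>, and this pair is still
  increasing unless the reflection is \<open>t\<close> itself.\<close>

lemma step_simple: assumes "simple t" "(u, v) \<in> ST"
  shows "u \<circ> t = v \<or> (u \<circ> t, v \<circ> t) \<in> ST"
proof -
  obtain I J where IJ: "u \<in> \<Gamma>" "\<not> I \<simeq> J" "I < J" "u I < u J" "v = u \<circ> s I J" using assms(2) by (rule STE)
  obtain A B where AB: "\<not> A \<simeq> B" "A < B" "t = s A B" using assms(1) by (auto simp: simple_def)
  have tt: "t (t K) = K" for K using simple_facts[OF assms(1)] by blast
  consider "s I J = t" | "t I < t J" using assms(1) IJ by (auto simp: simple_def)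
  then show ?thesis
  proof cases
    case 2
    have "s (t I) (t J) = t \<circ> s I J \<circ> t" using s_conj_s[OF AB(1) IJ(2)] AB(3) by simp
    then have "u \<circ> t \<circ> s (t I) (t J) = v \<circ> t" by (auto simp: IJ tt)
    moreover have "(u \<circ> t, u \<circ> t \<circ> s (t I) (t J)) \<in> ST"
      using IJ 2 simple_facts[OF assms(1)] G_res by (intro STI G_comp) (auto simp: tt)
    ultimately show ?thesis by simp
  qed (use IJ in auto)
qed

text \<open>Steps of the chain are multiplied by \<open>t\<close> one at a time. At the exception
  \<open>y \<circ> t = z\<close> one has \<open>z \<circ> t = y\<close>, and the chain up to
  \<open>y\<close> already gives the second alternative.\<close>

lemma lift_simple: assumes "simple t" "u \<preceq> v" shows "u \<circ> t \<preceq> v \<circ> t \<or> u \<preceq> v \<circ> t"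
  using assms(2)
proof (induction rule: rtrancl_induct)
  case (step y z)
  have tt: "y \<circ> t \<circ> t = y" using simple_facts[OF assms(1)] by (simp add: comp_assoc)
  show ?case
  proof (cases "y \<circ> t = z")
    case True
    then show ?thesis using step tt by auto
  next
    case False
    then have "(y \<circ> t, z \<circ> t) \<in> ST" using step_simple[OF assms(1) step(2)] by blast
    then show ?thesis using step rtrancl_into_rtrancl by metis
  qed
qed simp

lemma lift_simple': assumes "simple t" "u \<preceq> v" shows "u \<circ> t \<preceq> v \<circ> t \<or> u \<circ> t \<preceq> v"
  using assms(2)
proof (induction rule: converse_rtrancl_induct)
  case (step y z)
  have tt: "y \<circ> t \<circ> t = y" using simple_facts[OF assms(1)] by (simp add: comp_assoc)
  show ?case
  proof (cases "y \<circ> t = z")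
    case True
    then show ?thesis using step tt by auto
  next
    case False
    then have "(y \<circ> t, z \<circ> t) \<in> ST" using step_simple[OF assms(1) step(1)] by blast
    then show ?thesis using step converse_rtrancl_into_rtrancl by metis
  qed
qed simp

end

section \<open>Cosets and reduced elements\<close>

lemma descent_between:
  fixes f :: "int \<Rightarrow> 'a::linorder"
  assumes "I < J" "f J < f I"
  shows "\<exists>r. I \<le> r \<and> r < J \<and> f (r + 1) < f r"
proof (rule ccontr)
  assume "\<not> ?thesis"
  then have *: "\<And>r. I \<le> r \<Longrightarrow> r < J \<Longrightarrow> f r \<le> f (r + 1)" by (meson not_less)
  have "K \<le> J \<longrightarrow> f I \<le> f K" if "I \<le> K" for K
    using that
  proof (induction K rule: int_ge_induct)
    case (step i)
    then show ?case using *[of i] by auto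
  qed simp
  then show False using assms by (meson less_imp_le not_less order_refl)
qed

context refl_system
begin

lemma ST_card: "(u, v) \<in> ST \<Longrightarrow> card (Inv u) < card (Inv v)"
  by (auto elim!: STE intro: card_Inv_less)

lemma step_simple_left: assumes "simple t" "(u, v) \<in> ST"
  shows "t \<circ> u = v \<or> (t \<circ> u, t \<circ> v) \<in> ST"
proof -
  obtain I J where IJ: "u \<in> \<Gamma>" "\<not> I \<simeq> J" "I < J" "u I < u J" "v = u \<circ> s I J" using assms(2) by (rule STE)
  have "\<not> u I \<simeq> u J" using IJ G_res by blast
  then consider "s (u I) (u J) = t" | "t (u I) < t (u J)" using assms(1) IJ by (auto simp: simple_def)
  then show ?thesis
  proof cases
    case 1
    then show ?thesis using comp_s_eq[OF IJ(1,2)] IJ by simp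
  next
    case 2
    then have "(t \<circ> u, t \<circ> u \<circ> s I J) \<in> ST"
      using IJ simple_facts[OF assms(1)] by (intro STI G_comp) auto
    then show ?thesis using IJ by (simp add: comp_assoc)
  qed
qed

lemma lift_simple_left: assumes "simple t" "u \<preceq> v" shows "t \<circ> u \<preceq> t \<circ> v \<or> u \<preceq> t \<circ> v"
  using assms(2)
proof (induction rule: rtrancl_induct)
  case (step y z)
  have tt: "t \<circ> (t \<circ> y) = y" using simple_facts[OF assms(1)] by (simp add: comp_assoc[symmetric])
  show ?case
  proof (cases "t \<circ> y = z")
    case True
    then show ?thesis using step tt by auto
  next
    case False
    then have "(t \<circ> y, t \<circ> z) \<in> ST" using step_simple_left[OF assms(1) step(2)] by blast
    then show ?thesis using step rtrancl_into_rtrancl by metis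
  qed
qed simp

text \<open>Reflecting two values is the same as reflecting the positions \<open>inv x J\<close>,
  \<open>inv x I\<close> that hold them; values in the wrong order make this a step down.\<close>

lemma ST_reflect_left:
  assumes "x \<in> \<Gamma>" "\<not> I \<simeq> J" "I < J" "inv x J < inv x I"
  shows "(s I J \<circ> x, x) \<in> ST"
proof -
  define A where "A = inv x J"
  define B where "B = inv x I"
  have AB: "x A = J" "x B = I" "A < B" using assms AP_inv_r G_AP by (auto simp: A_def B_def)
  have nAB: "\<not> A \<simeq> B" using AB assms G_res[of x A B] res_sym by auto
  have "(s I J \<circ> x, s I J \<circ> x \<circ> s A B) \<in> ST"
    using AB nAB assms s_left s_right by (intro STI G_comp s_in) auto
  moreover have "s I J \<circ> x \<circ> s A B = x"
    using comp_s_eq[OF assms(1) nAB] AB s_commute[OF assms(2)] s_invol[OF assms(2)] by (auto simp: fun_eq_iff)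
  ultimately show ?thesis by simp
qed

end

context period
begin

sublocale GL: refl_system n AP rf
proof
  fix I J assume IJ: "\<not> I \<simeq> J"
  show "\<exists>\<epsilon>::int \<Rightarrow> int. \<forall>\<pi>\<in>AP. \<forall>K. \<pi> (rf I J K) = \<pi> K + \<epsilon> K * (\<pi> J - \<pi> I)"
    using rf_linear[OF _ IJ, of _ n] by (intro exI[of _ "ep I J"]) (auto simp: AP_def)
next
  fix I J
  have "K \<simeq> A + n \<longleftrightarrow> K \<simeq> A" for K A using dvd_add_left_iff[of n "-n" "K - A"] by (simp add: algebra_simps)
  then show "rf (I + n) (J + n) = rf I J" by (auto simp: rf_def fun_eq_iff)
qed (auto simp: AP_id rf_AP rf_left rf_invol intro: AP_comp AP_inv rf_conj)

text \<open>Since \<open>Y (omega m t) I = (I - t) div n\<close>, fixing the points \<open>omega m t\<close> with \<open>t \<in> T\<close> means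
  preserving the blocks into which the integers are cut at the translates of \<open>T\<close> by multiples of \<open>n\<close>.\<close>
definition blk :: "int set \<Rightarrow> int \<Rightarrow> int \<Rightarrow> bool"
  where "blk T I J \<longleftrightarrow> (\<forall>t\<in>T. (I - t) div n = (J - t) div n)"

definition PB :: "int set \<Rightarrow> (int \<Rightarrow> int) set"
  where "PB T = {\<pi> \<in> AP. \<forall>I. blk T (\<pi> I) I}"

text \<open>The minimal length representatives of the cosets \<open>PB T \<circ> \<pi>\<close>. As
  \<open>PB T\<close> acts on values, the values of a block have to occur at increasing
  positions.\<close>

definition red :: "int set \<Rightarrow> (int \<Rightarrow> int) \<Rightarrow> bool"
  where "red T \<pi> \<longleftrightarrow> (\<forall>I J. I < J \<longrightarrow> blk T I J \<longrightarrow> inv \<pi> I < inv \<pi> J)"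

lemma blk_sym: "blk T I J \<Longrightarrow> blk T J I" by (simp add: blk_def)
lemma blk_trans: "blk T I J \<Longrightarrow> blk T J K \<Longrightarrow> blk T I K" by (simp add: blk_def)

lemma blk_shift: "blk T (I + k * n) (J + k * n) \<longleftrightarrow> blk T I J"
proof -
  have "(I + k * n - t) div n = (I - t) div n + k" for I t
    using div_mult_self1[of n "I - t" k] n_pos by (simp add: algebra_simps)
  then show ?thesis by (simp add: blk_def)
qed

lemma blk_between: assumes "blk T I J" "I \<le> K" "K \<le> J" shows "blk T I K"
  unfolding blk_def
proof
  fix t assume "t \<in> T"
  moreover have "(I - t) div n \<le> (K - t) div n" "(K - t) div n \<le> (J - t) div n"
    using assms n_pos by (auto intro!: zdiv_mono1)
  ultimately show "(I - t) div n = (K - t) div n" using assms(1) by (fastforce simp: blk_def)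
qed

lemma blk_close: assumes "T \<noteq> {}" "blk T I J" shows "\<bar>I - J\<bar> < n"
proof -
  obtain t where t: "(I - t) div n = (J - t) div n" using assms by (auto simp: blk_def)
  define d where "d = (J - t) div n * n"
  have "d + (I - t) mod n = I - t" "d + (J - t) mod n = J - t"
    unfolding d_def t[symmetric] by (simp, simp add: t)
  then have "I - J = (I - t) mod n - (J - t) mod n" by simp
  then show ?thesis using pos_mod_bound[OF n_pos, of "I-t"] pos_mod_bound[OF n_pos, of "J-t"]
    pos_mod_sign[OF n_pos, of "I-t"] pos_mod_sign[OF n_pos, of "J-t"] by linarith
qed

text \<open>As \<open>T\<close> is nonempty, a block lies in a window of length \<open>n\<close>;
  its distinct members are incongruent, so the reflection exchanging them is available.\<close>

lemma blk_res: assumes "T \<noteq> {}" "blk T I J" "I < J" shows "\<not> I \<simeq> J"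
  using blk_close[OF assms(1,2)] assms(3) n_pos zdvd_imp_le[of n "J - I"] by (auto simp: dvd_diff_commute)

lemma blk_less: assumes "\<not> blk T I J" "blk T I I'" "blk T J J'" "I < J" shows "I' < J'"
proof -
  obtain t where t: "t \<in> T" "(I - t) div n \<noteq> (J - t) div n" using assms(1) by (auto simp: blk_def)
  have "(I - t) div n \<le> (J - t) div n" using assms(4) n_pos by (intro zdiv_mono1) auto
  then have "(I' - t) div n < (J' - t) div n" using t assms(2,3) by (auto simp: blk_def)
  then show ?thesis using zdiv_mono1[OF _ n_pos, of "J' - t" "I' - t"] by linarith
qed

lemma PB_AP: "q \<in> PB T \<Longrightarrow> q \<in> AP" by (simp add: PB_def)
lemma PB_blk: "q \<in> PB T \<Longrightarrow> blk T (q I) I" by (simp add: PB_def)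
lemma PB_id: "id \<in> PB T" by (simp add: PB_def AP_id blk_def)
lemma PB_comp: "p \<in> PB T \<Longrightarrow> q \<in> PB T \<Longrightarrow> p \<circ> q \<in> PB T"
  using AP_comp blk_trans unfolding PB_def by fastforce
lemma PB_inv: "p \<in> PB T \<Longrightarrow> inv p \<in> PB T"
proof -
  assume p: "p \<in> PB T"
  have "blk T (inv p I) I" for I
    using PB_blk[OF p, of "inv p I"] AP_inv_r[OF PB_AP[OF p], of I] blk_sym by simp
  then show ?thesis using AP_inv[OF PB_AP[OF p]] by (simp add: PB_def)
qed

lemma rf_PB: assumes "\<not> I \<simeq> J" "blk T I J" shows "rf I J \<in> PB T"
proof -
  have "blk T (rf I J K) K" for K
  proof -
    have 1: "blk T (K - A + B) K" if "K \<simeq> A" "blk T A B" for A B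
    proof -
      obtain k where k: "K = A + k * n" using \<open>K \<simeq> A\<close> by (rule resE)
      then show ?thesis using blk_shift[of T B k A] blk_sym that by (simp add: algebra_simps)
    qed
    show ?thesis using 1[of I J] 1[of J I] assms blk_sym by (auto simp: rf_def blk_def)
  qed
  then show ?thesis using rf_AP[OF assms(1)] by (simp add: PB_def)
qed

text \<open>On each block a reduced element and its block-preserving translate have increasing inverses,
  so the translating factor is an increasing bijection, that is, a shift.\<close>
lemma red_unique:
  assumes T: "T \<noteq> {}" and u: "u \<in> AP" "red T u" and q: "q \<in> PB T" "red T (q \<circ> u)"
  shows "q = id"
proof -
  define p where "p = inv q"
  have qA: "q \<in> AP" using q PB_AP by blast
  have pP: "p \<in> PB T" and pA: "p \<in> AP" using PB_inv PB_AP q by (auto simp: p_def)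
  have ic: "inv (q \<circ> u) = inv u \<circ> p" using AP_bij[OF qA] AP_bij[OF u(1)] by (simp add: p_def o_inv_distrib)
  have mono: "p I < p J" if "I < J" for I J
  proof (cases "blk T I J")
    case True
    have "inv u (p I) < inv u (p J)" using q(2) that True unfolding red_def ic by simp
    moreover have "blk T (p J) (p I)" using True PB_blk[OF pP] blk_sym blk_trans by metis
    ultimately show ?thesis using u(2) AP_eq[OF pA, of I J] that unfolding red_def
      by (metis less_asym linorder_neqE)
  next
    case False
    then show ?thesis using blk_less[OF False, of "p I" "p J"] PB_blk[OF pP] blk_sym that by metis
  qed
  have suc: "p (I + 1) = p I + 1" for I
  proof (rule ccontr)
    assume "p (I + 1) \<noteq> p I + 1"
    then have 1: "p I + 1 < p (I + 1)" "p I < p I + 1" using mono[of I "I + 1"] by auto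
    have 2: "p (q (p I + 1)) = p I + 1" using AP_inv_l[OF qA] by (simp add: p_def)
    have "I < q (p I + 1)" using 1 2 mono[of "q (p I + 1)" I] by (metis less_asym linorder_neqE less_irrefl)
    moreover have "q (p I + 1) < I + 1" using 1 2 mono[of "I + 1" "q (p I + 1)"]
      by (metis less_asym linorder_neqE less_irrefl)
    ultimately show False by linarith
  qed
  obtain t where t: "t \<in> T" using T by blast
  have "p (t + 1 * (k::int)) = p t + of_int k * 1" for k
    using shift_mult[of p 1 1 t k] suc by (simp add: mult.commute)
  then have sh: "p (t + k) = p t + k" for k by simp
  \<comment> \<open>The window from \<open>t\<close> to \<open>t + n - 1\<close> is a union of
    blocks, so the shift \<open>p\<close> preserves it; its two ends leave only the zero
    shift.\<close>
  have "(p t - t) div n = (t - t) div n" using PB_blk[OF pP, of t] t by (auto simp: blk_def)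
  then have ge: "p t \<ge> t" using n_pos pos_imp_zdiv_nonneg_iff[of n "p t - t"] by simp
  have "(p (t + (n - 1)) - t) div n = (t + (n - 1) - t) div n" using PB_blk[OF pP, of "t + (n - 1)"] t
    by (auto simp: blk_def)
  then have "(p t + (n - 1) - t) div n = 0" using sh[of "n - 1"] n_pos by simp
  then have "p t + (n - 1) - t < n" using n_pos by (metis add_0 div_mult_mod_eq mult_zero_left pos_mod_bound)
  then have "p t = t" using ge by simp
  then have "p K = K" for K using sh[of "K - t"] by simp
  then show ?thesis using AP_inv_r[OF qA] by (auto simp: p_def fun_eq_iff)
qed

end

context refl_system
begin

text \<open>A reduced element inverts only positions whose values lie in different blocks, and
  \<open>q\<close> cannot change the order of such values. So its inversions survive throughout the
  coset, which makes it shortest.\<close>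

lemma red_Inv_subset:
  assumes u: "u \<in> \<Gamma>" "red T u" and q: "q \<in> \<Gamma>" "q \<in> PB T"
  shows "Inv u \<subseteq> Inv (q \<circ> u)"
proof
  fix t assume "t \<in> Inv u"
  then obtain A B where AB: "t = s A B" "\<not> A \<simeq> B" "A < B" "u B < u A" by (auto simp: Inv_def)
  have "\<not> blk T (u B) (u A)"
  proof
    assume "blk T (u B) (u A)"
    then have "inv u (u B) < inv u (u A)" using u AB by (auto simp: red_def)
    then show False using AP_inv_l[OF G_AP[OF u(1)]] AB by simp
  qed
  then have "q (u B) < q (u A)" using blk_less AB PB_blk[OF q(2)] blk_sym by metis
  then show "t \<in> Inv (q \<circ> u)" using AB by (auto simp: Inv_def)
qed

text \<open>Reflecting a misordered pair of values inside a block stays in the coset and shortens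
  the element, so induction on length ends at a reduced one.\<close>

lemma red_below:
  assumes T: "T \<noteq> {}" and s_PB: "\<And>I J. \<not> I \<simeq> J \<Longrightarrow> blk T I J \<Longrightarrow> s I J \<in> PB T"
    and "x \<in> \<Gamma>"
  shows "\<exists>q\<in>\<Gamma> \<inter> PB T. red T (q \<circ> x) \<and> q \<circ> x \<preceq> x"
  using assms(3)
proof (induction "card (Inv x)" arbitrary: x rule: less_induct)
  case less
  show ?case
  proof (cases "red T x")
    case True
    then show ?thesis using G_id PB_id by (intro bexI[of _ id]) auto
  next
    case False
    then obtain I J where IJ: "I < J" "blk T I J" "\<not> inv x I < inv x J" by (auto simp: red_def)
    have n: "\<not> I \<simeq> J" using blk_res T IJ by blast
    have "inv x J < inv x I" using IJ AP_eq[OF AP_inv[OF G_AP[OF less(2)]], of I J] by auto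
    then have st: "(s I J \<circ> x, x) \<in> ST" using ST_reflect_left less(2) n IJ by blast
    then have "card (Inv (s I J \<circ> x)) < card (Inv x)" by (rule ST_card)
    then obtain q where q: "q \<in> \<Gamma> \<inter> PB T" "red T (q \<circ> (s I J \<circ> x))" "q \<circ> (s I J \<circ> x) \<preceq> s I J \<circ> x"
      using less(1)[of "s I J \<circ> x"] G_comp s_in n less(2) by blast
    have "q \<circ> s I J \<in> \<Gamma> \<inter> PB T" using q G_comp PB_comp s_in[OF n] s_PB[OF n IJ(2)] by auto
    moreover have "q \<circ> s I J \<circ> x \<preceq> x" using q(3) st by (metis comp_assoc rtrancl.rtrancl_into_rtrancl)
    moreover have "red T (q \<circ> s I J \<circ> x)" using q(2) by (simp add: comp_assoc)
    ultimately show ?thesis by blast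
  qed
qed

end

section \<open>Simple reflections in the GL case\<close>

locale gt1 = period +
  assumes n_gt1: "1 < n"
begin

lemma res_suc: "\<not> r \<simeq> r + 1" "\<not> r + 1 \<simeq> r" using n_gt1 by (auto simp: zdvd1_eq)

text \<open>The map moves every integer by at most 1, so it can reverse \<open>I < J\<close> only if
  \<open>J = I + 1\<close> and \<open>I\<close> moves up, that is,
  \<open>I \<simeq> r\<close>.\<close>

lemma rf_simple: "GL.simple (rf r (r + 1))"
  unfolding GL.simple_def
proof (intro conjI allI impI)
  show "\<exists>A B. \<not> A \<simeq> B \<and> A < B \<and> rf r (r + 1) = rf A B" using res_suc by (intro exI[of _ r] exI[of _ "r+1"]) auto
next
  fix I J assume IJ: "\<not> I \<simeq> J" "I < J"
  let ?t = "rf r (r + 1)"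
  show "?t I < ?t J \<or> rf I J = ?t"
  proof (rule disjCI)
    assume ne: "rf I J \<noteq> ?t"
    show "?t I < ?t J"
    proof (rule ccontr)
      assume "\<not> ?t I < ?t J"
      then have lt: "?t J < ?t I" using AP_eq[OF rf_AP[OF res_suc(1)], of r I J] IJ by auto
      have d: "?t K - K \<in> {-1, 0, 1} \<and> (?t K - K = 1 \<longleftrightarrow> K \<simeq> r)" for K using res_suc
        by (auto simp: rf_def)
      have "?t I - I = 1" "J = I + 1" using d[of I] d[of J] lt IJ by auto
      then have "I \<simeq> r" using d by blast
      then obtain k where "I = r + k * n" by (rule resE)
      then have "rf I J = ?t" using GL.s_shift_mult[of r k "r + 1"] \<open>J = I + 1\<close> by (simp add: algebra_simps)
      then show False using ne by simp
    qed
  qed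
qed

lemma AP_mono_or_descent: assumes "\<pi> \<in> AP" shows "strict_mono \<pi> \<or> (\<exists>r. \<pi> (r + 1) < \<pi> r)"
proof (rule disjCI)
  assume *: "\<nexists>r. \<pi> (r + 1) < \<pi> r"
  show "strict_mono \<pi>"
  proof (rule strict_monoI)
    fix I J :: int assume "I < J"
    then show "\<pi> I < \<pi> J" using descent_between[of I J \<pi>] * AP_eq[OF assms, of I J] by force
  qed
qed

lemma ST_suc: "\<pi> \<in> AP \<Longrightarrow> \<pi> r < \<pi> (r + 1) \<Longrightarrow> (\<pi>, \<pi> \<circ> rf r (r + 1)) \<in> GL.ST"
  using res_suc by (intro GL.STI) auto

lemma ST_suc': assumes "\<pi> \<in> AP" "\<pi> (r + 1) < \<pi> r" shows "(\<pi> \<circ> rf r (r + 1), \<pi>) \<in> GL.ST"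
  using ST_suc[of "\<pi> \<circ> rf r (r + 1)" r] assms GL.comp_s_s[OF res_suc(1), of \<pi> r] GL.G_comp rf_AP res_suc rf_left rf_right
  by simp

abbreviation GLle (infix "\<preceq>\<^sub>G" 50) where "u \<preceq>\<^sub>G v \<equiv> (u, v) \<in> GL.ST\<^sup>*"

lemma lift_asc: assumes "u \<preceq>\<^sub>G v" "u \<in> AP" "u r < u (r + 1)" shows "u \<preceq>\<^sub>G v \<circ> rf r (r + 1)"
  using GL.lift_simple[OF rf_simple[of r] assms(1)] ST_suc[OF assms(2,3)] by (meson converse_rtrancl_into_rtrancl)

lemma lift_desc: assumes "u \<preceq>\<^sub>G v" "u \<in> AP" "u (r + 1) < u r"
  shows "u \<circ> rf r (r + 1) \<preceq>\<^sub>G v \<circ> rf r (r + 1)"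
  using GL.lift_simple[OF rf_simple[of r] assms(1)] ST_suc'[OF assms(2,3)] by (meson converse_rtrancl_into_rtrancl)

text \<open>A misordered pair in a block yields an adjacent one. The simple reflection
  \<open>?t\<close> there lowers \<open>y\<close> but raises the reduced \<open>u\<close>, so either
  alternative of the lifting property puts \<open>u\<close> below
  \<open>?t \<circ> y\<close>.\<close>

lemma le_red:
  assumes T: "T \<noteq> {}" and u: "red T u" "u \<in> AP" and "u \<preceq>\<^sub>G y"
  shows "\<exists>q\<in>PB T. red T (q \<circ> y) \<and> u \<preceq>\<^sub>G q \<circ> y"
  using assms(4)
proof (induction "card (GL.Inv y)" arbitrary: y rule: less_induct)
  case less
  have yA: "y \<in> AP" using GL.le_G[OF less(2)] u by simp
  show ?case
  proof (cases "red T y")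
    case True
    then show ?thesis using PB_id less(2) by (intro bexI[of _ id]) auto
  next
    case False
    then obtain I J where IJ: "I < J" "blk T I J" "\<not> inv y I < inv y J" by (auto simp: red_def)
    have "inv y J < inv y I" using IJ AP_eq[OF AP_inv[OF yA], of I J] by auto
    then obtain r where r: "I \<le> r" "r < J" "inv y (r + 1) < inv y r" using descent_between IJ(1) by metis
    have "blk T I r" "blk T I (r + 1)" using blk_between[OF IJ(2)] r by auto
    then have b: "blk T r (r + 1)" using blk_sym blk_trans by blast
    let ?t = "rf r (r + 1)"
    have st: "(?t \<circ> y, y) \<in> GL.ST" using GL.ST_reflect_left[OF yA res_suc(1)] r by simp
    then have c: "card (GL.Inv (?t \<circ> y)) < card (GL.Inv y)" by (rule GL.ST_card)
    have "inv u r < inv u (r + 1)" using u(1) b by (auto simp: red_def)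
    moreover have "inv ?t = ?t" by (rule inv_equality) (rule rf_invol[OF res_suc(1)])+
    then have "inv (?t \<circ> u) = inv u \<circ> ?t"
      using AP_bij[OF rf_AP[OF res_suc(1), of r]] AP_bij[OF u(2)] by (simp add: o_inv_distrib)
    ultimately have "(?t \<circ> (?t \<circ> u), ?t \<circ> u) \<in> GL.ST"
      using GL.ST_reflect_left[of "?t \<circ> u" r "r+1"] rf_AP[OF res_suc(1), of r] AP_comp u(2) rf_left rf_right[OF res_suc(1)] res_suc(1)
      by simp
    moreover have "?t \<circ> (?t \<circ> u) = u" using rf_invol[OF res_suc(1), of r] by auto
    ultimately have "u \<preceq>\<^sub>G ?t \<circ> y" using GL.lift_simple_left[OF rf_simple[of r] less(2)]
      by (metis converse_rtrancl_into_rtrancl)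
    then obtain q where q: "q \<in> PB T" "red T (q \<circ> (?t \<circ> y))" "u \<preceq>\<^sub>G q \<circ> (?t \<circ> y)" using less(1)[OF c] by blast
    have "q \<circ> ?t \<in> PB T" using q PB_comp rf_PB[OF res_suc(1) b] by blast
    then show ?thesis using q by (metis comp_assoc)
  qed
qed

end

section \<open>The symplectic subsystem\<close>

locale even_period = period +
  assumes n_even: "even n"
begin

sublocale gt1 using n_pos n_even by unfold_locales presburger

text \<open>With coordinates numbered from 0 the duality is
  \<open>j \<mapsto> 2 * m - 1 - j\<close>; modulo \<open>n = 2 * m\<close> it becomes this
  involution.\<close>

definition bar :: "int \<Rightarrow> int" where "bar K = -1 - K"

lemma bar_bar: "bar (bar K) = K" by (simp add: bar_def)

lemma bar_res: "bar I \<simeq> bar J \<longleftrightarrow> I \<simeq> J" "bar I \<simeq> J \<longleftrightarrow> I \<simeq> bar J" "\<not> I \<simeq> bar I"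
proof -
  show "bar I \<simeq> bar J \<longleftrightarrow> I \<simeq> J" using dvd_diff_commute[of n I J] by (simp add: bar_def)
  show "bar I \<simeq> J \<longleftrightarrow> I \<simeq> bar J" using dvd_minus_iff[of n "bar I - J"] by (simp add: bar_def algebra_simps)
  have "odd (I - bar I)" by (simp add: bar_def)
  then show "\<not> I \<simeq> bar I" using n_even dvd_trans by blast
qed

lemma rf_bar: "bar (rf I J K) = rf (bar I) (bar J) (bar K)"
  unfolding rf_def bar_res by (simp add: bar_def)

text \<open>The constant \<open>c\<close> is the similitude factor that distinguishes
  \<open>GSp\<close> from \<open>Sp\<close>.\<close>

definition SP :: "(int \<Rightarrow> int) set"
  where "SP = {\<pi> \<in> AP. \<exists>c. \<forall>K. \<pi> (bar K) = bar (\<pi> K) + c * n}"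

text \<open>For \<open>I \<simeq> bar J\<close>, a long root, the mirrored reflection coincides with
  \<open>rf I J\<close> and is taken once; otherwise the two reflections commute and their product
  is symplectic.\<close>

definition rs :: "int \<Rightarrow> int \<Rightarrow> int \<Rightarrow> int"
  where "rs I J = (if I \<simeq> bar J then rf I J else rf I J \<circ> rf (bar J) (bar I))"

definition eps :: "int \<Rightarrow> int \<Rightarrow> int \<Rightarrow> int"
  where "eps I J K = (if I \<simeq> bar J then ep I J K else ep I J K + ep (bar J) (bar I) K)"

lemma bar_not_res: "\<not> I \<simeq> J \<Longrightarrow> \<not> bar J \<simeq> bar I"
  using bar_res(1) res_sym by blast

lemma bar_distinct: assumes "\<not> I \<simeq> bar J" "K \<simeq> bar J \<or> K \<simeq> bar I"
  shows "\<not> K \<simeq> I" "\<not> K \<simeq> J"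
proof -
  have *: False if "K \<simeq> A" "K \<simeq> B" "\<not> A \<simeq> B" for A B
    using that res_sym[of K A] res_trans[of A K B] by blast
  have "\<not> I \<simeq> bar J" "\<not> J \<simeq> bar I" "\<not> I \<simeq> bar I" "\<not> J \<simeq> bar J"
    using assms(1) bar_res res_sym by blast+
  then show "\<not> K \<simeq> I" "\<not> K \<simeq> J" using * assms(2) by blast+
qed

text \<open>Mirror symmetry gives \<open>y (bar I) - y (bar J) = y J - y I\<close>, so both factors
  contribute multiples of the same root value, and the inner factor does not disturb the coefficient
  of the outer one.\<close>

lemma rs_linear:
  fixes y :: "int \<Rightarrow> 'a::comm_ring_1"
  assumes y: "\<And>K. y (K + n) = y K + e" and b: "\<And>K. y (bar K) = C - y K" and IJ: "\<not> I \<simeq> J"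
  shows "y (rs I J K) = y K + of_int (eps I J K) * (y J - y I)"
proof (cases "I \<simeq> bar J")
  case True
  then show ?thesis using rf_linear[of y e, OF y IJ] by (simp add: rs_def eps_def)
next
  case False
  have IJ': "\<not> bar J \<simeq> bar I" using bar_not_res IJ .
  define L where "L = rf (bar J) (bar I) K"
  have ep: "ep I J L = ep I J K"
  proof (cases "K \<simeq> bar J \<or> K \<simeq> bar I")
    case True
    have "L \<simeq> bar J \<or> L \<simeq> bar I"
    proof (cases "K \<simeq> bar J")
      case True
      then show ?thesis by (auto simp: L_def rf_def)
    next
      case False
      then show ?thesis using \<open>K \<simeq> bar J \<or> K \<simeq> bar I\<close> by (auto simp: L_def rf_def)
    qed
    then show ?thesis using bar_distinct[OF False] True by (simp add: ep_def)
  next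
    case False
    then show ?thesis by (simp add: L_def rf_def)
  qed
  have "y (rs I J K) = y L + of_int (ep I J K) * (y J - y I)"
    using rf_linear[of y e I J L, OF y IJ] False ep by (simp add: rs_def L_def)
  also have "y L = y K + of_int (ep (bar J) (bar I) K) * (y (bar I) - y (bar J))"
    using rf_linear[of y e "bar J" "bar I" K, OF y IJ'] by (simp add: L_def)
  also have "y (bar I) - y (bar J) = y J - y I" by (simp add: b)
  finally show ?thesis using False by (simp add: eps_def algebra_simps)
qed

lemma SP_AP: "\<pi> \<in> SP \<Longrightarrow> \<pi> \<in> AP" by (simp add: SP_def)

lemma SP_bar: assumes "\<pi> \<in> SP" obtains c where "\<And>K. \<pi> (bar K) = bar (\<pi> K) + c * n"
  using assms by (auto simp: SP_def)

lemma rf_shift2: "rf (I + k * n) (J + k * n) = rf I J"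
  by (rule GL.s_shift_mult)

lemma rf_bar_comm: assumes "\<not> I \<simeq> J" "\<not> I \<simeq> bar J"
  shows "rf I J (rf (bar J) (bar I) K) = rf (bar J) (bar I) (rf I J K)"
proof -
  have "rf I J (bar J) = bar J" "rf I J (bar I) = bar I"
    using bar_distinct[OF assms(2)] by (auto simp: rf_def)
  then show ?thesis using rf_conj[OF rf_AP[OF assms(1)], of "bar J" "bar I" K] by simp
qed

lemma rs_bar: assumes "\<not> I \<simeq> J" shows "rs I J (bar K) = bar (rs I J K)"
proof (cases "I \<simeq> bar J")
  case True
  then obtain k where k: "I = bar J + k * n" by (rule resE)
  have "bar I = J + (-k) * n" "bar J = I + (-k) * n" using k by (simp_all add: bar_def algebra_simps)
  then have "rf (bar I) (bar J) = rf (J + (-k) * n) (I + (-k) * n)" by simp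
  then have "rf (bar I) (bar J) = rf I J" using rf_shift2[of J "-k" I] GL.s_commute[OF assms] by simp
  then show ?thesis using True rf_bar[of I J K] by (simp add: rs_def)
next
  case False
  show ?thesis using False rf_bar rf_bar_comm[OF assms False, of "bar K"] GL.s_commute[OF assms]
      GL.s_commute[OF bar_not_res[OF assms]] by (simp add: rs_def bar_bar)
qed

lemma rs_AP: "\<not> I \<simeq> J \<Longrightarrow> rs I J \<in> AP"
  using rf_AP bar_not_res by (auto simp: rs_def intro!: AP_comp)

lemma rs_SP: "\<not> I \<simeq> J \<Longrightarrow> rs I J \<in> SP"
  using rs_AP rs_bar by (auto simp: SP_def intro!: exI[of _ 0])

lemma SP_comp: assumes "\<pi> \<in> SP" "\<kappa> \<in> SP" shows "\<pi> \<circ> \<kappa> \<in> SP"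
proof -
  obtain c d where c: "\<And>K. \<pi> (bar K) = bar (\<pi> K) + c * n" and d: "\<And>K. \<kappa> (bar K) = bar (\<kappa> K) + d * n"
    using assms SP_bar by metis
  have "(\<pi> \<circ> \<kappa>) (bar K) = bar ((\<pi> \<circ> \<kappa>) K) + (c + d) * n" for K
    unfolding comp_apply d AP_shift[OF SP_AP[OF assms(1)]] c by (simp add: distrib_right)
  then show ?thesis using AP_comp[OF assms[THEN SP_AP]] unfolding SP_def by blast
qed

lemma SP_inv: assumes "\<pi> \<in> SP" shows "inv \<pi> \<in> SP"
proof -
  have A: "\<pi> \<in> AP" using assms SP_AP by blast
  obtain c where c: "\<And>K. \<pi> (bar K) = bar (\<pi> K) + c * n" using SP_bar assms by blast
  have "inv \<pi> (bar K) = bar (inv \<pi> K) + (-c) * n" for K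
  proof -
    have "\<pi> (bar (inv \<pi> K) + (-c) * n) = bar K" by (subst AP_shift[OF A]) (simp add: c AP_inv_r[OF A])
    then show ?thesis using AP_inv_l[OF A] by metis
  qed
  then show ?thesis using AP_inv[OF A] unfolding SP_def by blast
qed

lemma SP_res_bar: assumes "\<pi> \<in> SP" shows "\<pi> I \<simeq> bar (\<pi> J) \<longleftrightarrow> I \<simeq> bar J"
proof -
  obtain c where c: "\<And>K. \<pi> (bar K) = bar (\<pi> K) + c * n" using SP_bar assms by blast
  have "I \<simeq> bar J \<longleftrightarrow> \<pi> I \<simeq> \<pi> (bar J)" using AP_res[OF SP_AP[OF assms]] by simp
  also have "\<dots> \<longleftrightarrow> \<pi> I \<simeq> bar (\<pi> J)"
    using dvd_add_left_iff[of n "- (c * n)" "\<pi> I - bar (\<pi> J)"] by (simp add: c algebra_simps)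
  finally show ?thesis ..
qed

sublocale Sp: refl_system n SP rs
proof
  fix I J assume IJ: "\<not> I \<simeq> J"
  have "\<pi> (rs I J K) = \<pi> K + eps I J K * (\<pi> J - \<pi> I)" if \<pi>S: "\<pi> \<in> SP" for \<pi> K
  proof -
    obtain c where c: "\<And>K. \<pi> (bar K) = bar (\<pi> K) + c * n" using SP_bar[OF \<pi>S] by blast
    have "\<pi> (bar K) = (c * n - 1) - \<pi> K" for K using c[of K] by (simp add: bar_def)
    moreover have "\<pi> (K + n) = \<pi> K + n" for K using SP_AP[OF that] by (simp add: AP_def)
    ultimately show ?thesis using rs_linear[of \<pi> n "c * n - 1" I J K] IJ by simp
  qed
  then show "\<exists>\<epsilon>::int \<Rightarrow> int. \<forall>\<pi>\<in>SP. \<forall>K. \<pi> (rs I J K) = \<pi> K + \<epsilon> K * (\<pi> J - \<pi> I)"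
    by (intro exI[of _ "eps I J"]) auto
  show "rs I J I = J"
  proof (cases "I \<simeq> bar J")
    case False
    have "\<not> I \<simeq> bar I" "\<not> I \<simeq> bar J" using False bar_res by auto
    then show ?thesis using rf_left by (simp add: rs_def rf_other[of I "bar J" "bar I"])
  qed (simp add: rs_def rf_left)
  show "rs I J (rs I J K) = K" for K
    using rf_invol[OF IJ] rf_invol[OF bar_not_res[OF IJ]] rf_bar_comm[OF IJ] by (auto simp: rs_def)
  show "\<pi> (rs I J K) = rs (\<pi> I) (\<pi> J) (\<pi> K)" if \<pi>S: "\<pi> \<in> SP" for \<pi> K
  proof -
    obtain c where c: "\<And>K. \<pi> (bar K) = bar (\<pi> K) + c * n" using SP_bar[OF \<pi>S] by blast
    have "\<pi> (rf (bar J) (bar I) K) = rf (bar (\<pi> J)) (bar (\<pi> I)) (\<pi> K)" for K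
      using rf_conj[OF SP_AP[OF that], of "bar J" "bar I" K] rf_shift2 by (simp add: c)
    then show ?thesis using SP_res_bar[OF that] rf_conj[OF SP_AP[OF that]] by (simp add: rs_def)
  qed
next
  fix I J
  have 1: "bar (K + n) = bar K + (-1) * n" for K by (simp add: bar_def)
  have "I + n \<simeq> bar (J + n) \<longleftrightarrow> I \<simeq> bar J"
    using dvd_add_right_iff[of n "2 * n" "I - bar J"] by (simp add: bar_def algebra_simps)
  then show "rs (I + n) (J + n) = rs I J"
    using rf_shift2[of I 1 J] rf_shift2[of "bar J" "-1" "bar I"] by (simp add: rs_def 1)
next
  show "id \<in> SP" using AP_id by (auto simp: SP_def intro: exI[of _ 0])
qed (auto simp: rs_SP SP_AP intro: SP_comp SP_inv)

abbreviation Sple (infix "\<preceq>\<^sub>S" 50) where "u \<preceq>\<^sub>S v \<equiv> (u, v) \<in> Sp.ST\<^sup>*"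

text \<open>A step at a short root is two GL steps: the mirrored pair \<open>bar J < bar I\<close>
  has increasing images too, and its places are untouched by the first reflection.\<close>

lemma Sp_le_imp_GL_le: assumes "u \<preceq>\<^sub>S v" shows "u \<preceq>\<^sub>G v"
  using assms
proof (induction rule: rtrancl_induct)
  case (step y z)
  obtain I J where IJ: "y \<in> SP" "\<not> I \<simeq> J" "I < J" "y I < y J" "z = y \<circ> rs I J" using step(2) by (rule Sp.STE)
  have A: "y \<in> AP" using IJ SP_AP by blast
  have st: "(y, y \<circ> rf I J) \<in> GL.ST" using IJ A by (intro GL.STI)
  show ?case
  proof (cases "I \<simeq> bar J")
    case True
    then have "(y, z) \<in> GL.ST" using IJ st by (simp add: rs_def)
    then show ?thesis using step(3) by (rule rtrancl_into_rtrancl[rotated])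
  next
    case False
    obtain c where c: "\<And>K. y (bar K) = bar (y K) + c * n" using SP_bar IJ by blast
    have "rf I J (bar J) = bar J" "rf I J (bar I) = bar I"
      using bar_distinct[OF False] by (auto simp: rf_def)
    then have "(y \<circ> rf I J, y \<circ> rf I J \<circ> rf (bar J) (bar I)) \<in> GL.ST"
      using IJ A bar_not_res[OF IJ(2)] rf_AP AP_comp by (intro GL.STI) (auto simp: c, auto simp: bar_def)
    moreover have "y \<circ> rf I J \<circ> rf (bar J) (bar I) = z" using False IJ by (simp add: rs_def comp_assoc)
    ultimately show ?thesis using step(3) st by (metis rtrancl.rtrancl_into_rtrancl)
  qed
qed simp

text \<open>Each GL factor of \<open>rs r (r + 1)\<close> is simple, so a pair reversed by the
  product has one of these factors as its GL reflection, and that factor in turn determines the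
  symplectic reflection.\<close>

lemma rs_suc_simple: "Sp.simple (rs r (r + 1))"
  unfolding Sp.simple_def
proof (intro conjI allI impI)
  show "\<exists>A B. \<not> A \<simeq> B \<and> A < B \<and> rs r (r + 1) = rs A B" using res_suc by (intro exI[of _ r] exI[of _ "r+1"]) auto
next
  fix I J assume IJ: "\<not> I \<simeq> J" "I < J"
  have s1: "rf A (A+1) I' < rf A (A+1) J' \<or> rf I' J' = rf A (A+1)" if "\<not> I' \<simeq> J'" "I' < J'" for A I' J'
    using rf_simple[of A] that by (auto simp: GL.simple_def)
  have b: "bar (r + 1) + 1 = bar r" by (simp add: bar_def)
  show "rs r (r + 1) I < rs r (r + 1) J \<or> rs I J = rs r (r + 1)"
  proof (cases "r \<simeq> bar (r + 1)")
    case True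
    \<comment> \<open>In the long root case \<open>rf I J\<close> commutes with \<open>bar\<close>,
      which forces \<open>I\<close> and \<open>J\<close> to be mirror images as well.\<close>
    have "rf I J = rf r (r + 1) \<Longrightarrow> rs I J = rs r (r + 1)"
    proof -
      assume eq: "rf I J = rf r (r + 1)"
      have "bar (rf r (r + 1) K) = rf r (r + 1) (bar K)" for K using rs_bar[OF res_suc(1), of r K] True by (simp add: rs_def)
      then have "bar J = rf I J (bar I)" using eq rf_left by metis
      moreover have "\<not> J = I" using IJ by auto
      ultimately have "bar I \<simeq> I \<or> bar I \<simeq> J" by (auto simp: rf_def bar_def split: if_splits)
      then have "I \<simeq> bar J" using bar_res res_sym by blast
      then show ?thesis using eq True by (simp add: rs_def)
    qed
    then show ?thesis using s1[OF IJ, of r] True by (auto simp: rs_def)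
  next
    case False
    let ?a = "rf r (r + 1)" and ?b = "rf (bar (r + 1)) (bar r)"
    have rs: "rs r (r + 1) K = ?a (?b K)" for K using False by (simp add: rs_def)
    \<comment> \<open>A GL reflection that is not at a mirror pair determines its symplectic double;
      whether it is at a mirror pair can be seen from the two classes it moves.\<close>
    have rf_rs: "rs A B = rs C D" if "rf A B = rf C D" "\<not> A \<simeq> B" and nCD: "\<not> C \<simeq> D" and "\<not> C \<simeq> bar D" for A B C D
    proof -
      have "rf (bar B) (bar A) = rf (bar D) (bar C)"
      proof
        fix K
        have "rf (bar B) (bar A) K = bar (rf B A (bar K))" using rf_bar[of B A "bar K"] by (simp add: bar_bar)
        also have "\<dots> = bar (rf D C (bar K))" using that GL.s_commute by metis
        also have "\<dots> = rf (bar D) (bar C) K" using rf_bar[of D C "bar K"] by (simp add: bar_bar)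
        finally show "rf (bar B) (bar A) K = rf (bar D) (bar C) K" .
      qed
      moreover have "\<not> A \<simeq> bar B"
      proof
        assume AB: "A \<simeq> bar B"
        have inA: "K \<simeq> A \<or> K \<simeq> B" if "rf A B K \<noteq> K" for K using that rf_other by blast
        have "C \<noteq> D" using that by auto
        then have "C \<simeq> A \<or> C \<simeq> B" "D \<simeq> A \<or> D \<simeq> B"
          using inA[of C] inA[of D] that rf_left[of C D] rf_right[OF that(3)] by auto
        moreover have BA: "B \<simeq> bar A" using AB bar_res res_sym by blast
        ultimately consider "C \<simeq> A" "D \<simeq> B" | "C \<simeq> B" "D \<simeq> A" using nCD res_sym res_trans by blast
        then have "C \<simeq> bar D"
        proof cases
          case 1
          then have "bar B \<simeq> bar D" using bar_res(1) res_sym by blast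
          then show ?thesis using 1 AB res_trans by blast
        next
          case 2
          then have "bar A \<simeq> bar D" using bar_res(1) res_sym by blast
          then show ?thesis using 2 BA res_trans by blast
        qed
        then show False using that by simp
      qed
      ultimately show ?thesis using that by (simp add: rs_def)
    qed
    consider "rf I J = ?b" | "?b I < ?b J" using s1[OF IJ, of "bar (r + 1)"] b by auto
    then show ?thesis
    proof cases
      case 1
      have "rs I J = rs (bar (r+1)) (bar r)"
        using 1 False bar_res res_sym by (intro rf_rs IJ bar_not_res[OF res_suc(1)]) (auto simp: bar_bar)
      also have "\<dots> = rs r (r + 1)"
        using False bar_res res_sym rf_bar_comm[OF res_suc(1) False] by (auto simp: rs_def bar_bar fun_eq_iff)
      finally show ?thesis by simp
    next
      case 2
      have n: "\<not> ?b I \<simeq> ?b J" using AP_res[OF rf_AP[OF bar_not_res[OF res_suc(1)]]] IJ by simp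
      consider "rf (?b I) (?b J) = ?a" | "?a (?b I) < ?a (?b J)" using s1[OF n 2, of r] by auto
      then show ?thesis
      proof cases
        case 1
        have bb: "?b (?b K) = K" for K using rf_invol[OF bar_not_res[OF res_suc(1)]] .
        have "rf I J K = ?a K" for K
        proof -
          have "?b (rf I J K) = rf (?b I) (?b J) (?b K)"
            using rf_conj[OF rf_AP[OF bar_not_res[OF res_suc(1)]], of r I J K] by simp
          also have "\<dots> = ?b (?a K)" using 1 rf_bar_comm[OF res_suc(1) False] by simp
          finally have "?b (rf I J K) = ?b (?a K)" .
          then show ?thesis using 1 bb by metis
        qed
        then have "rf I J = ?a" by auto
        then show ?thesis using rf_rs[OF _ IJ(1) res_suc(1) False] by simp
      qed (simp add: rs)
    qed
  qed
qed

text \<open>Induction on the GL length of \<open>v\<close>, with a descent \<open>r\<close> of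
  \<open>v\<close>. By the symmetry of \<open>u\<close>, the mirrored adjacent pair is an ascent or
  descent of \<open>u\<close> together with \<open>r\<close>, so GL lifting applies to both factors
  of \<open>rs r (r + 1)\<close> in the same way.\<close>

lemma GL_le_imp_Sp_le: assumes "u \<preceq>\<^sub>G v" "u \<in> SP" "v \<in> SP" shows "u \<preceq>\<^sub>S v"
  using assms
proof (induction "card (GL.Inv v)" arbitrary: u v rule: less_induct)
  case less
  have uA: "u \<in> AP" and vA: "v \<in> AP" using less SP_AP by auto
  show ?case
  proof (cases "strict_mono v")
    case True
    then have "GL.Inv v = {}" by (auto simp: GL.Inv_def strict_mono_less)
    then show ?thesis using GL.le_card[OF less(2)] by simp
  next
    case False
    then obtain r where r: "v (r + 1) < v r" using AP_mono_or_descent vA by blast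
    let ?t = "rs r (r + 1)"
    have tt: "w \<circ> ?t \<circ> ?t = w" for w using Sp.comp_s_s[OF res_suc(1)] .
    have main: "(u r < u (r + 1) \<and> u \<preceq>\<^sub>G v \<circ> ?t) \<or> (u (r + 1) < u r \<and> u \<circ> ?t \<preceq>\<^sub>G v \<circ> ?t)"
    proof (cases "r \<simeq> bar (r + 1)")
      case True
      then have "?t = rf r (r + 1)" by (simp add: rs_def)
      moreover have "u r < u (r + 1) \<or> u (r + 1) < u r" using AP_eq[OF uA, of r "r+1"] by auto
      ultimately show ?thesis using lift_asc[OF less(2) uA, of r] lift_desc[OF less(2) uA, of r] by metis
    next
      case False
      let ?a = "rf r (r + 1)" and ?q = "bar (r + 1)"
      let ?b = "rf ?q (?q + 1)"
      have b: "?q + 1 = bar r" by (simp add: bar_def)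
      have t: "?t = ?a \<circ> ?b" using False by (simp add: rs_def b)
      obtain c where c: "\<And>K. u (bar K) = bar (u K) + c * n" using SP_bar less by blast
      have q: "u ?q < u (?q + 1) \<longleftrightarrow> u r < u (r + 1)" "u (?q + 1) < u ?q \<longleftrightarrow> u (r + 1) < u r"
        unfolding b c by (auto simp: bar_def)
      have fx: "?a ?q = ?q" "?a (?q + 1) = ?q + 1" unfolding b using bar_distinct[OF False] by (auto simp: rf_def)
      show ?thesis
      proof (cases "u r < u (r + 1)")
        case True
        have "u \<preceq>\<^sub>G v \<circ> ?a" using lift_asc[OF less(2) uA True] .
        then have "u \<preceq>\<^sub>G v \<circ> ?a \<circ> ?b" using lift_asc uA True q by blast
        then show ?thesis using True t by (simp add: comp_assoc)
      next
        case ge: False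
        then have lt: "u (r + 1) < u r" using AP_eq[OF uA, of r "r+1"] by auto
        have "u \<circ> ?a \<preceq>\<^sub>G v \<circ> ?a" using lift_desc[OF less(2) uA lt] .
        then have "u \<circ> ?a \<circ> ?b \<preceq>\<^sub>G v \<circ> ?a \<circ> ?b" 
          using lt q fx AP_comp[OF uA rf_AP[OF res_suc(1), of r]] lift_desc[of "u \<circ> ?a" "v \<circ> ?a" ?q] by simp
        then show ?thesis using lt t by (simp add: comp_assoc)
      qed
    qed
    have vt: "v \<circ> ?t \<in> SP" and ut: "u \<circ> ?t \<in> SP" using less SP_comp rs_SP res_suc by blast+
    have st: "(v \<circ> ?t, v) \<in> Sp.ST"
      using Sp.STI[OF vt res_suc(1), of r] r Sp.s_left[OF res_suc(1), of r] Sp.s_right[OF res_suc(1), of r] tt[of v] by simp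
    have "v \<circ> ?t \<preceq>\<^sub>G v" using st Sp_le_imp_GL_le by blast
    then have "v \<circ> ?t = v \<or> card (GL.Inv (v \<circ> ?t)) < card (GL.Inv v)" using GL.le_card by blast
    moreover have "v \<circ> ?t \<noteq> v"
    proof
      assume "v \<circ> ?t = v"
      then have "v (?t r) = v r" by (simp add: fun_eq_iff)
      then show False using AP_eq[OF vA] Sp.s_left[OF res_suc(1), of r] by simp
    qed
    ultimately have c: "card (GL.Inv (v \<circ> ?t)) < card (GL.Inv v)" by simp
    from main show ?thesis
    proof
      assume "u r < u (r + 1) \<and> u \<preceq>\<^sub>G v \<circ> ?t"
      then have "u \<preceq>\<^sub>S v \<circ> ?t" using less(1)[OF c] less vt by blast
      then show ?thesis using st by simp
    next
      assume "u (r + 1) < u r \<and> u \<circ> ?t \<preceq>\<^sub>G v \<circ> ?t"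
      then have "u \<circ> ?t \<preceq>\<^sub>S v \<circ> ?t" using less(1)[OF c] ut vt by blast
      then have "u \<preceq>\<^sub>S v \<or> u \<preceq>\<^sub>S v \<circ> ?t" using Sp.lift_simple'[OF rs_suc_simple[of r]] tt by metis
      then show ?thesis using st by auto
    qed
  qed
qed

text \<open>For \<open>T = -T\<close> the mirror reverses the cutting into blocks:
  \<open>(bar K - t) div n = -1 - (K + t) div n\<close>.\<close>

lemma blk_bar: assumes "uminus ` T = T" "blk T I J" shows "blk T (bar J) (bar I)"
  unfolding blk_def
proof
  fix t assume "t \<in> T"
  then have "- t \<in> T" using assms(1) by blast
  then have 1: "(I - (- t)) div n = (J - (- t)) div n" using assms(2) unfolding blk_def by blast
  have "(bar K - t) div n = - 1 - (K - (- t)) div n" for K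
  proof -
    have "(-1 - a) div n = -1 - a div n" for a
    proof -
      have "-1 - a = (n - 1 - a mod n) + (- 1 - a div n) * n" by (simp add: algebra_simps)
      moreover have "(n - 1 - a mod n) div n = 0"
        using pos_mod_bound[OF n_pos, of a] pos_mod_sign[OF n_pos, of a] by (intro div_pos_pos_trivial) linarith+
      ultimately show ?thesis using n_pos by (metis add_0 div_mult_self1 less_irrefl add.commute)
    qed
    from this[of "K + t"] show ?thesis by (simp add: bar_def algebra_simps)
  qed
  then show "(bar J - t) div n = (bar I - t) div n" using 1 by simp
qed

lemma rs_PB: assumes "uminus ` T = T" "\<not> I \<simeq> J" "blk T I J" shows "rs I J \<in> PB T"
  using rf_PB[OF assms(2,3)] PB_comp[OF rf_PB[OF assms(2,3)] rf_PB[OF bar_not_res[OF assms(2)] blk_bar[OF assms(1,3)]]]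
  by (simp add: rs_def)

end

section \<open>Obtuse cones\<close>

context gt1
begin

definition per :: "(int \<Rightarrow> int) set" where "per = {l. \<forall>K. l (K + n) = l K}"

definition tau :: "(int \<Rightarrow> int) \<Rightarrow> int \<Rightarrow> int" where "tau l I = I + n * l I"

text \<open>Injectivity on residues makes the direction regular, so every reflection goes strictly
  up or down along it.\<close>

definition orient :: "(int \<Rightarrow> int) \<Rightarrow> bool"
  where "orient \<rho> \<longleftrightarrow> \<rho> \<in> per \<and> (\<forall>I J. \<rho> I = \<rho> J \<longrightarrow> I \<simeq> J)"

text \<open>Reflections moving up in the direction of the Weyl chamber determined by the linear order
  that \<open>\<rho>\<close> induces on the residues.\<close>
definition UP :: "(int \<Rightarrow> int) \<Rightarrow> ((int \<Rightarrow> int) \<times> (int \<Rightarrow> int)) set"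
  where "UP \<rho> = {(\<pi>, \<pi> \<circ> rf I J) | \<pi> I J. \<pi> \<in> AP \<and> \<not> I \<simeq> J \<and> \<rho> J < \<rho> I \<and> \<pi> I < \<pi> J}"

lemma per_shift: "l \<in> per \<Longrightarrow> l (I + k * n) = l I"
  using shift_mult[of l n 0 I k] by (simp add: per_def)

lemma per_res: "l \<in> per \<Longrightarrow> I \<simeq> J \<Longrightarrow> l I = l J"
  using per_shift resE by metis

lemma per_mod: "l \<in> per \<Longrightarrow> l (I mod n) = l I"
  using per_shift[of l "I mod n" "I div n"] by simp

lemma per_comp: "l \<in> per \<Longrightarrow> \<kappa> \<in> AP \<Longrightarrow> l \<circ> \<kappa> \<in> per" by (simp add: per_def AP_def)

lemma tau_tau: assumes "l \<in> per" shows "tau l (tau (\<lambda>I. - l I) I) = I"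
proof -
  have "l (I - n * l I) = l I" using per_shift[OF assms, of I "- l I"] by (simp add: algebra_simps)
  then show ?thesis by (simp add: tau_def)
qed

lemma tau_AP: assumes "l \<in> per" shows "tau l \<in> AP"
proof -
  have "(\<lambda>I. - l I) \<in> per" using assms by (simp add: per_def)
  then have "tau (\<lambda>I. - l I) (tau l I) = I" for I using tau_tau[of "\<lambda>I. - l I" I] by simp
  then have "bij (tau l)" using tau_tau[OF assms] by (intro o_bij[of "tau (\<lambda>I. - l I)"]) auto
  then show ?thesis using assms by (simp add: AP_def tau_def per_def)
qed

lemma inv_tau: "l \<in> per \<Longrightarrow> inv (tau l) = tau (\<lambda>I. - l I)"
  using tau_tau[of l] tau_tau[of "\<lambda>I. - l I"] by (intro inv_equality) (auto simp: per_def)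

lemma per_tau: "\<rho> \<in> per \<Longrightarrow> l \<in> per \<Longrightarrow> \<rho> \<circ> tau l = \<rho>"
  by (rule ext, simp, rule per_res) (auto simp: tau_def)

lemma orient_comp: "orient \<rho> \<Longrightarrow> \<kappa> \<in> AP \<Longrightarrow> orient (\<rho> \<circ> \<kappa>)"
  unfolding orient_def using per_comp AP_res by (metis comp_apply)

lemma UPI: "\<pi> \<in> AP \<Longrightarrow> \<not> I \<simeq> J \<Longrightarrow> \<rho> J < \<rho> I \<Longrightarrow> \<pi> I < \<pi> J \<Longrightarrow> (\<pi>, \<pi> \<circ> rf I J) \<in> UP \<rho>"
  by (auto simp: UP_def)

lemma UPE: assumes "(u, v) \<in> UP \<rho>"
  obtains I J where "u \<in> AP" "\<not> I \<simeq> J" "\<rho> J < \<rho> I" "u I < u J" "v = u \<circ> rf I J"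
  using assms by (auto simp: UP_def)

lemma comp_rf_comp: assumes "\<kappa> \<in> AP"
  shows "u \<circ> rf I J \<circ> \<kappa> = u \<circ> \<kappa> \<circ> rf (inv \<kappa> I) (inv \<kappa> J)"
  using rf_conj[OF assms, of "inv \<kappa> I" "inv \<kappa> J"] AP_inv_r[OF assms] by (auto simp: fun_eq_iff)

lemma UP_comp: assumes "(u, v) \<in> UP \<rho>" "\<kappa> \<in> AP" shows "(u \<circ> \<kappa>, v \<circ> \<kappa>) \<in> UP (\<rho> \<circ> \<kappa>)"
proof -
  obtain I J where IJ: "u \<in> AP" "\<not> I \<simeq> J" "\<rho> J < \<rho> I" "u I < u J" "v = u \<circ> rf I J" using assms(1) by (rule UPE)
  have "(u \<circ> \<kappa>, u \<circ> \<kappa> \<circ> rf (inv \<kappa> I) (inv \<kappa> J)) \<in> UP (\<rho> \<circ> \<kappa>)"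
    using IJ AP_comp[OF IJ(1) assms(2)] AP_inv_r[OF assms(2)] AP_res[OF AP_inv[OF assms(2)]] by (intro UPI) auto
  then show ?thesis unfolding IJ(5) comp_rf_comp[OF assms(2)] .
qed

lemma UPs_comp: assumes "(u, v) \<in> (UP \<rho>)\<^sup>*" "\<kappa> \<in> AP" shows "(u \<circ> \<kappa>, v \<circ> \<kappa>) \<in> (UP (\<rho> \<circ> \<kappa>))\<^sup>*"
  using assms(1)
proof (induction rule: rtrancl_induct)
  case (step y z)
  then show ?case using UP_comp[OF step(2) assms(2)] by (rule_tac rtrancl_into_rtrancl)
qed simp

lemma tau_rf: assumes "l \<in> per" "\<not> I \<simeq> J" shows "tau l \<circ> rf I J = rf I J \<circ> tau (l \<circ> rf I J)"
proof
  fix K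
  show "(tau l \<circ> rf I J) K = (rf I J \<circ> tau (l \<circ> rf I J)) K"
    using AP_shift[OF rf_AP[OF assms(2)], of K "l (rf I J K)"] by (simp add: tau_def mult.commute)
qed

text \<open>Membership in all obtuse cones passes down a Bruhat step. If the step goes up along
  \<open>\<rho>\<close> it is prepended; otherwise the path of \<open>v\<close> for the reflected
  chamber is carried back by \<open>?t\<close>.\<close>

lemma obtuse_step:
  assumes L: "L \<subseteq> per" "\<And>l I J. l \<in> L \<Longrightarrow> \<not> I \<simeq> J \<Longrightarrow> l \<circ> rf I J \<in> L"
    and st: "(u, v) \<in> GL.ST" and v: "\<And>\<rho>. orient \<rho> \<Longrightarrow> \<exists>l\<in>L. (v, tau l) \<in> (UP \<rho>)\<^sup>*"
    and \<rho>: "orient \<rho>"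
  shows "\<exists>l\<in>L. (u, tau l) \<in> (UP \<rho>)\<^sup>*"
proof -
  obtain I J where IJ: "u \<in> AP" "v \<in> AP" "\<not> I \<simeq> J" "I < J" "u I < u J" "v = u \<circ> rf I J" using st by (rule GL.STE)
  have "\<rho> I \<noteq> \<rho> J" using \<rho> IJ by (auto simp: orient_def)
  then consider "\<rho> J < \<rho> I" | "\<rho> I < \<rho> J" by linarith
  then show ?thesis
  proof cases
    case 1
    then have "(u, v) \<in> UP \<rho>" using IJ UPI by simp
    then show ?thesis using v[OF \<rho>] by (meson converse_rtrancl_into_rtrancl)
  next
    case 2
    let ?t = "rf I J"
    have tA: "?t \<in> AP" using rf_AP IJ by blast
    have tt: "w \<circ> ?t \<circ> ?t = w" for w :: "int \<Rightarrow> int" using rf_invol[OF IJ(3)] by auto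
    \<comment> \<open>Composed with \<open>?t\<close>, a path for the chamber
      \<open>\<rho> \<circ> ?t\<close> becomes a path for \<open>\<rho>\<close> starting at
      \<open>u\<close>. It ends at \<open>?t \<circ> tau (l \<circ> ?t)\<close>, and one further
      step along \<open>\<rho>\<close> removes the factor \<open>?t\<close>.\<close>
    obtain l where l: "l \<in> L" "(v, tau l) \<in> (UP (\<rho> \<circ> ?t))\<^sup>*" using v[OF orient_comp[OF \<rho> tA]] by blast
    have l': "l \<circ> ?t \<in> L" using l L IJ by blast
    then have l'p: "l \<circ> ?t \<in> per" using L by blast
    have "(v \<circ> ?t, tau l \<circ> ?t) \<in> (UP (\<rho> \<circ> ?t \<circ> ?t))\<^sup>*" using UPs_comp[OF l(2) tA] .
    then have 1: "(u, ?t \<circ> tau (l \<circ> ?t)) \<in> (UP \<rho>)\<^sup>*"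
      using tau_rf[of l I J] l L IJ by (simp add: tt subset_iff)
    have "(?t, ?t \<circ> rf J I) \<in> UP \<rho>"
      using tA IJ 2 res_sym rf_left rf_right by (intro UPI) auto
    then have "(?t, id) \<in> UP \<rho>" using GL.s_commute[OF IJ(3)] rf_invol[OF IJ(3)] by (simp add: fun_eq_iff[symmetric] comp_def id_def)
    then have "(?t \<circ> tau (l \<circ> ?t), tau (l \<circ> ?t)) \<in> UP \<rho>"
      using UP_comp[OF _ tau_AP[OF l'p], of ?t id \<rho>] per_tau[of \<rho>] \<rho> l'p by (simp add: orient_def)
    then show ?thesis using 1 l' by (meson rtrancl.rtrancl_into_rtrancl)
  qed
qed

lemma admissible_in_obtuse_cones:
  assumes L: "L \<subseteq> per" "\<And>l I J. l \<in> L \<Longrightarrow> \<not> I \<simeq> J \<Longrightarrow> l \<circ> rf I J \<in> L"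
    and "x \<preceq>\<^sub>G tau l0" "l0 \<in> L" "orient \<rho>"
  shows "\<exists>l\<in>L. (x, tau l) \<in> (UP \<rho>)\<^sup>*"
  using assms(3,5)
proof (induction arbitrary: \<rho> rule: converse_rtrancl_induct)
  case base
  then show ?case using assms(4) by blast
next
  case (step y z)
  then show ?case using obtuse_step[OF L step(1)] by blast
qed

text \<open>Translation by \<open>N * \<rho>\<close> moves the places of \<open>I\<close> and
  \<open>J\<close> apart by \<open>n * N * (\<rho> I - \<rho> J)\<close>, so for \<open>N\<close>
  larger than their distance the step becomes a Bruhat step. A path has finitely many steps and thus
  a common bound.\<close>

lemma UP_translate:
  assumes "\<rho> \<in> per" "(x, y) \<in> (UP \<rho>)\<^sup>*"
  shows "\<exists>N0. \<forall>N\<ge>N0. x \<circ> tau (\<lambda>I. N * \<rho> I) \<preceq>\<^sub>G y \<circ> tau (\<lambda>I. N * \<rho> I)"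
  using assms(2)
proof (induction rule: rtrancl_induct)
  case (step y z)
  obtain N0 where N0: "\<And>N. N \<ge> N0 \<Longrightarrow> x \<circ> tau (\<lambda>I. N * \<rho> I) \<preceq>\<^sub>G y \<circ> tau (\<lambda>I. N * \<rho> I)" using step by blast
  obtain I J where IJ: "y \<in> AP" "\<not> I \<simeq> J" "\<rho> J < \<rho> I" "y I < y J" "z = y \<circ> rf I J" using step(2) by (rule UPE)
  have "(y \<circ> tau (\<lambda>I. N * \<rho> I), z \<circ> tau (\<lambda>I. N * \<rho> I)) \<in> GL.ST" if N: "N \<ge> \<bar>I - J\<bar> + 1" for N
  proof -
    define \<kappa> where "\<kappa> = tau (\<lambda>I. N * \<rho> I)"
    have p: "(\<lambda>I. N * \<rho> I) \<in> per" using assms by (simp add: per_def)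
    have \<kappa>: "\<kappa> \<in> AP" using tau_AP[OF p] by (simp add: \<kappa>_def)
    have "N * 1 \<le> N * (n * (\<rho> I - \<rho> J))"
      using N IJ n_pos by (intro mult_left_mono) (auto simp: pos_zmult_eq_1_iff_lemma int_one_le_iff_zero_less)
    then have "I - J < N * (n * (\<rho> I - \<rho> J))" using N by linarith
    then have lt: "inv \<kappa> I < inv \<kappa> J" unfolding \<kappa>_def inv_tau[OF p] by (simp add: tau_def algebra_simps)
    have "(y \<circ> \<kappa>, y \<circ> \<kappa> \<circ> rf (inv \<kappa> I) (inv \<kappa> J)) \<in> GL.ST"
      using IJ lt AP_comp[OF IJ(1) \<kappa>] AP_inv_r[OF \<kappa>] AP_res[OF AP_inv[OF \<kappa>]] by (intro GL.STI) auto
    then show ?thesis using comp_rf_comp[OF \<kappa>, of y I J] IJ(5) by (simp add: \<kappa>_def)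
  qed
  then show ?case using N0
    by (intro exI[of _ "max N0 (\<bar>I - J\<bar> + 1)"]) (meson max.boundedE rtrancl.rtrancl_into_rtrancl)
qed auto

text \<open>The fourth assumption says that \<open>x\<close> increases on every pair reversed by
  \<open>inv \<kappa>\<close>, which makes lengths add in \<open>x \<circ> \<kappa>\<close>. A
  descent \<open>r\<close> of \<open>\<kappa>\<close> is then a descent of
  \<open>x \<circ> \<kappa>\<close>, and the simple reflection can be cancelled on both sides of the
  inequality.\<close>

lemma cancel_right:
  assumes "\<kappa> \<in> AP" "x \<in> AP" "y \<in> AP"
    and "\<And>I J. I < J \<Longrightarrow> inv \<kappa> J < inv \<kappa> I \<Longrightarrow> x I < x J"
    and "x \<circ> \<kappa> \<preceq>\<^sub>G y \<circ> \<kappa>"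
  shows "x \<preceq>\<^sub>G y"
  using assms(1,4,5)
proof (induction "card (GL.Inv \<kappa>)" arbitrary: \<kappa> rule: less_induct)
  case less
  note \<kappa> = less(2)
  show ?case
  proof (cases "strict_mono \<kappa>")
    case True
    have "strict_mono (inv \<kappa>)"
    proof (rule strict_monoI)
      fix I J :: int assume "I < J"
      then show "inv \<kappa> I < inv \<kappa> J"
        using strict_mono_less[OF True, of "inv \<kappa> I" "inv \<kappa> J"] AP_inv_r[OF \<kappa>] by simp
    qed
    then have "x \<circ> \<kappa> \<circ> inv \<kappa> \<preceq>\<^sub>G y \<circ> \<kappa> \<circ> inv \<kappa>"
      using GL.le_mono_right[OF AP_inv[OF \<kappa>] _ less(4)] by blast
    moreover have "w \<circ> \<kappa> \<circ> inv \<kappa> = w" for w :: "int \<Rightarrow> int" using AP_inv_r[OF \<kappa>] by auto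
    ultimately show ?thesis by simp
  next
    case False
    then obtain r where r: "\<kappa> (r + 1) < \<kappa> r" using AP_mono_or_descent[OF \<kappa>] by blast
    let ?t = "rf r (r + 1)"
    have tA: "?t \<in> AP" using rf_AP[OF res_suc(1)] .
    have tt: "?t (?t K) = K" for K using rf_invol[OF res_suc(1)] .
    have \<kappa>t: "\<kappa> \<circ> ?t \<in> AP" using AP_comp[OF \<kappa> tA] .
    have "(\<kappa> \<circ> ?t, \<kappa>) \<in> GL.ST" using ST_suc'[OF \<kappa> r] .
    then have c: "card (GL.Inv (\<kappa> \<circ> ?t)) < card (GL.Inv \<kappa>)" by (rule GL.ST_card)
    have "x (\<kappa> (r + 1)) < x (\<kappa> r)" using less(3)[OF r] AP_inv_l[OF \<kappa>] by simp
    then have le: "x \<circ> (\<kappa> \<circ> ?t) \<preceq>\<^sub>G y \<circ> (\<kappa> \<circ> ?t)"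
      using lift_desc[OF less(4) AP_comp[OF assms(2) \<kappa>], of r] by (simp add: comp_assoc)
    have invt: "inv (\<kappa> \<circ> ?t) K = ?t (inv \<kappa> K)" for K
    proof -
      have "(\<kappa> \<circ> ?t) (?t (inv \<kappa> K)) = K" using AP_inv_r[OF \<kappa>] by (simp add: tt)
      then show ?thesis using AP_inv_l[OF \<kappa>t] by metis
    qed
    have "x I < x J" if IJ: "I < J" "inv (\<kappa> \<circ> ?t) J < inv (\<kappa> \<circ> ?t) I" for I J
    proof (cases "inv \<kappa> J < inv \<kappa> I")
      case True
      then show ?thesis using less(3) IJ by blast
    next
      case False
      define A where "A = inv \<kappa> I"
      define B where "B = inv \<kappa> J"
      have AB: "A < B" using False IJ AP_eq[OF AP_inv[OF \<kappa>], of I J] by (auto simp: A_def B_def)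
      have \<kappa>AB: "\<kappa> A = I" "\<kappa> B = J" using AP_inv_r[OF \<kappa>] by (auto simp: A_def B_def)
      have tAB: "?t B < ?t A" using IJ by (simp add: invt A_def B_def)
      show ?thesis
      proof (cases "A \<simeq> B")
        case True
        then obtain k where k: "A = B + k * n" by (rule resE)
        then show ?thesis using tAB AB AP_shift[OF tA, of B k] by simp
      next
        case nAB: False
        \<comment> \<open>A pair reversed by \<open>?t\<close> alone consists of translates of
          \<open>r\<close> and \<open>r + 1\<close>, where \<open>\<kappa>\<close> descends, against
          \<open>I < J\<close>.\<close>
        then have eq: "rf A B = ?t" using rf_simple[of r] AB tAB unfolding GL.simple_def by (meson less_asym)
        have "rf A B A = B" by (rule rf_left)
        moreover have d: "?t K - K \<in> {-1, 0, 1} \<and> (?t K - K = 1 \<longleftrightarrow> K \<simeq> r)" for K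
          using res_suc by (auto simp: rf_def)
        ultimately have "B = A + 1" "A \<simeq> r" using d[of A] AB eq by auto
        then obtain k where "A = r + k * n" "B = r + 1 + k * n" using resE[of A r] by (metis add.commute add.left_commute)
        then have "\<kappa> A = \<kappa> r + k * n" "\<kappa> B = \<kappa> (r + 1) + k * n" using AP_shift[OF \<kappa>] by blast+
        then show ?thesis using \<kappa>AB IJ(1) r by simp
      qed
    qed
    then show ?thesis using less(1)[OF c \<kappa>t _ le] by blast
  qed
qed

text \<open>The acute cone condition is what cancellation needs: the inverse of the translation by
  \<open>N * \<rho>\<close> can reverse \<open>I < J\<close> only if
  \<open>\<rho> I < \<rho> J\<close>.\<close>

lemma acute_UP_imp_le:
  assumes "\<rho> \<in> per" "x \<in> AP" "y \<in> AP" "(x, y) \<in> (UP \<rho>)\<^sup>*"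
    and acute: "\<And>I J. I < J \<Longrightarrow> \<rho> I < \<rho> J \<Longrightarrow> x I < x J"
  shows "x \<preceq>\<^sub>G y"
proof -
  obtain N0 where N0: "\<And>N. N \<ge> N0 \<Longrightarrow> x \<circ> tau (\<lambda>I. N * \<rho> I) \<preceq>\<^sub>G y \<circ> tau (\<lambda>I. N * \<rho> I)"
    using UP_translate[OF assms(1,4)] by blast
  define N where "N = max N0 1"
  have p: "(\<lambda>I. N * \<rho> I) \<in> per" using assms by (simp add: per_def)
  show ?thesis
  proof (rule cancel_right[OF tau_AP[OF p] assms(2,3)])
    show "x \<circ> tau (\<lambda>I. N * \<rho> I) \<preceq>\<^sub>G y \<circ> tau (\<lambda>I. N * \<rho> I)" using N0 by (simp add: N_def)
    fix I J :: int assume IJ: "I < J" "inv (tau (\<lambda>I. N * \<rho> I)) J < inv (tau (\<lambda>I. N * \<rho> I)) I"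
    then have "0 < n * N * (\<rho> J - \<rho> I)" unfolding inv_tau[OF p] by (simp add: tau_def algebra_simps)
    moreover have "0 < n * N" using n_pos by (simp add: N_def)
    ultimately have "\<rho> I < \<rho> J" by (simp add: zero_less_mult_iff)
    then show "x I < x J" using acute IJ by blast
  qed
qed

text \<open>The product of the reflections exchanging \<open>I\<close> with two suitable translates
  of \<open>J\<close> is a translation, and its effect is to swap \<open>l I\<close> and
  \<open>l J\<close>. The translates are chosen so that both reflections go up.\<close>

lemma tau_swap_UP:
  assumes l: "l \<in> per" and IJ: "\<not> I \<simeq> J" "\<rho> \<in> per" "\<rho> J < \<rho> I" "l I < l J"
  shows "(tau l, tau (l \<circ> rf I J)) \<in> (UP \<rho>)\<^sup>*"
proof -
  define D where "D = l J - l I"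
  \<comment> \<open>Strictly \<open>a * n < I - J < (a + 1) * n\<close>. The upper bound and
    \<open>D \<ge> 1\<close> make the reflection at \<open>J + a * n\<close> a step up, the lower
    bound does so for the one at \<open>J + (a + D) * n\<close>.\<close>
  define a where "a = (I - J) div n"
  have D: "1 \<le> D" using IJ by (simp add: D_def)
  have "(I - J) mod n \<noteq> 0" using IJ by (simp add: dvd_eq_mod_eq_0)
  then have am: "0 < (I - J) mod n" "(I - J) mod n < n"
    using pos_mod_sign[OF n_pos, of "I - J"] pos_mod_bound[OF n_pos, of "I - J"] by linarith+
  have e: "I - J = a * n + (I - J) mod n" by (simp add: a_def)
  have lo: "a * n < I - J" using am e by linarith
  have "n * 1 \<le> n * D" using D n_pos by (intro mult_left_mono) auto
  then have hi: "I - J < a * n + n * D" using am e by linarith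
  define J1 where "J1 = J + a * n"
  define J2 where "J2 = J + (a + D) * n"
  have J1r: "K \<simeq> J1 \<longleftrightarrow> K \<simeq> J" and J2r: "K \<simeq> J2 \<longleftrightarrow> K \<simeq> J" for K
    using dvd_add_left_iff[of n "- (a * n)" "K - J"] dvd_add_left_iff[of n "- ((a + D) * n)" "K - J"]
    by (simp_all add: J1_def J2_def algebra_simps)
  define u where "u = tau l \<circ> rf I J1"
  have tl: "tau l \<in> AP" using tau_AP l .
  have n1: "\<not> I \<simeq> J1" and n2: "\<not> I \<simeq> J2" using IJ J1r J2r by auto
  have uA: "u \<in> AP" using AP_comp[OF tl rf_AP[OF n1]] by (simp add: u_def)
  have \<rho>J: "\<rho> J1 < \<rho> I" "\<rho> J2 < \<rho> I" using IJ(3) per_shift[OF IJ(2)] by (simp_all add: J1_def J2_def)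
  have lJ1: "l J1 = l J" using per_shift[OF l] by (simp add: J1_def)
  have 1: "(tau l, u) \<in> UP \<rho>" unfolding u_def using hi
    by (intro UPI tl n1 \<rho>J) (simp add: tau_def lJ1, simp add: J1_def D_def algebra_simps)
  have uI: "u I = J1 + n * l J" by (simp add: u_def rf_left tau_def lJ1)
  have "u J1 = I + n * l I" by (simp add: u_def rf_right[OF n1] tau_def)
  moreover have "J2 = J1 + D * n" by (simp add: J1_def J2_def algebra_simps)
  ultimately have uJ2: "u J2 = I + n * l I + D * n" using AP_shift[OF uA, of J1 D] by simp
  have 2: "(u, u \<circ> rf I J2) \<in> UP \<rho>" using lo
    by (intro UPI uA n2 \<rho>J) (simp add: uI uJ2, simp add: J1_def D_def algebra_simps)
  have "u \<circ> rf I J2 = tau (l \<circ> rf I J)"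
  proof
    fix K
    consider (a) "K \<simeq> I" | (b) "K \<simeq> J" "\<not> K \<simeq> I" | (c) "\<not> K \<simeq> I" "\<not> K \<simeq> J" by blast
    then show "(u \<circ> rf I J2) K = tau (l \<circ> rf I J) K"
    proof cases
      case a
      then obtain k where k: "K = I + k * n" by (rule resE)
      have "rf I J2 K = J2 + k * n" "rf I J K = J + k * n" using a by (simp_all add: rf_def k)
      then show ?thesis using AP_shift[OF uA, of J2 k] uJ2 per_shift[OF l, of J k]
        by (simp add: tau_def k D_def algebra_simps)
    next
      case b
      then obtain k where k: "K = J + k * n" using resE by blast
      have "rf I J2 K = I + (k - a - D) * n" "rf I J K = I + k * n"
        using b J2r by (simp_all add: rf_def k J2_def algebra_simps)
      then have "(u \<circ> rf I J2) K = u I + (k - a - D) * n" "tau (l \<circ> rf I J) K = K + n * l I"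
        using AP_shift[OF uA, of I "k - a - D"] per_shift[OF l, of I k] by (simp_all add: tau_def)
      then show ?thesis unfolding uI k J1_def D_def by (simp add: algebra_simps)
    next
      case c
      then show ?thesis by (simp add: u_def rf_def J1r J2r tau_def)
    qed
  qed
  then show ?thesis using 1 2 by simp
qed

lemma swap_measure:
  assumes l: "l \<in> per" and IJ: "\<not> I \<simeq> J" "\<rho> \<in> per" "\<rho> J < \<rho> I" "l I < l J"
  shows "(\<Sum>i\<in>{0..<n}. \<rho> i * l i) < (\<Sum>i\<in>{0..<n}. \<rho> i * (l \<circ> rf I J) i)"
proof -
  define i where "i = I mod n"
  define j where "j = J mod n"
  have ij: "i \<in> {0..<n}" "j \<in> {0..<n}" using n_pos by (auto simp: i_def j_def)
  have ne: "i \<noteq> j" using IJ(1) by (auto simp: i_def j_def mod_eq_dvd_iff)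
  have r: "i \<simeq> I" "j \<simeq> J" by (simp_all add: i_def j_def minus_div_mult_eq_mod[symmetric])
  have vals: "l i = l I" "l j = l J" "\<rho> i = \<rho> I" "\<rho> j = \<rho> J" using r per_res l IJ by blast+
  have rl: "l (rf I J i) = l J" "l (rf I J j) = l I"
  proof -
    have "rf I J i \<simeq> J" using r by (simp add: rf_def)
    then show "l (rf I J i) = l J" using per_res l by blast
    have "\<not> j \<simeq> I" using r(2) IJ(1) res_sym res_trans by blast
    then have "rf I J j \<simeq> I" using r by (simp add: rf_def)
    then show "l (rf I J j) = l I" using per_res l by blast
  qed
  have oth: "l (rf I J k) = l k" if "k \<in> {0..<n} - {i} - {j}" for k
  proof -
    have "k mod n = k" using that by simp
    then have "\<not> k \<simeq> I" "\<not> k \<simeq> J" using that by (auto simp: i_def j_def mod_eq_dvd_iff[symmetric])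
    then show ?thesis by (simp add: rf_other)
  qed
  have split: "(\<Sum>k\<in>{0..<n}. f k) = f i + f j + (\<Sum>k\<in>{0..<n} - {i} - {j}. f k)" for f :: "int \<Rightarrow> int"
    using sum.remove[OF _ ij(1), of f] sum.remove[of "{0..<n} - {i}" j f] ij ne by simp
  have rest: "(\<Sum>k\<in>{0..<n} - {i} - {j}. \<rho> k * (l \<circ> rf I J) k) = (\<Sum>k\<in>{0..<n} - {i} - {j}. \<rho> k * l k)"
    using oth by (intro sum.cong) auto
  have "0 < (\<rho> I - \<rho> J) * (l J - l I)" using IJ by simp
  then have "\<rho> I * l I + \<rho> J * l J < \<rho> I * l J + \<rho> J * l I" by (simp add: algebra_simps)
  then show ?thesis unfolding split rest by (simp add: vals rl)
qed

definition sorted_by :: "(int \<Rightarrow> int) \<Rightarrow> (int \<Rightarrow> int) \<Rightarrow> bool"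
  where "sorted_by \<rho> l \<longleftrightarrow> (\<forall>I J. \<rho> J < \<rho> I \<longrightarrow> l J \<le> l I)"

text \<open>Among the orbit elements reachable from \<open>l0\<close>, one maximising the pairing
  with \<open>\<rho>\<close> is sorted: swapping an unsorted pair would go up and, by the
  rearrangement inequality, increase the pairing.\<close>

lemma UP_to_sorted:
  assumes L: "finite L" "L \<subseteq> per" "\<And>l I J. l \<in> L \<Longrightarrow> \<not> I \<simeq> J \<Longrightarrow> l \<circ> rf I J \<in> L"
    and "l0 \<in> L" "orient \<rho>"
  shows "\<exists>l\<in>L. sorted_by \<rho> l \<and> (tau l0, tau l) \<in> (UP \<rho>)\<^sup>*"
proof -
  define L' where "L' = {l \<in> L. (tau l0, tau l) \<in> (UP \<rho>)\<^sup>*}"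
  define f where "f l = (\<Sum>i\<in>{0..<n}. \<rho> i * l i)" for l
  have fin: "finite (f ` L')" and ne: "f ` L' \<noteq> {}" using L assms(4) by (auto simp: L'_def)
  obtain l where l: "l \<in> L'" "f l = Max (f ` L')" using Max_in[OF fin ne] by auto
  have \<rho>: "\<rho> \<in> per" using assms(5) by (simp add: orient_def)
  have lp: "l \<in> per" using l L by (auto simp: L'_def)
  have "sorted_by \<rho> l" unfolding sorted_by_def
  proof (intro allI impI, rule ccontr)
    fix I J assume IJ: "\<rho> J < \<rho> I" "\<not> l J \<le> l I"
    have n: "\<not> I \<simeq> J" using IJ per_res[OF \<rho>] by fastforce
    have "(tau l, tau (l \<circ> rf I J)) \<in> (UP \<rho>)\<^sup>*" using tau_swap_UP[OF lp n \<rho>] IJ by simp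
    then have "l \<circ> rf I J \<in> L'" using l L n by (auto simp: L'_def)
    then have "f (l \<circ> rf I J) \<le> f l" using l fin by simp
    then show False using swap_measure[OF lp n \<rho>] IJ by (simp add: f_def)
  qed
  then show ?thesis using l by (auto simp: L'_def)
qed

section \<open>Sorted functions and ranks of residues\<close>

lemma finite_residues: "finite {j \<in> {0..<n}. P j}"
  by (rule finite_subset[of _ "{0..<n}"]) auto

lemma AP_residues_bij: assumes "\<kappa> \<in> AP" shows "bij_betw (\<lambda>i. \<kappa> i mod n) {0..<n} {0..<n}"
proof -
  have "inj_on (\<lambda>i. \<kappa> i mod n) {0..<n}"
  proof (rule inj_onI)
    fix i j assume ij: "i \<in> {0..<n}" "j \<in> {0..<n}" "\<kappa> i mod n = \<kappa> j mod n"
    then have "i \<simeq> j" using AP_res[OF assms] by (simp add: mod_eq_dvd_iff)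
    then show "i = j" using ij by (simp add: mod_eq_dvd_iff[symmetric])
  qed
  moreover have "(\<lambda>i. \<kappa> i mod n) ` {0..<n} \<subseteq> {0..<n}" using n_pos by auto
  ultimately show ?thesis by (simp add: bij_betw_def endo_inj_surj)
qed

text \<open>The superlevel sets of both functions are up-sets of the same cardinality for the same linear order.\<close>
lemma sorted_unique:
  assumes \<nu>: "\<nu> \<in> per" and \<kappa>: "\<kappa> \<in> AP" and \<rho>: "orient \<rho>" and s: "sorted_by \<rho> (\<nu> \<circ> \<kappa>)" "sorted_by \<rho> \<nu>"
  shows "\<nu> \<circ> \<kappa> = \<nu>"
proof -
  define l where "l = \<nu> \<circ> \<kappa>"
  define A where "A v = {i \<in> {0..<n}. v \<le> l i}" for v
  define B where "B v = {i \<in> {0..<n}. v \<le> \<nu> i}" for v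
  have fin: "finite (A v)" "finite (B v)" for v unfolding A_def B_def by (rule finite_residues)+
  have lp: "l \<in> per" using per_comp \<nu> \<kappa> by (simp add: l_def)
  have card: "card (A v) = card (B v)" for v
  proof (rule bij_betw_same_card)
    have \<nu>m: "\<nu> (\<kappa> i mod n) = l i" for i using per_mod[OF \<nu>] by (simp add: l_def)
    note b = AP_residues_bij[OF \<kappa>]
    show "bij_betw (\<lambda>i. \<kappa> i mod n) (A v) (B v)"
    proof (rule bij_betw_subset[OF b])
      show "A v \<subseteq> {0..<n}" by (auto simp: A_def)
      show "(\<lambda>i. \<kappa> i mod n) ` A v = B v"
      proof
        show "(\<lambda>i. \<kappa> i mod n) ` A v \<subseteq> B v" using n_pos \<nu>m by (auto simp: A_def B_def)
        show "B v \<subseteq> (\<lambda>i. \<kappa> i mod n) ` A v"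
        proof
          fix j assume j: "j \<in> B v"
          then have "j \<in> (\<lambda>i. \<kappa> i mod n) ` {0..<n}" using b by (auto simp: bij_betw_def B_def)
          then obtain i where i: "i \<in> {0..<n}" "j = \<kappa> i mod n" by blast
          then have "i \<in> A v" using j \<nu>m by (auto simp: A_def B_def)
          then show "j \<in> (\<lambda>i. \<kappa> i mod n) ` A v" using i by blast
        qed
      qed
    qed
  qed
  have nested: "A v \<subseteq> B v \<or> B v \<subseteq> A v" for v
  proof (rule ccontr)
    assume "\<not> ?thesis"
    then obtain i j where i: "i \<in> A v" "i \<notin> B v" and j: "j \<in> B v" "j \<notin> A v" by blast
    then have ij: "v \<le> l i" "\<nu> i < v" "v \<le> \<nu> j" "l j < v" "i \<in> {0..<n}" "j \<in> {0..<n}" "i \<noteq> j"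
      by (auto simp: A_def B_def)
    have "\<rho> i \<noteq> \<rho> j"
    proof
      assume "\<rho> i = \<rho> j"
      then have "i \<simeq> j" using \<rho> by (simp add: orient_def)
      then show False using ij by (simp add: mod_eq_dvd_iff[symmetric])
    qed
    then consider "\<rho> j < \<rho> i" | "\<rho> i < \<rho> j" by linarith
    then show False
    proof cases
      case 1
      then have "\<nu> j \<le> \<nu> i" using s by (simp add: sorted_by_def)
      then show ?thesis using ij by linarith
    next
      case 2
      then have "l i \<le> l j" using s by (simp add: sorted_by_def l_def)
      then show ?thesis using ij by linarith
    qed
  qed
  have AB: "A v = B v" for v using nested[of v] card[of v] fin[of v] card_subset_eq by metis
  have "l I = \<nu> I" for I
  proof -
    define i where "i = I mod n"
    have i: "i \<in> {0..<n}" using n_pos by (simp add: i_def)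
    have "i \<in> A (l i)" "i \<in> B (\<nu> i)" using i by (auto simp: A_def B_def)
    then have "i \<in> B (l i)" "i \<in> A (\<nu> i)" using AB by auto
    then have "l i = \<nu> i" by (auto simp: A_def B_def)
    then show ?thesis using per_mod[OF \<nu>, of I] per_mod[OF lp, of I] by (simp add: i_def)
  qed
  then show ?thesis by (auto simp: l_def)
qed

lemma finite_orbit: assumes "\<mu> \<in> per" shows "finite {\<mu> \<circ> \<kappa> | \<kappa>. \<kappa> \<in> AP}"
proof -
  define F where "F = {g. \<forall>x. (x \<in> {0..<n} \<longrightarrow> g x \<in> \<mu> ` {0..<n}) \<and> (x \<notin> {0..<n} \<longrightarrow> g x = (0::int))}"
  have "finite F" unfolding F_def by (intro finite_set_of_finite_funs) auto
  moreover have "{\<mu> \<circ> \<kappa> | \<kappa>. \<kappa> \<in> AP} \<subseteq> (\<lambda>g K. g (K mod n)) ` F"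
  proof
    fix l assume "l \<in> {\<mu> \<circ> \<kappa> | \<kappa>. \<kappa> \<in> AP}"
    then obtain \<kappa> where \<kappa>: "l = \<mu> \<circ> \<kappa>" "\<kappa> \<in> AP" by blast
    define g where "g x = (if x \<in> {0..<n} then l x else 0)" for x
    have "l x \<in> \<mu> ` {0..<n}" for x using per_mod[OF assms, of "\<kappa> x"] n_pos \<kappa>
      by (intro image_eqI[of _ _ "\<kappa> x mod n"]) auto
    then have "g \<in> F" by (auto simp: g_def F_def)
    moreover have "l = (\<lambda>K. g (K mod n))"
      using per_mod[OF per_comp[OF assms \<kappa>(2)]] \<kappa> n_pos by (auto simp: g_def fun_eq_iff)
    ultimately show "l \<in> (\<lambda>g K. g (K mod n)) ` F" by blast
  qed
  ultimately show ?thesis using finite_subset by blast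
qed

text \<open>Numbers the residues in the order given by \<open>f\<close> and extends periodically:
  the finite Weyl group element that takes the chamber of \<open>f\<close> to the standard
  one.\<close>

definition rank :: "(int \<Rightarrow> int) \<Rightarrow> int \<Rightarrow> int"
  where "rank f I = int (card {j \<in> {0..<n}. f j < f I}) + n * (I div n)"

lemma rank_bounds: assumes "orient f"
  shows "int (card {j \<in> {0..<n}. f j < f I}) < n"
proof -
  have "f (I mod n) = f I" using per_mod assms by (auto simp: orient_def)
  then have "{j \<in> {0..<n}. f j < f I} \<subseteq> {0..<n} - {I mod n}" by auto
  then have "card {j \<in> {0..<n}. f j < f I} \<le> card ({0..<n} - {I mod n})" by (intro card_mono) auto
  also have "\<dots> < card {0..<n}" using n_pos by (intro card_Diff1_less) simp_all
  finally show ?thesis using n_pos by simp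
qed

lemma rank_mod: assumes "orient f" shows "rank f I mod n = int (card {j \<in> {0..<n}. f j < f I})"
  using rank_bounds[OF assms, of I] by (simp add: rank_def)

lemma rank_div: assumes "orient f" shows "rank f I div n = I div n"
  using rank_bounds[OF assms, of I] n_pos by (simp add: rank_def)

lemma rank_mod_mono: assumes "orient f" "f I \<le> f J" shows "rank f I mod n \<le> rank f J mod n"
  unfolding rank_mod[OF assms(1)] 
  by (rule of_nat_mono, rule card_mono[OF finite_residues]) (use assms(2) in auto)

lemma rank_mod_strict: assumes "orient f" "f I < f J" shows "rank f I mod n < rank f J mod n"
proof -
  have "I mod n \<in> {j \<in> {0..<n}. f j < f J}" "I mod n \<notin> {j \<in> {0..<n}. f j < f I}"
    using per_mod[of f I] assms n_pos by (auto simp: orient_def)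
  then have "{j \<in> {0..<n}. f j < f I} \<subset> {j \<in> {0..<n}. f j < f J}" using assms(2) by auto
  then show ?thesis unfolding rank_mod[OF assms(1)] using psubset_card_mono[OF finite_residues] by simp
qed

lemma rank_AP: assumes "orient f" shows "rank f \<in> AP"
proof -
  have p: "rank f (I + n) = rank f I + n" for I
    using assms n_pos by (simp add: rank_def orient_def per_def algebra_simps)
  have inj: "inj (rank f)"
  proof (rule injI)
    fix I J assume eq: "rank f I = rank f J"
    have "\<not> f I < f J" "\<not> f J < f I" using rank_mod_strict[OF assms] eq by (metis less_irrefl)+
    then have "f I = f J" by simp
    then have "I mod n = J mod n" using assms by (simp add: orient_def mod_eq_dvd_iff)
    moreover have "I div n = J div n" using rank_div[OF assms] eq by metis
    ultimately show "I = J" using div_mult_mod_eq by metis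
  qed
  have "inj_on (\<lambda>i. rank f i mod n) {0..<n}"
  proof (rule inj_onI)
    fix i j assume ij: "i \<in> {0..<n}" "j \<in> {0..<n}" "rank f i mod n = rank f j mod n"
    have "i div n = j div n" using ij by simp
    then have "rank f i = rank f j" using ij(3) rank_div[OF assms] div_mult_mod_eq by metis
    then show "i = j" using inj by (simp add: inj_def)
  qed
  moreover have "(\<lambda>i. rank f i mod n) ` {0..<n} \<subseteq> {0..<n}" using n_pos by auto
  ultimately have im: "(\<lambda>i. rank f i mod n) ` {0..<n} = {0..<n}" by (simp add: endo_inj_surj)
  have "\<exists>I. rank f I = K" for K
  proof -
    have "K mod n \<in> (\<lambda>i. rank f i mod n) ` {0..<n}" using im n_pos by simp
    then obtain i where i: "i \<in> {0..<n}" "K mod n = rank f i mod n" by auto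
    have "rank f i div n = 0" using i rank_div[OF assms] by simp
    then have "rank f i = K mod n" using i by (metis add_0 div_mult_mod_eq mult_zero_left)
    then have "rank f (i + K div n * n) = K" using shift_mult[of "rank f" n n i "K div n"] p by simp
    then show ?thesis by blast
  qed
  then have "surj (rank f)" by (metis surjI)
  then show ?thesis using inj p by (simp add: AP_def bij_def)
qed

end

context even_period
begin

text \<open>The mirror exchanges the residues below \<open>bar I\<close> with those above
  \<open>I\<close>. Exactly one residue ties with \<open>I\<close>, so the numbers below and above
  add up to \<open>n - 1\<close>, which is the symmetry of the rank.\<close>

lemma rank_SP: assumes "orient f" "\<And>K. f (bar K) = c - f K" shows "rank f \<in> SP"
proof -
  have "rank f (bar I) = bar (rank f I) + 0 * n" for I
  proof -
    have fm: "f (i mod n) = f i" for i using per_mod assms(1) by (auto simp: orient_def)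
    let ?b = "\<lambda>j. n - 1 - j"
    have fb: "f (?b j) = c - f j" for j
      using per_shift[of f "bar j" 1] assms by (simp add: orient_def bar_def algebra_simps)
    have "bij_betw ?b {j \<in> {0..<n}. f j < f (bar I)} {j \<in> {0..<n}. f I < f j}"
      by (rule bij_betw_byWitness[where f' = ?b]) (auto simp: fb assms(2))
    then have c1: "card {j \<in> {0..<n}. f j < f (bar I)} = card {j \<in> {0..<n}. f I < f j}" by (rule bij_betw_same_card)
    have eq: "{j \<in> {0..<n}. f j = f I} = {I mod n}"
    proof
      show "{j \<in> {0..<n}. f j = f I} \<subseteq> {I mod n}"
      proof
        fix j assume j: "j \<in> {j \<in> {0..<n}. f j = f I}"
        then have "j \<simeq> I" using assms(1) by (simp add: orient_def)
        then show "j \<in> {I mod n}" using j by (simp add: mod_eq_dvd_iff[symmetric])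
      qed
      show "{I mod n} \<subseteq> {j \<in> {0..<n}. f j = f I}" using fm n_pos by simp
    qed
    have "{0..<n} = {j \<in> {0..<n}. f j < f I} \<union> ({j \<in> {0..<n}. f j = f I} \<union> {j \<in> {0..<n}. f I < f j})" by auto
    then have "card {0..<n} = card ({j \<in> {0..<n}. f j < f I} \<union> ({j \<in> {0..<n}. f j = f I} \<union> {j \<in> {0..<n}. f I < f j}))"
      by (rule arg_cong)
    also have "\<dots> = card {j \<in> {0..<n}. f j < f I} + (1 + card {j \<in> {0..<n}. f I < f j})"
    proof -
      let ?A = "{j \<in> {0..<n}. f j < f I}" and ?B = "{j \<in> {0..<n}. f I < f j}"
      have "I mod n \<notin> ?B" using fm[of I] by simp
      then have "card ({I mod n} \<union> ?B) = 1 + card ?B" using finite_residues by simp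
      moreover have "card (?A \<union> ({I mod n} \<union> ?B)) = card ?A + card ({I mod n} \<union> ?B)"
        using fm[of I] finite_residues by (intro card_Un_disjoint) (auto simp del: atLeastLessThan_iff)
      ultimately show ?thesis unfolding eq by simp
    qed
    finally have c2: "n = int (card {j \<in> {0..<n}. f j < f I}) + (1 + int (card {j \<in> {0..<n}. f I < f j}))"
      using n_pos by simp
    have dv: "bar I div n = - 1 - I div n"
    proof -
      have "bar I = (n - 1 - I mod n) + (- 1 - I div n) * n" by (simp add: bar_def algebra_simps)
      moreover have "(n - 1 - I mod n) div n = 0"
        using pos_mod_bound[OF n_pos, of I] pos_mod_sign[OF n_pos, of I] by (intro div_pos_pos_trivial) linarith+
      ultimately show ?thesis using n_pos by simp
    qed
    have "rank f (bar I) = int (card {j \<in> {0..<n}. f I < f j}) + n * (- 1 - I div n)"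
      unfolding rank_def c1 dv ..
    moreover have "bar (rank f I) = - 1 - int (card {j \<in> {0..<n}. f j < f I}) - n * (I div n)"
      by (simp add: rank_def bar_def)
    ultimately show ?thesis using c2 unfolding right_diff_distrib by linarith
  qed
  then show ?thesis using rank_AP[OF assms(1)] unfolding SP_def by blast
qed

lemma mod_bar: "bar I mod n = n - 1 - I mod n"
proof -
  have "bar I = (n - 1 - I mod n) + (- 1 - I div n) * n" by (simp add: bar_def algebra_simps)
  moreover have "(n - 1 - I mod n) mod n = n - 1 - I mod n"
    using pos_mod_bound[OF n_pos, of I] pos_mod_sign[OF n_pos, of I] by (intro mod_pos_pos_trivial) linarith+
  ultimately show ?thesis by simp
qed

text \<open>A lexicographic refinement of \<open>l\<close>: the weight \<open>n\<close> keeps the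
  tie-break \<open>I mod n\<close> from overruling \<open>l\<close>, and the tie-break separates
  residues.\<close>

lemma refine_orient:
  assumes "l \<in> per"
  shows "orient (\<lambda>I. n * l I + I mod n)" "n * l I + I mod n < n * l J + J mod n \<Longrightarrow> l I \<le> l J"
proof -
  have *: "l I \<le> l J" if "n * l I + I mod n \<le> n * l J + J mod n" for I J
  proof (rule ccontr)
    assume "\<not> l I \<le> l J"
    then have "n * (l J + 1) \<le> n * l I" using n_pos by (intro mult_left_mono) auto
    then have "n * l J + n \<le> n * l I" by (simp add: distrib_left)
    then show False using that pos_mod_bound[OF n_pos, of J] pos_mod_sign[OF n_pos, of I] by linarith
  qed
  show "n * l I + I mod n < n * l J + J mod n \<Longrightarrow> l I \<le> l J" using *[of I J] by simp
  have "I \<simeq> J" if "n * l I + I mod n = n * l J + J mod n" for I J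
    using *[of I J] *[of J I] that by (simp add: mod_eq_dvd_iff[symmetric])
  then show "orient (\<lambda>I. n * l I + I mod n)" using assms by (simp add: orient_def per_def)
qed

text \<open>The chamber is that of the displacement \<open>d\<close>: since
  \<open>\<rho> I < \<rho> J\<close> entails \<open>d I \<le> d J\<close>, the element
  \<open>x\<close> keeps every such pair \<open>I < J\<close> in order, which is the acute cone
  condition.\<close>

theorem admissible_symmetric:
  assumes x: "x \<in> SP" and \<mu>: "\<mu> \<in> per" "\<And>K. \<mu> (bar K) = c - \<mu> K" and \<kappa>0: "\<kappa>0 \<in> AP" and le: "x \<preceq>\<^sub>G tau (\<mu> \<circ> \<kappa>0)"
  shows "\<exists>\<kappa>\<in>SP. x \<preceq>\<^sub>G tau (\<mu> \<circ> \<kappa>)"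
proof -
  have xA: "x \<in> AP" using SP_AP x .
  obtain e where e: "\<And>K. x (bar K) = bar (x K) + e * n" using SP_bar x by blast
  define d where "d I = x I - I" for I
  define \<rho> where "\<rho> I = n * d I + I mod n" for I
  define M where "M I = n * \<mu> I + I mod n" for I
  have dp: "d \<in> per" using xA by (simp add: d_def per_def AP_def)
  have \<rho>: "orient \<rho>" and \<rho>d: "\<And>I J. \<rho> I < \<rho> J \<Longrightarrow> d I \<le> d J"
    using refine_orient[OF dp] by (auto simp: \<rho>_def[abs_def])
  have M: "orient M" and M\<mu>: "\<And>I J. M I < M J \<Longrightarrow> \<mu> I \<le> \<mu> J"
    using refine_orient[OF \<mu>(1)] by (auto simp: M_def[abs_def])
  have "d (bar K) = e * n - d K" for K unfolding d_def e by (simp add: bar_def)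
  \<comment> \<open>The summand \<open>n - 1\<close> comes from the tie-break, as
    \<open>bar I mod n = n - 1 - I mod n\<close>.\<close>
  then have \<rho>S: "rank \<rho> \<in> SP"
    by (intro rank_SP[OF \<rho>, of "n * (e * n) + n - 1"]) (simp add: \<rho>_def mod_bar right_diff_distrib)
  have MS: "rank M \<in> SP"
    by (intro rank_SP[OF M, of "n * c + n - 1"]) (simp add: M_def mod_bar \<mu>(2) right_diff_distrib)
  \<comment> \<open>\<open>\<kappa>\<close> carries the order of the residues by
    \<open>\<rho>\<close> to their order by \<open>M\<close>, so
    \<open>\<mu> \<circ> \<kappa>\<close> is sorted for \<open>\<rho>\<close>; both ranks are
    symplectic, hence so is \<open>\<kappa>\<close>.\<close>
  define \<kappa> where "\<kappa> = inv (rank M) \<circ> rank \<rho>"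
  have \<kappa>S: "\<kappa> \<in> SP" using SP_comp SP_inv MS \<rho>S by (simp add: \<kappa>_def)
  have \<kappa>A: "\<kappa> \<in> AP" using SP_AP \<kappa>S .
  have rk: "rank M (\<kappa> I) = rank \<rho> I" for I using AP_inv_r[OF SP_AP[OF MS]] by (simp add: \<kappa>_def)
  define \<nu> where "\<nu> = \<mu> \<circ> \<kappa>"
  have \<nu>p: "\<nu> \<in> per" using per_comp \<mu> \<kappa>A by (simp add: \<nu>_def)
  have \<nu>s: "sorted_by \<rho> \<nu>" unfolding sorted_by_def
  proof (intro allI impI)
    fix I J assume "\<rho> J < \<rho> I"
    then have "rank M (\<kappa> J) mod n < rank M (\<kappa> I) mod n" using rank_mod_strict[OF \<rho>] by (simp add: rk)
    then have "M (\<kappa> J) < M (\<kappa> I)" using rank_mod_mono[OF M, of "\<kappa> I" "\<kappa> J"] by linarith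
    then show "\<nu> J \<le> \<nu> I" using M\<mu> by (simp add: \<nu>_def)
  qed
  define L where "L = {\<mu> \<circ> \<kappa> | \<kappa>. \<kappa> \<in> AP}"
  have L: "finite L" "L \<subseteq> per" using finite_orbit \<mu> per_comp by (auto simp: L_def)
  have Lr: "l \<circ> rf I J \<in> L" if "l \<in> L" "\<not> I \<simeq> J" for l I J
    using that AP_comp rf_AP unfolding L_def by (auto simp: comp_assoc)
  obtain l where l: "l \<in> L" "(x, tau l) \<in> (UP \<rho>)\<^sup>*"
    using admissible_in_obtuse_cones[OF L(2) Lr le _ \<rho>] \<kappa>0 by (auto simp: L_def)
  obtain l' where l': "l' \<in> L" "sorted_by \<rho> l'" "(tau l, tau l') \<in> (UP \<rho>)\<^sup>*"
    using UP_to_sorted[OF L Lr l(1) \<rho>] by blast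
  obtain \<kappa>' where \<kappa>': "l' = \<mu> \<circ> \<kappa>'" "\<kappa>' \<in> AP" using l' by (auto simp: L_def)
  have "\<nu> \<circ> (inv \<kappa> \<circ> \<kappa>') = l'" using AP_inv_r[OF \<kappa>A] by (auto simp: \<nu>_def \<kappa>')
  then have "l' = \<nu>" using sorted_unique[OF \<nu>p AP_comp[OF AP_inv[OF \<kappa>A] \<kappa>'(2)] \<rho>] \<nu>s l' by simp
  then have "(x, tau \<nu>) \<in> (UP \<rho>)\<^sup>*" using l l' by simp
  moreover have "x I < x J" if "I < J" "\<rho> I < \<rho> J" for I J using \<rho>d[OF that(2)] that(1) by (simp add: d_def)
  ultimately have "x \<preceq>\<^sub>G tau \<nu>"
    using acute_UP_imp_le[of \<rho> x "tau \<nu>"] xA tau_AP \<nu>p \<rho> by (simp add: orient_def)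
  then show ?thesis using \<kappa>S by (auto simp: \<nu>_def)
qed

end

section \<open>From the extended affine Weyl groups to affine permutations\<close>

locale gsp = even_period n for n :: int +
  fixes m :: nat
  assumes n_def: "n = int (2 * m)"
begin

lemma m_pos: "1 \<le> m" using n_pos n_def by simp

lemma int_less_n: "i < 2 * m \<Longrightarrow> int i < n" by (simp add: n_def)

definition aff :: "ewg \<Rightarrow> int \<Rightarrow> int"
  where "aff w I = int (inv (snd w) (nat (I mod n))) + n * (fst w (nat (I mod n)) + I div n)"

definition Y :: "pt \<Rightarrow> int \<Rightarrow> real"
  where "Y x I = x (nat (I mod n)) + real_of_int (I div n)"

lemma residue_less: "nat (I mod n) < 2 * m"
  using pos_mod_bound[OF n_pos, of I] pos_mod_sign[OF n_pos, of I] by (simp add: n_def nat_less_iff)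

lemma int_residue: "int (nat (I mod n)) = I mod n"
  using pos_mod_sign[OF n_pos] by simp

lemma residue_of_nat: "i < 2 * m \<Longrightarrow> nat (int i mod n) = i" "i < 2 * m \<Longrightarrow> int i div n = 0"
  using int_less_n[of i] by simp_all

lemma perms_bij: assumes "\<sigma> \<in> perms k" shows "bij \<sigma>"
proof -
  have "bij_betw \<sigma> {k..} {k..}" using assms by (intro bij_betwI'[of "{k..}"]) (auto simp: perms_def)
  then have "bij_betw \<sigma> ({..<k} \<union> {k..}) ({..<k} \<union> {k..})"
    using assms by (intro bij_betw_combine) (auto simp: perms_def)
  moreover have "{..<k} \<union> {k..} = (UNIV :: nat set)" by auto
  ultimately show ?thesis by simp
qed

lemma perms_inv: assumes "\<sigma> \<in> perms k" shows "inv \<sigma> \<in> perms k"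
proof -
  note b = perms_bij[OF assms]
  have fix': "inv \<sigma> i = i" if "k \<le> i" for i using assms that b by (intro inv_f_eq) (auto simp: perms_def bij_is_inj)
  have im: "\<sigma> ` {..<k} = {..<k}" using assms by (simp add: perms_def bij_betw_def)
  have "inv \<sigma> ` {..<k} = {..<k}" using image_inv_f_f[OF bij_is_inj[OF b], of "{..<k}"] im by simp
  moreover have "inj_on (inv \<sigma>) {..<k}" using bij_is_inj[OF bij_imp_bij_inv[OF b]] by (rule inj_on_subset) simp
  ultimately show ?thesis using fix' unfolding perms_def bij_betw_def by blast
qed

lemma perms_less: assumes "\<sigma> \<in> perms k" "i < k" shows "\<sigma> i < k"
  using assms bij_betwE by (fastforce simp: perms_def)

lemma W_GL_perms: "w \<in> W_GL m \<Longrightarrow> snd w \<in> perms (2 * m)" by (simp add: W_GL_def)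

lemma aff_mod_div:
  assumes "w \<in> W_GL m"
  shows "aff w I mod n = int (inv (snd w) (nat (I mod n)))" "aff w I div n = fst w (nat (I mod n)) + I div n"
proof -
  have "inv (snd w) (nat (I mod n)) < 2 * m"
    using perms_less[OF perms_inv[OF W_GL_perms[OF assms]] residue_less] .
  then have *: "0 \<le> int (inv (snd w) (nat (I mod n)))" "int (inv (snd w) (nat (I mod n))) < n" using int_less_n by simp_all
  show "aff w I mod n = int (inv (snd w) (nat (I mod n)))"
    unfolding aff_def mod_mult_self2 using * by (rule mod_pos_pos_trivial)
  have "aff w I div n = (fst w (nat (I mod n)) + I div n) + int (inv (snd w) (nat (I mod n))) div n"
    unfolding aff_def using n_pos by (intro div_mult_self2) simp
  then show "aff w I div n = fst w (nat (I mod n)) + I div n"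
    using div_pos_pos_trivial[OF *] by simp
qed

lemma int_eq_mod_div: "I mod n = J mod n \<Longrightarrow> I div n = J div n \<Longrightarrow> I = (J::int)"
  using div_mult_mod_eq by metis

lemma aff_AP: assumes "w \<in> W_GL m" shows "aff w \<in> AP"
proof -
  note md = aff_mod_div[OF assms]
  note b = perms_bij[OF W_GL_perms[OF assms]]
  have inj: "inj (aff w)"
  proof (rule injI)
    fix I J assume eq: "aff w I = aff w J"
    have "inv (snd w) (nat (I mod n)) = inv (snd w) (nat (J mod n))" using md(1)[of I] md(1)[of J] eq by simp
    then have "nat (I mod n) = nat (J mod n)"
      using bij_is_inj[OF bij_imp_bij_inv[OF b]] by (simp add: inj_eq)
    then have 1: "I mod n = J mod n" using int_residue by metis
    then have "I div n = J div n" using md(2)[of I] md(2)[of J] eq by simp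
    then show "I = J" by (rule int_eq_mod_div[OF 1])
  qed
  have "\<exists>I. aff w I = K" for K
  proof -
    define k where "k = nat (K mod n)"
    define i where "i = snd w k"
    have k: "k < 2 * m" "int k = K mod n" unfolding k_def by (rule residue_less, rule int_residue)
    have i: "i < 2 * m" using perms_less[OF W_GL_perms[OF assms] k(1)] by (simp add: i_def)
    have ii: "inv (snd w) i = k" using b by (simp add: i_def bij_is_inj)
    define I where "I = int i + n * (K div n - fst w i)"
    have r: "I mod n = int i" "I div n = K div n - fst w i"
    proof -
      have *: "0 \<le> int i" "int i < n" using int_less_n[OF i] by simp_all
      show "I mod n = int i" unfolding I_def mod_mult_self2 using * by (rule mod_pos_pos_trivial)
      have "I div n = (K div n - fst w i) + int i div n" unfolding I_def using n_pos by (intro div_mult_self2) simp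
      then show "I div n = K div n - fst w i" using div_pos_pos_trivial[OF *] by simp
    qed
    have "aff w I mod n = K mod n" using k(2) by (simp add: md r ii)
    moreover have "aff w I div n = K div n" by (simp add: md r)
    ultimately have "aff w I = K" by (rule int_eq_mod_div)
    then show ?thesis by blast
  qed
  then have "surj (aff w)" by (metis surjI)
  moreover have "aff w (I + n) = aff w I + n" for I using n_pos by (simp add: aff_def algebra_simps)
  ultimately show ?thesis using inj by (simp add: AP_def bij_def)
qed

text \<open>Pulling back functions is contravariant. Right multiplication by a reflection, as in the
  definition of the Bruhat order, therefore becomes composition on the left.\<close>

lemma aff_mult: assumes "w \<in> W_GL m" "v \<in> W_GL m" shows "aff (ewg_mult w v) = aff v \<circ> aff w"
proof
  fix I
  have "inv (snd w \<circ> snd v) = inv (snd v) \<circ> inv (snd w)"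
    by (intro o_inv_distrib perms_bij[OF W_GL_perms] assms)
  then have inv: "inv (snd w \<circ> snd v) k = inv (snd v) (inv (snd w) k)" for k by (metis comp_apply)
  have e: "aff v (aff w I) = int (inv (snd v) (inv (snd w) (nat (I mod n))))
      + n * (fst v (inv (snd w) (nat (I mod n))) + (fst w (nat (I mod n)) + I div n))"
    unfolding aff_def[of v] aff_mod_div[OF assms(1)] nat_int ..
  then show "aff (ewg_mult w v) I = (aff v \<circ> aff w) I"
    unfolding comp_apply e unfolding aff_def ewg_mult_def fst_conv snd_conv inv by (simp add: algebra_simps)
qed

lemma mult_W_GL: assumes "w \<in> W_GL m" "v \<in> W_GL m" shows "ewg_mult w v \<in> W_GL m"
proof -
  have "inv (snd w) i = i" if "2 * m \<le> i" for i using perms_inv[OF W_GL_perms[OF assms(1)]] that by (simp add: perms_def)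
  moreover have "snd w \<circ> snd v \<in> perms (2 * m)"
    using W_GL_perms[OF assms(1)] W_GL_perms[OF assms(2)] by (auto simp: perms_def intro: bij_betw_trans)
  ultimately show ?thesis using assms by (simp add: W_GL_def ewg_mult_def)
qed

lemma one_W_GL: "ewg_one \<in> W_GL m" by (simp add: W_GL_def ewg_one_def perms_def)

lemma aff_one: "aff ewg_one = id" using n_pos by (auto simp: aff_def ewg_one_def fun_eq_iff)

lemma aff_inj: assumes "w \<in> W_GL m" "v \<in> W_GL m" "aff w = aff v" shows "w = v"
proof -
  have 1: "inv (snd w) i = inv (snd v) i \<and> fst w i = fst v i" if "i < 2 * m" for i
    using aff_mod_div[OF assms(1), of "int i"] aff_mod_div[OF assms(2), of "int i"] assms(3) residue_of_nat[OF that] by simp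
  have 2: "inv (snd w) i = inv (snd v) i \<and> fst w i = fst v i" if "\<not> i < 2 * m" for i
    using that assms perms_inv[OF W_GL_perms[OF assms(1)]] perms_inv[OF W_GL_perms[OF assms(2)]]
    by (auto simp: W_GL_def perms_def)
  have "inv (snd w) = inv (snd v)" "fst w = fst v" using 1 2 by blast+
  then have "snd w = snd v" using inv_inv_eq[OF perms_bij[OF W_GL_perms[OF assms(1)]]]
      inv_inv_eq[OF perms_bij[OF W_GL_perms[OF assms(2)]]] by metis
  then show ?thesis using \<open>fst w = fst v\<close> by (simp add: prod_eq_iff)
qed

lemma aff_surj: assumes "\<pi> \<in> AP" shows "\<exists>w\<in>W_GL m. aff w = \<pi>"
proof -
  define \<tau> where "\<tau> i = (if i < 2 * m then nat (\<pi> (int i) mod n) else i)" for i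
  have b: "bij_betw (\<lambda>i. \<pi> i mod n) {0..<n} {0..<n}" using AP_residues_bij[OF assms] .
  have lt: "\<tau> i < 2 * m" if "i < 2 * m" for i using that residue_less by (simp add: \<tau>_def)
  have "inj_on \<tau> {..<2 * m}"
  proof (rule inj_onI)
    fix i j assume ij: "i \<in> {..<2 * m}" "j \<in> {..<2 * m}" "\<tau> i = \<tau> j"
    then have "\<pi> (int i) mod n = \<pi> (int j) mod n" by (simp add: \<tau>_def) (metis int_residue)
    then have "int i = int j" using inj_onD[OF bij_betw_imp_inj_on[OF b], of "int i" "int j"] ij int_less_n by simp
    then show "i = j" by simp
  qed
  then have "bij_betw \<tau> {..<2 * m} {..<2 * m}"
    using lt endo_inj_surj[of "{..<2 * m}" \<tau>] by (auto simp: bij_betw_def)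
  then have \<tau>: "\<tau> \<in> perms (2 * m)" by (simp add: perms_def \<tau>_def)
  define w :: ewg where "w = ((\<lambda>i. if i < 2 * m then \<pi> (int i) div n else 0), inv \<tau>)"
  have w: "w \<in> W_GL m" using perms_inv[OF \<tau>] by (simp add: w_def W_GL_def)
  have "aff w I = \<pi> I" for I
  proof -
    define i where "i = nat (I mod n)"
    have i: "i < 2 * m" "int i = I mod n" unfolding i_def by (rule residue_less, rule int_residue)
    have "aff w I = int (\<tau> i) + n * (\<pi> (int i) div n + I div n)"
      using inv_inv_eq[OF perms_bij[OF \<tau>]] i by (simp add: aff_def w_def i_def[symmetric])
    also have "int (\<tau> i) = \<pi> (int i) mod n" using i n_pos by (simp add: \<tau>_def)
    also have "\<pi> (int i) mod n + n * (\<pi> (int i) div n + I div n) = \<pi> (int i) + (I div n) * n"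
      by (simp add: distrib_left mult.commute)
    also have "\<dots> = \<pi> (int i + (I div n) * n)" using AP_shift[OF assms] by simp
    also have "int i + (I div n) * n = I" using i by simp
    finally show ?thesis .
  qed
  then show ?thesis using w by blast
qed

section \<open>Points as functions on the integers\<close>

lemma Y_per: "Y x (K + n) = Y x K + 1" using n_pos by (simp add: Y_def)

lemma Y_shift: "Y x (K + k * n) = Y x K + of_int k" using shift_mult[of "Y x" n 1 K k] Y_per by simp

lemma Y_act: assumes "w \<in> W_GL m" shows "Y (ewg_act w x) = Y x \<circ> aff w"
proof
  fix I
  show "Y (ewg_act w x) I = (Y x \<circ> aff w) I"
    unfolding comp_apply Y_def[of x] aff_mod_div[OF assms] nat_int by (simp add: Y_def ewg_act_def)
qed

lemma Y_nat: "i < 2 * m \<Longrightarrow> Y x (int i) = x i" using residue_of_nat[of i] by (simp add: Y_def)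

lemma Y_inj: assumes "x \<in> V_GL m" "y \<in> V_GL m" "Y x = Y y" shows "x = y"
proof
  fix i
  show "x i = y i"
  proof (cases "i < 2 * m")
    case True
    then show ?thesis using Y_nat[OF True, of x] Y_nat[OF True, of y] assms by simp
  qed (use assms in \<open>auto simp: V_GL_def\<close>)
qed

lemma Y_surj: assumes "\<And>K. y (K + n) = y K + 1" shows "\<exists>x\<in>V_GL m. Y x = y"
proof -
  define x where "x i = (if i < 2 * m then y (int i) else 0)" for i
  have "Y x I = y I" for I
  proof -
    have "Y x I = y (I mod n) + of_int (I div n)" using residue_less[of I] n_pos by (simp add: Y_def x_def)
    also have "\<dots> = y (I mod n + I div n * n)" 
      using shift_mult[of y n 1 "I mod n" "I div n", OF assms] by simp
    finally show ?thesis by simp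
  qed
  then show ?thesis by (intro bexI[of _ x]) (auto simp: V_GL_def x_def)
qed

lemma V_GL_act: "w \<in> W_GL m \<Longrightarrow> x \<in> V_GL m \<Longrightarrow> ewg_act w x \<in> V_GL m"
  using perms_inv[OF W_GL_perms, of w] by (auto simp: V_GL_def W_GL_def ewg_act_def perms_def)

lemma bar_nat: assumes "i < 2 * m" shows "bar (int i) + n = int (2 * m - 1 - i)"
  using assms by (simp add: bar_def of_nat_diff n_def)

lemma bar_decomp: "bar K = int (2 * m - 1 - nat (K mod n)) + (- 1 - K div n) * n"
proof -
  define q where "q = K div n"
  define i where "i = nat (K mod n)"
  have "K = int i + q * n" using int_residue[of K] by (simp add: i_def q_def)
  moreover have "bar (int i) + n = int (2 * m - 1 - i)" unfolding i_def by (rule bar_nat[OF residue_less])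
  ultimately have "bar K = int (2 * m - 1 - i) + (- 1 - q) * n" by (simp add: bar_def algebra_simps)
  then show ?thesis by (simp add: i_def q_def)
qed

lemma V_Sp_sum: assumes "x \<in> V_Sp m" "i < m" shows "x i + x (2 * m - 1 - i) = x 0 + x (2 * m - 1)"
  using assms unfolding V_Sp_def by blast

lemma W_Sp_sum: assumes "w \<in> W_Sp m" "i < m"
  shows "fst w i + fst w (2 * m - 1 - i) = fst w 0 + fst w (2 * m - 1)"
  using assms unfolding W_Sp_def Xstar_def by blast

lemma V_Sp_iff: "x \<in> V_Sp m \<longleftrightarrow> x \<in> V_GL m \<and> (\<exists>C. \<forall>K. Y x (bar K) = C - Y x K)"
proof
  assume x: "x \<in> V_Sp m"
  define C where "C = x 0 + x (2 * m - 1)"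
  have s: "x i + x (2 * m - 1 - i) = C" if "i < 2 * m" for i
  proof (cases "i < m")
    case False
    then have "2 * m - 1 - i < m" "2 * m - 1 - (2 * m - 1 - i) = i" using that by linarith+
    then show ?thesis using V_Sp_sum[OF x, of "2 * m - 1 - i"] by (simp only: C_def add.commute)
  next
    case True
    then show ?thesis unfolding C_def by (rule V_Sp_sum[OF x])
  qed
  \<comment> \<open>The mirror of a coordinate index lies one period below its partner, hence
    \<open>C - 1\<close>.\<close>
  have "Y x (bar K) = (C - 1) - Y x K" for K
  proof -
    define i where "i = nat (K mod n)"
    have i: "i < 2 * m" "int i = K mod n" unfolding i_def by (rule residue_less, rule int_residue)
    have "bar K = int (2 * m - 1 - i) + (- 1 - K div n) * n" unfolding i_def by (rule bar_decomp)
    then have "Y x (bar K) = x (2 * m - 1 - i) + of_int (- 1 - K div n)" using Y_nat[of "2 * m - 1 - i" x] i by (simp add: Y_shift)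
    moreover have "Y x K = x i + of_int (K div n)" by (simp add: Y_def i_def)
    ultimately show ?thesis using s[OF i(1)] by simp
  qed
  then show "x \<in> V_GL m \<and> (\<exists>C. \<forall>K. Y x (bar K) = C - Y x K)" using x by (auto simp: V_Sp_def V_GL_def)
next
  assume *: "x \<in> V_GL m \<and> (\<exists>C. \<forall>K. Y x (bar K) = C - Y x K)"
  then obtain C where C: "\<And>K. Y x (bar K) = C - Y x K" by blast
  have "x (2 * m - 1 - i) = C + 1 - x i" if "i < 2 * m" for i
    using C[of "int i"] Y_per[of x "bar (int i)"] bar_nat[OF that] Y_nat[OF that, of x] Y_nat[of "2 * m - 1 - i" x] that by simp
  then show "x \<in> V_Sp m" using * m_pos by (auto simp: V_Sp_def V_GL_def)
qed

lemma W_Sp_iff: "w \<in> W_Sp m \<longleftrightarrow> w \<in> W_GL m \<and> aff w \<in> SP"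
proof
  assume w: "w \<in> W_Sp m"
  then have wG: "w \<in> W_GL m" by (auto simp: W_Sp_def W_GL_def Xstar_def S_star_def)
  define c where "c = fst w 0 + fst w (2 * m - 1)"
  have s: "fst w i + fst w (2 * m - 1 - i) = c" if "i < 2 * m" for i
  proof (cases "i < m")
    case False
    then have "2 * m - 1 - i < m" "2 * m - 1 - (2 * m - 1 - i) = i" using that by linarith+
    then show ?thesis using W_Sp_sum[OF w, of "2 * m - 1 - i"] by (simp only: c_def add.commute)
  next
    case True
    then show ?thesis unfolding c_def by (rule W_Sp_sum[OF w])
  qed
  have p: "inv (snd w) (2 * m - 1 - i) = 2 * m - 1 - inv (snd w) i" if "i < 2 * m" for i
  proof -
    define j where "j = inv (snd w) i"
    have j: "j < 2 * m" "snd w j = i" using perms_less[OF perms_inv[OF W_GL_perms[OF wG]] that]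
        perms_bij[OF W_GL_perms[OF wG]] by (simp_all add: j_def bij_is_surj surj_f_inv_f)
    have "snd w (2 * m - 1 - j) = 2 * m - 1 - i" using w j by (auto simp: W_Sp_def S_star_def)
    then show ?thesis using perms_bij[OF W_GL_perms[OF wG]] by (simp add: j_def[symmetric] bij_is_inj inv_f_eq)
  qed
  have "aff w (bar K) = bar (aff w K) + c * n" for K
  proof -
    define i where "i = nat (K mod n)"
    have i: "i < 2 * m" "int i = K mod n" unfolding i_def by (rule residue_less, rule int_residue)
    have e: "bar K = int (2 * m - 1 - i) + (- 1 - K div n) * n" unfolding i_def by (rule bar_decomp)
    have il: "2 * m - 1 - i < 2 * m" using i by linarith
    have jl: "inv (snd w) i < 2 * m" using perms_less[OF perms_inv[OF W_GL_perms[OF wG]] i(1)] .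
    have "aff w (bar K) = int (2 * m - 1 - inv (snd w) i) + n * fst w (2 * m - 1 - i) + (- 1 - K div n) * n"
      unfolding e AP_shift[OF aff_AP[OF wG]] using residue_of_nat[OF il] p[OF i(1)] by (simp add: aff_def)
    also have "int (2 * m - 1 - inv (snd w) i) = n - 1 - int (inv (snd w) i)" using jl by (simp add: of_nat_diff n_def)
    also have "fst w (2 * m - 1 - i) = c - fst w i" using s[OF i(1)] by simp
    finally show ?thesis by (simp add: aff_def i_def[symmetric] bar_def algebra_simps)
  qed
  then show "w \<in> W_GL m \<and> aff w \<in> SP" using wG aff_AP[OF wG] unfolding SP_def by blast
next
  assume *: "w \<in> W_GL m \<and> aff w \<in> SP"
  then have wG: "w \<in> W_GL m" by simp
  obtain c where c: "\<And>K. aff w (bar K) = bar (aff w K) + c * n" using * SP_bar by blast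
  have main: "inv (snd w) (2 * m - 1 - i) = 2 * m - 1 - inv (snd w) i \<and> fst w (2 * m - 1 - i) = c - fst w i"
    if i: "i < 2 * m" for i
  proof -
    have il: "2 * m - 1 - i < 2 * m" using i by linarith
    have jl: "inv (snd w) i < 2 * m" using perms_less[OF perms_inv[OF W_GL_perms[OF wG]] i] .
    \<comment> \<open>The partner of \<open>i\<close> is its mirror raised by one period, so
      \<open>c\<close> becomes \<open>c + 1\<close>.\<close>
    have "aff w (int (2 * m - 1 - i)) = bar (aff w (int i)) + (c + 1) * n"
      using c[of "int i"] AP_shift[OF aff_AP[OF wG], of "bar (int i)" 1] bar_nat[OF i] by (simp add: algebra_simps)
    also have "\<dots> = int (2 * m - 1 - inv (snd w) i) + (c - fst w i) * n"
    proof -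
      have "int (2 * m - 1 - inv (snd w) i) = n - 1 - int (inv (snd w) i)" using jl by (simp add: of_nat_diff n_def)
      then show ?thesis using residue_of_nat[OF i] by (simp add: aff_def bar_def algebra_simps)
    qed
    finally have e: "aff w (int (2 * m - 1 - i)) = int (2 * m - 1 - inv (snd w) i) + (c - fst w i) * n" .
    have *: "0 \<le> int (2 * m - 1 - inv (snd w) i)" "int (2 * m - 1 - inv (snd w) i) < n" using jl by (auto simp: n_def)
    have "aff w (int (2 * m - 1 - i)) mod n = int (2 * m - 1 - inv (snd w) i)"
      unfolding e mod_mult_self1 using * by (rule mod_pos_pos_trivial)
    moreover have "aff w (int (2 * m - 1 - i)) div n = (c - fst w i)"
      unfolding e using n_pos div_pos_pos_trivial[OF *] by (simp only: div_mult_self1)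
    ultimately show ?thesis using aff_mod_div[OF wG, of "int (2 * m - 1 - i)"] residue_of_nat[OF il] by simp
  qed
  have "snd w (2 * m - 1 - j) = 2 * m - 1 - snd w j" if j: "j < 2 * m" for j
  proof -
    have b: "bij (snd w)" using perms_bij W_GL_perms wG by blast
    have sj: "snd w j < 2 * m" using perms_less W_GL_perms wG j by blast
    have "inv (snd w) (2 * m - 1 - snd w j) = 2 * m - 1 - j" using main[OF sj] b by (simp add: bij_is_inj)
    then show ?thesis using b by (metis bij_is_surj surj_f_inv_f)
  qed
  then have "snd w \<in> S_star m" using W_GL_perms[OF wG] by (simp add: S_star_def)
  moreover have "fst w \<in> Xstar m" using main m_pos wG by (auto simp: Xstar_def W_GL_def)
  ultimately show "w \<in> W_Sp m" by (simp add: W_Sp_def)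
qed

lemma mono_int_suc:
  fixes y :: "int \<Rightarrow> real"
  assumes "\<And>r. y r < y (r + 1)" shows "strict_mono y"
proof (rule strict_monoI)
  fix I J :: int assume "I < J"
  then have "I + 1 \<le> J" by simp
  then show "y I < y J"
  proof (induction J rule: int_ge_induct)
    case (step i)
    then show ?case using assms[of i] by linarith
  qed (use assms in simp)
qed

lemma Y_mono_iff: "strict_mono (Y x) \<longleftrightarrow> (\<forall>j. j + 1 < 2 * m \<longrightarrow> x j < x (j + 1)) \<and> x (2 * m - 1) < x 0 + 1"
proof
  assume s: "strict_mono (Y x)"
  have "x j < x (j + 1)" if "j + 1 < 2 * m" for j
    using strict_monoD[OF s, of "int j" "int (j + 1)"] Y_nat[of j x] Y_nat[OF that, of x] that by simp
  moreover have "x (2 * m - 1) < x 0 + 1"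
    using strict_monoD[OF s, of "int (2 * m - 1)" "int 0 + n"] Y_nat[of "2 * m - 1" x] Y_nat[of 0 x] Y_per[of x "int 0"] m_pos
    by (simp add: of_nat_diff n_def)
  ultimately show "(\<forall>j. j + 1 < 2 * m \<longrightarrow> x j < x (j + 1)) \<and> x (2 * m - 1) < x 0 + 1" by blast
next
  assume *: "(\<forall>j. j + 1 < 2 * m \<longrightarrow> x j < x (j + 1)) \<and> x (2 * m - 1) < x 0 + 1"
  show "strict_mono (Y x)"
  proof (rule mono_int_suc)
    fix r :: int
    define i where "i = nat (r mod n)"
    have i: "i < 2 * m" "int i = r mod n" unfolding i_def by (rule residue_less, rule int_residue)
    have r: "r = int i + r div n * n" using i by simp
    have Yr: "Y x r = x i + of_int (r div n)" by (simp add: Y_def i_def)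
    show "Y x r < Y x (r + 1)"
    proof (cases "i + 1 < 2 * m")
      case True
      have "r + 1 = int (i + 1) + r div n * n" using r by simp
      then have "Y x (r + 1) = x (i + 1) + of_int (r div n)" using Y_shift[of x "int (i + 1)" "r div n"] Y_nat[OF True, of x] by metis
      then show ?thesis using Yr True * by simp
    next
      case False
      then have "i = 2 * m - 1" using i by linarith
      then have "r + 1 = int 0 + (r div n + 1) * n" using r m_pos by (simp add: of_nat_diff n_def algebra_simps)
      then have "Y x (r + 1) = x 0 + of_int (r div n + 1)"
        using Y_shift[of x "int 0" "r div n + 1"] Y_nat[of 0 x] m_pos by (metis mult_2 add_pos_pos less_le_trans zero_less_one)
      then show ?thesis using Yr \<open>i = 2 * m - 1\<close> * by simp
    qed
  qed
qed

lemma A_GL_iff: "x \<in> A_GL m \<longleftrightarrow> x \<in> V_GL m \<and> strict_mono (Y x)"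
  by (auto simp: A_GL_def Y_mono_iff)

text \<open>The symplectic alcove lists only the inequalities up to the middle; those beyond it are
  mirror images of the ones at \<open>2 * m - 2 - j\<close>.\<close>

lemma A_Sp_iff: "x \<in> A_Sp m \<longleftrightarrow> x \<in> V_Sp m \<and> strict_mono (Y x)"
proof -
  have "(\<forall>j<m. x j < x (j + 1)) \<longleftrightarrow> (\<forall>j. j + 1 < 2 * m \<longrightarrow> x j < x (j + 1))" if x: "x \<in> V_Sp m"
  proof
    assume l: "\<forall>j<m. x j < x (j + 1)"
    show "\<forall>j. j + 1 < 2 * m \<longrightarrow> x j < x (j + 1)"
    proof (intro allI impI)
      fix j assume j: "j + 1 < 2 * m"
      show "x j < x (j + 1)"
      proof (cases "j < m")
        case False
        define i where "i = 2 * m - 1 - (j + 1)"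
        have i: "i < m" "i + 1 < m" "2 * m - 1 - i = j + 1" "2 * m - 1 - (i + 1) = j"
          using False j by (auto simp: i_def)
        have c: "x a + x (2 * m - 1 - a) = x 0 + x (2 * m - 1)" if "a < m" for a using V_Sp_sum[OF x that] .
        have "x (i + 1) + x j = x 0 + x (2 * m - 1)" using c[OF i(2)] i(4) by simp
        moreover have "x i + x (j + 1) = x 0 + x (2 * m - 1)" using c[OF i(1)] i(3) by simp
        moreover have "x i < x (i + 1)" using l i(1) by blast
        ultimately show ?thesis by linarith
      qed (use l in blast)
    qed
  qed auto
  then show ?thesis by (auto simp: A_Sp_def Y_mono_iff)
qed

end

text \<open>The interface between geometry and permutations. \<open>classify\<close> is there
  because reflections are defined as elements fixing a hyperplane pointwise; \<open>V_base\<close>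
  provides a point of the alcove whose values compare as their indices do.\<close>

locale ewg_model = gsp n m + refl_system n \<Gamma> s
  for n :: int and m :: nat and \<Gamma> :: "(int \<Rightarrow> int) set" and s :: "int \<Rightarrow> int \<Rightarrow> int \<Rightarrow> int" +
  fixes G :: "ewg set" and V A :: "pt set"
  assumes G_iff: "w \<in> G \<longleftrightarrow> w \<in> W_GL m \<and> aff w \<in> \<Gamma>"
    and V_sub: "V \<subseteq> V_GL m"
    and V_act: "w \<in> G \<Longrightarrow> x \<in> V \<Longrightarrow> ewg_act w x \<in> V"
    and V_refl: "x \<in> V \<Longrightarrow> \<not> I \<simeq> J \<Longrightarrow> Y x I = Y x J \<Longrightarrow> Y x \<circ> s I J = Y x"
    and A_iff: "x \<in> A \<longleftrightarrow> x \<in> V \<and> strict_mono (Y x)"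
    and V_base: "\<exists>x\<in>V. \<forall>K. Y x K = of_int K / of_int n"
    and classify: "\<kappa> \<in> \<Gamma> \<Longrightarrow> \<not> I \<simeq> J \<Longrightarrow> (\<And>x. x \<in> V \<Longrightarrow> Y x I = Y x J \<Longrightarrow> Y x \<circ> \<kappa> = Y x)
      \<Longrightarrow> \<kappa> = id \<or> \<kappa> = s I J"
begin

section \<open>Hyperplanes, lengths and reflections\<close>

definition wall :: "int \<Rightarrow> int \<Rightarrow> pt set" where "wall I J = {x \<in> V. Y x I = Y x J}"

definition fixed :: "(int \<Rightarrow> int) \<Rightarrow> pt set" where "fixed t = {x \<in> V. Y x \<circ> t = Y x}"

lemma G_W_GL: "w \<in> G \<Longrightarrow> w \<in> W_GL m" and G_aff: "w \<in> G \<Longrightarrow> aff w \<in> \<Gamma>" by (auto simp: G_iff)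

lemma G_surj: assumes "\<pi> \<in> \<Gamma>" obtains w where "w \<in> G" "aff w = \<pi>"
  using aff_surj[OF G_AP[OF assms]] assms G_iff by metis

lemma G_inj: "w \<in> G \<Longrightarrow> v \<in> G \<Longrightarrow> aff w = aff v \<Longrightarrow> w = v" using aff_inj G_W_GL by blast

lemma G_mult: "w \<in> G \<Longrightarrow> v \<in> G \<Longrightarrow> ewg_mult w v \<in> G"
  using mult_W_GL aff_mult G_comp by (simp add: G_iff)

lemma aff_G_mult: "w \<in> G \<Longrightarrow> v \<in> G \<Longrightarrow> aff (ewg_mult w v) = aff v \<circ> aff w"
  using aff_mult G_W_GL by blast

lemma G_one: "ewg_one \<in> G" using one_W_GL aff_one G_id by (simp add: G_iff)

lemma V_eq: "x \<in> V \<Longrightarrow> y \<in> V \<Longrightarrow> x = y \<longleftrightarrow> Y x = Y y" using Y_inj V_sub by blast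

lemma act_eq: "w \<in> G \<Longrightarrow> x \<in> V \<Longrightarrow> ewg_act w x = x \<longleftrightarrow> Y x \<circ> aff w = Y x"
  using V_eq[OF V_act] Y_act[OF G_W_GL] by simp

lemma s_ne_id: assumes "\<not> I \<simeq> J" shows "s I J \<noteq> id"
proof
  assume "s I J = id"
  then have "J = I" using s_left[OF assms] by simp
  then show False using assms by simp
qed

lemma wall_fixed: assumes "\<not> I \<simeq> J" shows "wall I J = fixed (s I J)"
  using V_refl[OF _ assms] s_left[OF assms] by (auto simp: wall_def fixed_def fun_eq_iff) metis

text \<open>Distinct reflections have distinct hyperplanes, which lets separating hyperplanes be
  counted as inversions.\<close>

lemma fixed_inj: assumes "\<not> I \<simeq> J" "\<not> K \<simeq> L" "fixed (s I J) = fixed (s K L)" shows "s I J = s K L"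
proof -
  have "s K L = id \<or> s K L = s I J"
  proof (rule classify[OF s_in[OF assms(2)] assms(1)])
    fix x assume "x \<in> V" "Y x I = Y x J"
    then have "x \<in> fixed (s K L)" using assms(3) wall_fixed[OF assms(1)] by (auto simp: wall_def)
    then show "Y x \<circ> s K L = Y x" by (simp add: fixed_def)
  qed
  then show ?thesis using s_ne_id[OF assms(2)] by auto
qed

lemma wall_commute: "wall I J = wall J I" by (auto simp: wall_def)

lemma wall_shift: "wall (I + k * n) (J + k * n) = wall I J" by (simp add: wall_def Y_shift)

lemma normal_pair:
  assumes "\<not> I \<simeq> J"
  obtains i j k l where "i < j" "j < 2 * m" "I = int i + l * n" "J = int j + k * n + l * n"
    | i j k l where "i < j" "j < 2 * m" "J = int i + l * n" "I = int j + k * n + l * n"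
proof -
  define i where "i = nat (I mod n)"
  define j where "j = nat (J mod n)"
  have ij: "i < 2 * m" "j < 2 * m" "int i = I mod n" "int j = J mod n"
    unfolding i_def j_def by (rule residue_less int_residue)+
  have "I mod n \<noteq> J mod n" using assms by (simp add: mod_eq_dvd_iff)
  then have "i \<noteq> j" using ij(3,4) by auto
  have I: "I = int i + (I div n) * n" and J: "J = int j + (J div n) * n" using ij by simp_all
  consider "i < j" | "j < i" using \<open>i \<noteq> j\<close> by linarith
  then show ?thesis
  proof cases
    case 1
    have "J = int j + (J div n - I div n) * n + (I div n) * n" using J by (simp add: algebra_simps)
    then show ?thesis using that(1) 1 ij I by blast
  next
    case 2
    have "I = int i + (I div n - J div n) * n + (J div n) * n" using I by (simp add: algebra_simps)
    then show ?thesis using that(2) 2 ij J by blast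
  qed
qed

lemma wall_coord: assumes "i < j" "j < 2 * m" shows "{x \<in> V. x i - x j = real_of_int k} = wall (int i) (int j + k * n)"
  using Y_nat[of i] Y_nat[of j] assms by (auto simp: wall_def Y_shift)

lemma coord_not_res: assumes "i < j" "j < 2 * m" shows "\<not> int i \<simeq> int j + k * n"
proof
  assume "int i \<simeq> int j + k * n"
  then have "int i mod n = (int j + k * n) mod n" by (simp only: mod_eq_dvd_iff)
  then show False using int_less_n[of i] int_less_n[of j] assms by simp
qed

lemma hyps_eq: "hyps (2 * m) V = {wall I J | I J. \<not> I \<simeq> J}"
proof
  show "hyps (2 * m) V \<subseteq> {wall I J | I J. \<not> I \<simeq> J}"
    using wall_coord coord_not_res by (fastforce simp: hyps_def)
  show "{wall I J | I J. \<not> I \<simeq> J} \<subseteq> hyps (2 * m) V"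
  proof
    fix H assume "H \<in> {wall I J | I J. \<not> I \<simeq> J}"
    then obtain I J where IJ: "H = wall I J" "\<not> I \<simeq> J" by blast
    show "H \<in> hyps (2 * m) V" using IJ(2)
    proof (cases rule: normal_pair)
      case (1 i j k l)
      then have "H = {x \<in> V. x i - x j = real_of_int k}" using wall_shift wall_coord IJ by simp
      then show ?thesis using 1 by (auto simp: hyps_def)
    next
      case (2 i j k l)
      then have "H = {x \<in> V. x i - x j = real_of_int k}" using wall_shift wall_coord IJ wall_commute by simp
      then show ?thesis using 2 by (auto simp: hyps_def)
    qed
  qed
qed

lemma base_mono: obtains b where "b \<in> A" "\<And>K. Y b K = of_int K / of_int n"
proof -
  obtain b where b: "b \<in> V" "\<And>K. Y b K = of_int K / of_int n" using V_base by blast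
  have "strict_mono (Y b)" using n_pos by (intro strict_monoI) (simp add: b divide_strict_right_mono)
  then show ?thesis using b that A_iff by blast
qed

text \<open>The sign of a root on the base alcove is the order of \<open>I\<close> and
  \<open>J\<close>, and on the image alcove the order of \<open>aff w I\<close> and
  \<open>aff w J\<close>. A hyperplane separates when the two disagree.\<close>

lemma sep_hyps_eq: assumes w: "w \<in> G"
  shows "sep_hyps (2 * m) V A (ewg_act w ` A) = fixed ` Inv (aff w)"
proof
  have p: "aff w \<in> \<Gamma>" using G_aff[OF w] .
  show "sep_hyps (2 * m) V A (ewg_act w ` A) \<subseteq> fixed ` Inv (aff w)"
  proof
    fix H assume "H \<in> sep_hyps (2 * m) V A (ewg_act w ` A)"
    then obtain i j k b x where H: "i < j" "j < 2 * m" "H = {x \<in> V. x i - x j = real_of_int k}" "b \<in> A" "x \<in> A"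
        "(b i - b j - real_of_int k) * (ewg_act w x i - ewg_act w x j - real_of_int k) < 0"
      by (auto simp: sep_hyps_def)
    define I where "I = int i"
    define J where "J = int j + k * n"
    have n: "\<not> I \<simeq> J" using coord_not_res H by (simp add: I_def J_def)
    have e: "y i - y j - real_of_int k = Y y I - Y y J" for y
      using Y_nat[of i y] Y_nat[of j y] H by (simp add: I_def J_def Y_shift)
    have mono: "strict_mono (Y b)" "strict_mono (Y x)" using H A_iff by auto
    have prod: "(Y b I - Y b J) * (Y x (aff w I) - Y x (aff w J)) < 0"
      using H(6) unfolding e Y_act[OF G_W_GL[OF w]] by simp
    have Hf: "H = fixed (s I J)" using H wall_coord wall_fixed[OF n] by (simp add: I_def J_def)
    have "(I < J \<and> aff w J < aff w I) \<or> (J < I \<and> aff w I < aff w J)"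
      using prod strict_mono_less[OF mono(1)] strict_mono_less[OF mono(2)] by (auto simp: mult_less_0_iff)
    then have "s I J \<in> Inv (aff w)"
      using n res_sym s_commute[OF n] unfolding Inv_def by blast
    then show "H \<in> fixed ` Inv (aff w)" using Hf by blast
  qed
  show "fixed ` Inv (aff w) \<subseteq> sep_hyps (2 * m) V A (ewg_act w ` A)"
  proof
    fix H assume "H \<in> fixed ` Inv (aff w)"
    then obtain I J where IJ: "H = wall I J" "\<not> I \<simeq> J" "I < J" "aff w J < aff w I"
      using wall_fixed by (auto simp: Inv_def)
    obtain b where b: "b \<in> A" "\<And>K. Y b K = of_int K / of_int n" using base_mono by blast
    have e: "y i - y j - real_of_int k = Y y (int i) - Y y (int j + k * n)" if "i < j" "j < 2 * m" for i j k y
      using Y_nat[of i y] Y_nat[of j y] that by (simp add: Y_shift)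
    have mono: "strict_mono (Y b)" using b A_iff by auto
    have "(Y b I - Y b J) * (Y b (aff w I) - Y b (aff w J)) < 0"
      using IJ mono by (simp add: mult_less_0_iff strict_mono_less)
    then have prod: "(Y b I - Y b J) * (Y (ewg_act w b) I - Y (ewg_act w b) J) < 0"
      unfolding Y_act[OF G_W_GL[OF w]] by simp
    have "\<exists>i j k. i < j \<and> j < 2 * m \<and> H = {x \<in> V. x i - x j = real_of_int k} \<and>
      (b i - b j - real_of_int k) * (ewg_act w b i - ewg_act w b j - real_of_int k) < 0"
      using IJ(2)
    proof (cases rule: normal_pair)
      case (1 i j k l)
      have "H = {x \<in> V. x i - x j = real_of_int k}" using wall_shift wall_coord IJ 1 by simp
      moreover have "(b i - b j - real_of_int k) * (ewg_act w b i - ewg_act w b j - real_of_int k) < 0"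
        using prod unfolding e[OF 1(1,2)] 1(3,4) Y_shift by simp
      ultimately show ?thesis using 1 by blast
    next
      case (2 i j k l)
      have "H = {x \<in> V. x i - x j = real_of_int k}" using wall_shift wall_coord IJ 2 wall_commute by simp
      moreover have "(b i - b j - real_of_int k) * (ewg_act w b i - ewg_act w b j - real_of_int k) < 0"
        using prod unfolding e[OF 2(1,2)] 2(3,4) Y_shift by (auto simp: mult_less_0_iff)
      ultimately show ?thesis using 2 by blast
    qed
    then show "H \<in> sep_hyps (2 * m) V A (ewg_act w ` A)"
      using b(1) unfolding sep_hyps_def hyps_def by blast
  qed
qed

lemma alen_eq: assumes "w \<in> G" shows "alen (2 * m) V A w = card (Inv (aff w))"
proof -
  have "inj_on fixed (Inv (aff w))" by (rule inj_onI) (auto simp: Inv_def intro: fixed_inj)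
  then show ?thesis unfolding alen_def sep_hyps_eq[OF assms] by (rule card_image)
qed

lemma refls_eq: "refls G (2 * m) V = {r \<in> G. \<exists>I J. \<not> I \<simeq> J \<and> aff r = s I J}"
proof
  show "refls G (2 * m) V \<subseteq> {r \<in> G. \<exists>I J. \<not> I \<simeq> J \<and> aff r = s I J}"
  proof
    fix r assume "r \<in> refls G (2 * m) V"
    then obtain I J x where r: "r \<in> G" "\<not> I \<simeq> J" "\<forall>x\<in>wall I J. ewg_act r x = x" "x \<in> V" "ewg_act r x \<noteq> x"
      unfolding refls_def hyps_eq by blast
    have "aff r = id \<or> aff r = s I J"
      using r act_eq[OF r(1)] by (intro classify G_aff) (auto simp: wall_def)
    moreover have "aff r \<noteq> id" using r act_eq[OF r(1,4)] by auto
    ultimately show "r \<in> {r \<in> G. \<exists>I J. \<not> I \<simeq> J \<and> aff r = s I J}" using r by blast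
  qed
  show "{r \<in> G. \<exists>I J. \<not> I \<simeq> J \<and> aff r = s I J} \<subseteq> refls G (2 * m) V"
  proof
    fix r assume "r \<in> {r \<in> G. \<exists>I J. \<not> I \<simeq> J \<and> aff r = s I J}"
    then obtain I J where r: "r \<in> G" "\<not> I \<simeq> J" "aff r = s I J" by blast
    have "\<forall>x\<in>wall I J. ewg_act r x = x" using act_eq[OF r(1)] wall_fixed[OF r(2)] r(3) by (auto simp: fixed_def)
    moreover have "\<forall>x\<in>V. ewg_act r (ewg_act r x) = x"
    proof
      fix x assume x: "x \<in> V"
      have "Y (ewg_act r (ewg_act r x)) = Y x"
        using s_invol[OF r(2)] by (auto simp: Y_act[OF G_W_GL[OF r(1)]] r(3))
      then show "ewg_act r (ewg_act r x) = x" using V_eq V_act r x by blast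
    qed
    moreover have "\<exists>x\<in>V. ewg_act r x \<noteq> x"
    proof -
      obtain b where b: "b \<in> A" "\<And>K. Y b K = of_int K / of_int n" using base_mono by blast
      have "I \<noteq> J" using r(2) by auto
      then have "Y b (s I J I) \<noteq> Y b I" using b(2)[of I] b(2)[of J] n_pos s_left[OF r(2)] by simp
      then have "Y b \<circ> aff r \<noteq> Y b" by (auto simp: r(3) fun_eq_iff)
      then show ?thesis using act_eq[OF r(1)] b A_iff by blast
    qed
    ultimately show "r \<in> refls G (2 * m) V" using r unfolding refls_def hyps_eq by blast
  qed
qed

lemma affW_G: "x \<in> affW G (2 * m) V \<Longrightarrow> x \<in> G"
  unfolding affW_def by (induction rule: gen_by.induct) (auto simp: G_one refls_eq G_mult)

lemma ST_refl_left:
  assumes "\<pi> \<in> \<Gamma>" "\<not> I \<simeq> J" "card (Inv \<pi>) < card (Inv (s I J \<circ> \<pi>))" shows "(\<pi>, s I J \<circ> \<pi>) \<in> ST"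
proof -
  have main: "(\<pi>, s I J \<circ> \<pi>) \<in> ST" if IJ: "\<not> I \<simeq> J" "inv \<pi> I < inv \<pi> J" "card (Inv \<pi>) < card (Inv (s I J \<circ> \<pi>))" for I J
  proof -
    define A where "A = inv \<pi> I"
    define B where "B = inv \<pi> J"
    have AB: "\<pi> A = I" "\<pi> B = J" using AP_inv_r[OF G_AP[OF assms(1)]] by (auto simp: A_def B_def)
    then have n: "\<not> A \<simeq> B" using IJ G_res[OF assms(1), of A B] by simp
    have e: "s I J \<circ> \<pi> = \<pi> \<circ> s A B" using comp_s_eq[OF assms(1) n] AB by simp
    have "A < B" using IJ by (simp add: A_def B_def)
    then show ?thesis using card_Inv_less_iff[OF assms(1) n] IJ(3) STI[OF assms(1) n] unfolding e by blast
  qed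
  have "I \<noteq> J" using assms(2) by auto
  then have "inv \<pi> I \<noteq> inv \<pi> J" using AP_eq[OF AP_inv[OF G_AP[OF assms(1)]]] by simp
  then consider "inv \<pi> I < inv \<pi> J" | "inv \<pi> J < inv \<pi> I" by linarith
  then show ?thesis
    using main[of I J] main[of J I] assms(2,3) s_commute[OF assms(2)] res_sym[of J I] by cases auto
qed

abbreviation "BR \<equiv> {(x, ewg_mult x r) | x r. r \<in> refls G (2 * m) V \<and> alen (2 * m) V A x < alen (2 * m) V A (ewg_mult x r)}"

lemma BR_ST: assumes "x \<in> G" "(x, y) \<in> BR" shows "y \<in> G" "(aff x, aff y) \<in> ST"
proof -
  obtain r where r: "r \<in> refls G (2 * m) V" "y = ewg_mult x r" "alen (2 * m) V A x < alen (2 * m) V A y"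
    using assms(2) by auto
  then obtain I J where IJ: "r \<in> G" "\<not> I \<simeq> J" "aff r = s I J" unfolding refls_eq by blast
  show y: "y \<in> G" using r G_mult assms IJ by simp
  have "card (Inv (aff x)) < card (Inv (s I J \<circ> aff x))"
    using r(3) alen_eq[OF assms(1)] alen_eq[OF y] aff_G_mult[OF assms(1) IJ(1)] r(2) IJ(3) by simp
  then show "(aff x, aff y) \<in> ST" using ST_refl_left[OF G_aff[OF assms(1)] IJ(2)] r(2) aff_G_mult[OF assms(1) IJ(1)] IJ(3) by simp
qed

lemma BRs_ST: assumes "(x, y) \<in> BR\<^sup>*" "x \<in> G" shows "y \<in> G \<and> aff x \<preceq> aff y"
  using assms(1)
proof (induction rule: rtrancl_induct)
  case base
  then show ?case using assms(2) by simp
next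
  case (step y z)
  then show ?case using BR_ST[OF _ step(2)] by (meson rtrancl.rtrancl_into_rtrancl)
qed

text \<open>At the base point values increase with the index, so an element preserving the alcove is
  increasing; conversely an increasing element and its inverse both map the alcove into
  itself.\<close>

lemma stab_iff: "\<omega> \<in> stab_alc G A \<longleftrightarrow> \<omega> \<in> G \<and> strict_mono (aff \<omega>)"
proof
  assume w: "\<omega> \<in> stab_alc G A"
  obtain b where b: "b \<in> A" "\<And>K. Y b K = of_int K / of_int n" using base_mono by blast
  have "ewg_act \<omega> b \<in> A" using w b by (auto simp: stab_alc_def)
  then have "strict_mono (Y b \<circ> aff \<omega>)" using w A_iff Y_act[OF G_W_GL] by (auto simp: stab_alc_def)
  then have "aff \<omega> I < aff \<omega> J" if "I < J" for I J
    using strict_monoD[OF _ that, of "Y b \<circ> aff \<omega>"] n_pos by (simp add: b(2) divide_less_cancel)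
  then show "\<omega> \<in> G \<and> strict_mono (aff \<omega>)" using w by (auto simp: stab_alc_def intro: strict_monoI)
next
  assume w: "\<omega> \<in> G \<and> strict_mono (aff \<omega>)"
  have sub: "ewg_act v x \<in> A" if "v \<in> G" "strict_mono (aff v)" "x \<in> A" for v x
    using that A_iff V_act Y_act[OF G_W_GL] by (simp add: strict_mono_def)
  obtain v where v: "v \<in> G" "aff v = inv (aff \<omega>)" using G_surj[OF G_inv[OF G_aff]] w by blast
  note oA = G_AP[OF G_aff, of \<omega>]
  have "strict_mono (aff v)"
  proof (rule strict_monoI)
    fix I J :: int assume "I < J"
    then show "aff v I < aff v J"
      using strict_mono_less[of "aff \<omega>" "aff v I" "aff v J"] AP_inv_r[OF oA] w v(2) by simp
  qed
  have "x \<in> ewg_act \<omega> ` A" if x: "x \<in> A" for x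
  proof -
    have vx: "ewg_act v x \<in> A" using sub v \<open>strict_mono (aff v)\<close> x by blast
    have "Y (ewg_act \<omega> (ewg_act v x)) = Y x"
      using Y_act[OF G_W_GL] w v AP_inv_l[OF oA] by (auto simp: fun_eq_iff)
    then have "ewg_act \<omega> (ewg_act v x) = x" using V_eq V_act w vx x A_iff by blast
    then show ?thesis using vx by (metis image_eqI)
  qed
  then have "A \<subseteq> ewg_act \<omega> ` A" by blast
  moreover have "ewg_act \<omega> ` A \<subseteq> A" using sub[of \<omega>] w by blast
  ultimately show "\<omega> \<in> stab_alc G A" using w by (simp add: stab_alc_def)
qed

section \<open>The alcove stabiliser and the Bruhat order of the extended group\<close>

lemma affW_one: "ewg_one \<in> affW G (2 * m) V" by (simp add: affW_def gen_by.gen_one)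

lemma affW_step: "x \<in> affW G (2 * m) V \<Longrightarrow> r \<in> refls G (2 * m) V \<Longrightarrow> ewg_mult x r \<in> affW G (2 * m) V"
  by (simp add: affW_def gen_by.gen_step)

text \<open>Induction on length: reflections at descents shorten the element until it is increasing,
  and then it stabilises the alcove.\<close>

lemma decompose: assumes "w \<in> G"
  shows "\<exists>x\<in>affW G (2 * m) V. \<exists>\<omega>\<in>stab_alc G A. w = ewg_mult x \<omega>"
  using assms
proof (induction "card (Inv (aff w))" arbitrary: w rule: less_induct)
  case less
  have wG: "aff w \<in> \<Gamma>" using G_aff less by blast
  show ?case
  proof (cases "strict_mono (aff w)")
    case True
    have "w = ewg_mult ewg_one w" by (rule G_inj) (auto simp: less G_mult G_one aff_G_mult aff_one)
    then show ?thesis using True affW_one stab_iff less by blast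
  next
    case False
    then obtain r where r: "aff w (r + 1) < aff w r" using AP_mono_or_descent[OF G_AP[OF wG]] by blast
    let ?t = "s r (r + 1)"
    note n = res_suc(1)[of r]
    obtain t where t: "t \<in> G" "aff t = ?t" using G_surj[OF s_in[OF n]] by blast
    define v where "v = ewg_mult t w"
    have v: "v \<in> G" "aff v = aff w \<circ> ?t" using G_mult aff_G_mult t less by (auto simp: v_def)
    have "card (Inv (aff v)) < card (Inv (aff v \<circ> ?t))"
      using card_Inv_less[OF G_aff[OF v(1)] n] r s_left[OF n] s_right[OF n] by (simp add: v(2))
    then have "card (Inv (aff v)) < card (Inv (aff w))" using comp_s_s[OF n, of "aff w"] by (simp add: v(2))
    then obtain x \<omega> where x: "x \<in> affW G (2 * m) V" "\<omega> \<in> stab_alc G A" "v = ewg_mult x \<omega>" using less(1) v by blast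
    have xG: "x \<in> G" using affW_G x by blast
    note xA = G_aff[OF xG]
    have oG: "\<omega> \<in> G" using x stab_iff by blast
    \<comment> \<open>The affine Weyl group is generated by multiplication on the right, so the
      reflection \<open>t\<close> is moved past \<open>x\<close>: its conjugate \<open>t'\<close>
      satisfies \<open>ewg_mult x t' = ewg_mult t x\<close>.\<close>
    have n': "\<not> aff x r \<simeq> aff x (r + 1)" using n G_res[OF xA] by blast
    obtain t' where t': "t' \<in> G" "aff t' = s (aff x r) (aff x (r + 1))" using G_surj[OF s_in[OF n']] by blast
    have t'R: "t' \<in> refls G (2 * m) V" using t' n' unfolding refls_eq by blast
    have "w = ewg_mult (ewg_mult x t') \<omega>"
    proof (rule G_inj)
      show "w \<in> G" using less by blast
      show "ewg_mult (ewg_mult x t') \<omega> \<in> G" using G_mult xG t' oG by blast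
      have "aff (ewg_mult (ewg_mult x t') \<omega>) = aff \<omega> \<circ> (aff x \<circ> ?t)"
        using aff_G_mult G_mult xG t' oG comp_s_eq[OF xA n] by simp
      also have "\<dots> = aff v \<circ> ?t" using aff_G_mult xG oG x by (simp add: comp_assoc)
      also have "\<dots> = aff w" using comp_s_s[OF n, of "aff w"] by (simp add: v(2))
      finally show "aff w = aff (ewg_mult (ewg_mult x t') \<omega>)" ..
    qed
    then show ?thesis using affW_step[OF x(1) t'R] x(2) by blast
  qed
qed

text \<open>As \<open>aff \<omega>\<close> is increasing, a step up from
  \<open>aff \<omega> \<circ> aff y\<close> is a step up from \<open>aff y\<close>, so a chain never
  leaves the component of \<open>\<omega>\<close>.\<close>

lemma ST_lift:
  assumes x: "x \<in> affW G (2 * m) V" and \<omega>: "\<omega> \<in> stab_alc G A" and le: "aff (ewg_mult x \<omega>) \<preceq> \<pi>"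
  shows "\<exists>y\<in>affW G (2 * m) V. (x, y) \<in> BR\<^sup>* \<and> \<pi> = aff (ewg_mult y \<omega>)"
  using le
proof (induction rule: rtrancl_induct)
  case base
  then show ?case using x by blast
next
  case (step \<pi> \<pi>')
  then obtain y where y: "y \<in> affW G (2 * m) V" "(x, y) \<in> BR\<^sup>*" "\<pi> = aff (ewg_mult y \<omega>)" by blast
  obtain I J where IJ: "\<not> I \<simeq> J" "I < J" "\<pi> I < \<pi> J" "\<pi>' = \<pi> \<circ> s I J" using step(2) by (rule STE)
  have yG: "y \<in> G" using affW_G y by blast
  note yA = G_aff[OF yG]
  have oG: "\<omega> \<in> G" "strict_mono (aff \<omega>)" using \<omega> stab_iff by blast+
  have pi: "\<pi> = aff \<omega> \<circ> aff y" using aff_G_mult y yG oG by simp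
  have lt: "aff y I < aff y J" using IJ(3) pi oG(2) by (simp add: strict_mono_less)
  have n': "\<not> aff y I \<simeq> aff y J" using IJ G_res[OF yA] by blast
  obtain r where r: "r \<in> G" "aff r = s (aff y I) (aff y J)" using G_surj[OF s_in[OF n']] by blast
  have rR: "r \<in> refls G (2 * m) V" using r n' unfolding refls_eq by blast
  have e: "aff (ewg_mult y r) = aff y \<circ> s I J" using aff_G_mult yG r comp_s_eq[OF yA IJ(1)] by simp
  have "alen (2 * m) V A y < alen (2 * m) V A (ewg_mult y r)"
    using alen_eq[OF yG] alen_eq[OF G_mult[OF yG r(1)]] card_Inv_less[OF yA IJ(1,2) lt] e by simp
  then have "(y, ewg_mult y r) \<in> BR" using rR by blast
  moreover have "\<pi>' = aff (ewg_mult (ewg_mult y r) \<omega>)"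
    using aff_G_mult[OF G_mult[OF yG r(1)] oG(1)] e IJ(4) pi by (simp add: comp_assoc)
  moreover have "(x, ewg_mult y r) \<in> BR\<^sup>*" using y(2) calculation(1) by (rule rtrancl_into_rtrancl)
  ultimately show ?case using affW_step[OF y(1) rR] by blast
qed

lemma bruhat_iff: "bruhat G (2 * m) V A w w' \<longleftrightarrow> w \<in> G \<and> w' \<in> G \<and> aff w \<preceq> aff w'"
proof
  assume "bruhat G (2 * m) V A w w'"
  then obtain x x' \<omega> where x: "x \<in> affW G (2 * m) V" "x' \<in> affW G (2 * m) V" "\<omega> \<in> stab_alc G A"
      "w = ewg_mult x \<omega>" "w' = ewg_mult x' \<omega>" "(x, x') \<in> BR\<^sup>*"
    unfolding bruhat_def bruhat_aff_def by blast
  have xG: "x \<in> G" "x' \<in> G" "\<omega> \<in> G" "strict_mono (aff \<omega>)" using affW_G x stab_iff by blast+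
  have "aff \<omega> \<circ> aff x \<preceq> aff \<omega> \<circ> aff x'" using le_mono_left[OF G_aff[OF xG(3)] xG(4)] BRs_ST[OF x(6) xG(1)] by blast
  then show "w \<in> G \<and> w' \<in> G \<and> aff w \<preceq> aff w'" using x xG G_mult aff_G_mult by simp
next
  assume *: "w \<in> G \<and> w' \<in> G \<and> aff w \<preceq> aff w'"
  then obtain x \<omega> where x: "x \<in> affW G (2 * m) V" "\<omega> \<in> stab_alc G A" "w = ewg_mult x \<omega>" using decompose by blast
  then obtain y where y: "y \<in> affW G (2 * m) V" "(x, y) \<in> BR\<^sup>*" "aff w' = aff (ewg_mult y \<omega>)" using ST_lift * by blast
  have "w' = ewg_mult y \<omega>" using G_inj[OF _ _ y(3)] * G_mult affW_G y(1) x(2) stab_iff by blast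
  then show "bruhat G (2 * m) V A w w'" unfolding bruhat_def bruhat_aff_def using x y by blast
qed

end

section \<open>Parahoric cosets and admissible sets\<close>

context ewg_model
begin

definition para :: "int set \<Rightarrow> ewg set" where "para T = {w \<in> G. aff w \<in> PB T}"

lemma mem_coset: assumes "w \<in> G"
  shows "u \<in> coset w (para T) \<longleftrightarrow> u \<in> G \<and> (\<exists>q\<in>\<Gamma> \<inter> PB T. aff u = q \<circ> aff w)"
proof
  assume "u \<in> coset w (para T)"
  then obtain p where p: "p \<in> G" "aff p \<in> PB T" "u = ewg_mult w p" by (auto simp: coset_def para_def)
  then show "u \<in> G \<and> (\<exists>q\<in>\<Gamma> \<inter> PB T. aff u = q \<circ> aff w)"
    using G_mult[OF assms p(1)] aff_G_mult[OF assms p(1)] G_aff[OF p(1)]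
    by (intro conjI bexI[of _ "aff p"]) auto
next
  assume u: "u \<in> G \<and> (\<exists>q\<in>\<Gamma> \<inter> PB T. aff u = q \<circ> aff w)"
  then obtain q where q: "q \<in> \<Gamma>" "q \<in> PB T" "aff u = q \<circ> aff w" by blast
  obtain p where p: "p \<in> G" "aff p = q" using G_surj[OF q(1)] by blast
  have "u = ewg_mult w p" using u p q G_mult[OF assms p(1)] aff_G_mult[OF assms p(1)] by (intro G_inj) auto
  then show "u \<in> coset w (para T)" using p q by (auto simp: coset_def para_def)
qed

text \<open>A shortest element equals the reduced one found below it in its coset; conversely the
  inversions of a reduced element are contained in those of every coset member.\<close>

lemma minrep_iff:
  assumes T: "T \<noteq> {}" and s_PB: "\<And>I J. \<not> I \<simeq> J \<Longrightarrow> blk T I J \<Longrightarrow> s I J \<in> PB T" and w: "w \<in> G"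
  shows "minrep (2 * m) V A (coset w (para T)) u \<longleftrightarrow> u \<in> coset w (para T) \<and> red T (aff u)"
proof
  assume u: "minrep (2 * m) V A (coset w (para T)) u"
  then have uc: "u \<in> coset w (para T)" by (simp add: minrep_def)
  then obtain q where q: "u \<in> G" "q \<in> \<Gamma> \<inter> PB T" "aff u = q \<circ> aff w" using mem_coset[OF w] by blast
  obtain p where p: "p \<in> \<Gamma> \<inter> PB T" "red T (p \<circ> aff u)" "p \<circ> aff u \<preceq> aff u"
    using red_below[OF T s_PB G_aff[OF q(1)]] by blast
  obtain v where v: "v \<in> G" "aff v = p \<circ> aff u" using G_surj[of "p \<circ> aff u"] G_comp G_aff q p by blast
  have "aff v = (p \<circ> q) \<circ> aff w" using v q by (simp add: comp_assoc)
  then have "v \<in> coset w (para T)" using mem_coset[OF w] v p q G_comp PB_comp by blast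
  then have "alen (2 * m) V A u \<le> alen (2 * m) V A v" using u by (simp add: minrep_def)
  then have "card (Inv (aff u)) \<le> card (Inv (aff v))" using alen_eq q(1) v(1) by simp
  then have "aff v = aff u" using le_card[OF p(3)] v by auto
  then show "u \<in> coset w (para T) \<and> red T (aff u)" using uc p v by simp
next
  assume u: "u \<in> coset w (para T) \<and> red T (aff u)"
  then obtain q where q: "u \<in> G" "q \<in> \<Gamma> \<inter> PB T" "aff u = q \<circ> aff w" using mem_coset[OF w] by blast
  have qA: "q \<in> AP" using q PB_AP by blast
  have "alen (2 * m) V A u \<le> alen (2 * m) V A v" if vc: "v \<in> coset w (para T)" for v
  proof -
    obtain p where p: "v \<in> G" "p \<in> \<Gamma> \<inter> PB T" "aff v = p \<circ> aff w" using mem_coset[OF w] vc by blast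
    have "aff v = (p \<circ> inv q) \<circ> aff u" using p q AP_inv_l[OF qA] by (auto simp: fun_eq_iff)
    moreover have "p \<circ> inv q \<in> \<Gamma>" "p \<circ> inv q \<in> PB T" using p q G_comp G_inv PB_comp PB_inv by auto
    ultimately have "Inv (aff u) \<subseteq> Inv (aff v)" 
      using red_Inv_subset[OF G_aff[OF q(1)] conjunct2[OF u]] by simp
    then show ?thesis using alen_eq q(1) p(1) finite_Inv[OF G_aff[OF p(1)]] by (simp add: card_mono)
  qed
  then show "minrep (2 * m) V A (coset w (para T)) u" using u by (simp add: minrep_def)
qed

lemma coset_le_iff:
  assumes T: "T \<noteq> {}" and s_PB: "\<And>I J. \<not> I \<simeq> J \<Longrightarrow> blk T I J \<Longrightarrow> s I J \<in> PB T" and wv: "w \<in> G" "v \<in> G"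
  shows "coset_le G (2 * m) V A (coset w (para T)) (coset v (para T)) \<longleftrightarrow>
    (\<exists>q\<in>\<Gamma> \<inter> PB T. \<exists>p\<in>\<Gamma> \<inter> PB T. red T (q \<circ> aff w) \<and> red T (p \<circ> aff v) \<and> q \<circ> aff w \<preceq> p \<circ> aff v)"
proof -
  have minrep: "minrep (2 * m) V A (coset x (para T)) u \<longleftrightarrow> u \<in> G \<and> (\<exists>q\<in>\<Gamma> \<inter> PB T. aff u = q \<circ> aff x) \<and> red T (aff u)"
    if "x \<in> G" for x u
    using minrep_iff[OF T s_PB that] mem_coset[OF that] by blast
  have lift: "\<exists>u\<in>G. aff u = q \<circ> aff x" if "q \<in> \<Gamma>" "x \<in> G" for q x
    using G_surj[of "q \<circ> aff x"] G_comp G_aff that by metis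
  show ?thesis
  proof
    assume "coset_le G (2 * m) V A (coset w (para T)) (coset v (para T))"
    then show "\<exists>q\<in>\<Gamma> \<inter> PB T. \<exists>p\<in>\<Gamma> \<inter> PB T. red T (q \<circ> aff w) \<and> red T (p \<circ> aff v) \<and> q \<circ> aff w \<preceq> p \<circ> aff v"
      unfolding coset_le_def minrep[OF wv(1)] minrep[OF wv(2)] bruhat_iff by metis
  next
    assume "\<exists>q\<in>\<Gamma> \<inter> PB T. \<exists>p\<in>\<Gamma> \<inter> PB T. red T (q \<circ> aff w) \<and> red T (p \<circ> aff v) \<and> q \<circ> aff w \<preceq> p \<circ> aff v"
    then obtain q p where qp: "q \<in> \<Gamma> \<inter> PB T" "p \<in> \<Gamma> \<inter> PB T" "red T (q \<circ> aff w)" "red T (p \<circ> aff v)" "q \<circ> aff w \<preceq> p \<circ> aff v"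
      by blast
    obtain u u' where u: "u \<in> G" "aff u = q \<circ> aff w" "u' \<in> G" "aff u' = p \<circ> aff v" using lift wv qp by blast
    have "\<exists>q\<in>\<Gamma> \<inter> PB T. aff u = q \<circ> aff w" "\<exists>p\<in>\<Gamma> \<inter> PB T. aff u' = p \<circ> aff v" using u qp by blast+
    then show "coset_le G (2 * m) V A (coset w (para T)) (coset v (para T))"
      unfolding coset_le_def minrep[OF wv(1)] minrep[OF wv(2)] bruhat_iff
      using u qp by (intro exI[of _ u] exI[of _ u']) simp
  qed
qed

end

context gsp
begin

definition ind :: "int \<Rightarrow> int \<Rightarrow> real" where "ind K L = (if L \<simeq> K then 1 else 0)"

lemma ind_per: "ind K (L + n) = ind K L"
proof -
  have "L + n \<simeq> K \<longleftrightarrow> L \<simeq> K" using dvd_add_right_iff[of n n "L - K"] by (simp add: algebra_simps)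
  then show ?thesis by (simp add: ind_def)
qed

lemma ind_bar: "ind K (bar L) = ind (bar K) L" by (simp add: ind_def bar_res)

lemma Y_fix_imp_eq: assumes "Y x (\<kappa> K) = Y x K" "\<kappa> K \<simeq> K" shows "\<kappa> K = K"
proof -
  obtain k where k: "\<kappa> K = K + k * n" using assms(2) by (rule resE)
  then show ?thesis using assms(1) Y_shift[of x K k] by simp
qed

lemma AP_fixed_res: assumes "\<kappa> \<in> AP" "\<kappa> L = L" "K \<simeq> L" shows "\<kappa> K = K"
proof -
  obtain k where "K = L + k * n" using assms(3) by (rule resE)
  then show ?thesis using AP_shift[OF assms(1), of L k] assms(2) by simp
qed

lemma AP_fixed_res': assumes "\<kappa> \<in> AP" "\<kappa> L = L" "\<kappa> K \<simeq> L" shows "\<kappa> K = K"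
  using AP_fixed_res[OF assms(1,2,3)] AP_eq[OF assms(1)] by blast

text \<open>The element is tested on points of the hyperplane. Adding the indicator of a class other
  than those of \<open>I\<close> and \<open>J\<close> shows that this class is preserved, so at most
  these two are exchanged.\<close>

lemma classify_GL:
  assumes \<kappa>: "\<kappa> \<in> AP" and IJ: "\<not> I \<simeq> J" and fx: "\<And>x. x \<in> V_GL m \<Longrightarrow> Y x I = Y x J \<Longrightarrow> Y x \<circ> \<kappa> = Y x"
  shows "\<kappa> = id \<or> \<kappa> = rf I J"
proof -
  \<comment> \<open>The midpoint of the base point and its reflection, which lies on the
    hyperplane.\<close>
  define y where "y K = of_int (K + rf I J K) / (2 * of_int n :: real)" for K
  have yp: "y (K + n) = y K + 1" for K using n_pos rf_per[of I J K] by (simp add: y_def field_simps)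
  have yIJ: "y I = y J" using rf_left rf_right[OF IJ] by (simp add: y_def add.commute)
  have fy: "z \<circ> \<kappa> = z" if "\<And>K. z (K + n) = z K + 1" "z I = z J" for z :: "int \<Rightarrow> real"
    using Y_surj[of z, OF that(1)] fx that(2) by blast
  have y\<kappa>: "y (\<kappa> K) = y K" for K using fy[OF yp yIJ] by (metis comp_apply)
  obtain x where x: "Y x = y" using Y_surj[of y, OF yp] by blast
  have fix1: "\<kappa> K = K" if "\<kappa> K \<simeq> K" for K using Y_fix_imp_eq[of x \<kappa> K] that y\<kappa> by (simp add: x)
  have other: "\<kappa> K = K" if K: "\<not> K \<simeq> I" "\<not> K \<simeq> J" for K
  proof -
    have "ind K I = 0" "ind K J = 0" using K res_sym by (auto simp: ind_def)
    then have "(\<lambda>L. y L + ind K L) \<circ> \<kappa> = (\<lambda>L. y L + ind K L)" using yp yIJ by (intro fy) (simp_all add: ind_per)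
    from fun_cong[OF this, of K] have "ind K (\<kappa> K) = ind K K" using y\<kappa>[of K] by simp
    then show ?thesis by (intro fix1) (simp add: ind_def split: if_splits)
  qed
  have cl: "\<kappa> K \<simeq> I \<or> \<kappa> K \<simeq> J" if "K \<simeq> I \<or> K \<simeq> J" for K
  proof (rule ccontr)
    assume "\<not> (\<kappa> K \<simeq> I \<or> \<kappa> K \<simeq> J)"
    then have "\<kappa> (\<kappa> K) = \<kappa> K" using other by blast
    then show False using AP_eq[OF \<kappa>] that \<open>\<not> (\<kappa> K \<simeq> I \<or> \<kappa> K \<simeq> J)\<close> by metis
  qed
  consider "\<kappa> I \<simeq> I" | "\<kappa> I \<simeq> J" using cl[of I] by auto
  then show ?thesis
  proof cases
    case 1
    then have I: "\<kappa> I = I" by (rule fix1)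
    have "\<kappa> J = J" using cl[of J] fix1[of J] AP_fixed_res'[OF \<kappa> I, of J] by auto
    then have "\<kappa> K = K" for K using other[of K] AP_fixed_res[OF \<kappa>] I by metis
    then show ?thesis by auto
  next
    case 2
    then obtain k where "\<kappa> I = J + k * n" by (rule resE)
    then have I: "\<kappa> I = J" using y\<kappa>[of I] Y_shift[of x J k] yIJ by (simp add: x)
    have "\<not> \<kappa> J \<simeq> J" using AP_res[OF \<kappa>, of J I] I IJ res_sym by auto
    then have "\<kappa> J \<simeq> I" using cl[of J] by auto
    then obtain k where "\<kappa> J = I + k * n" by (rule resE)
    then have J: "\<kappa> J = I" using y\<kappa>[of J] Y_shift[of x I k] yIJ by (simp add: x)
    have "\<kappa> K = rf I J K" for K
    proof (cases "K \<simeq> I \<or> K \<simeq> J")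
      case True
      then show ?thesis
      proof
        assume "K \<simeq> I"
        then obtain k where "K = I + k * n" by (rule resE)
        then show ?thesis using AP_shift[OF \<kappa>] AP_shift[OF rf_AP[OF IJ]] I rf_left by simp
      next
        assume "K \<simeq> J"
        then obtain k where "K = J + k * n" by (rule resE)
        then show ?thesis using AP_shift[OF \<kappa>] AP_shift[OF rf_AP[OF IJ]] J rf_right[OF IJ] by simp
      qed
    next
      case False
      then show ?thesis using other rf_other by simp
    qed
    then show ?thesis by auto
  qed
qed

lemma Y_surj_Sp: assumes "\<And>K. y (K + n) = y K + 1" "\<And>K. y (bar K) = C - y K" shows "\<exists>x\<in>V_Sp m. Y x = y"
  using Y_surj[of y, OF assms(1)] assms(2) V_Sp_iff by metis

text \<open>The perturbations used in the GL case are made antisymmetric under \<open>bar\<close> so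
  as to stay in \<open>V_Sp\<close>.\<close>

lemma classify_Sp:
  assumes \<kappa>: "\<kappa> \<in> SP" and IJ: "\<not> I \<simeq> J" and fx: "\<And>x. x \<in> V_Sp m \<Longrightarrow> Y x I = Y x J \<Longrightarrow> Y x \<circ> \<kappa> = Y x"
  shows "\<kappa> = id \<or> \<kappa> = rs I J"
proof -
  define y where "y K = of_int (K + rs I J K) / (2 * of_int n :: real)" for K
  define C where "C = - 2 / (2 * of_int n :: real)"
  have rsp: "rs I J (K + n) = rs I J K + n" for K using rs_AP[OF IJ] by (simp add: AP_def)
  have yp: "y (K + n) = y K + 1" for K using n_pos rsp[of K] by (simp add: y_def field_simps)
  have yb: "y (bar K) = C - y K" for K unfolding y_def rs_bar[OF IJ] C_def using n_pos by (simp add: bar_def field_simps)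
  have yIJ: "y I = y J" using Sp.s_left[OF IJ] Sp.s_right[OF IJ] by (simp add: y_def add.commute)
  have fy: "z \<circ> \<kappa> = z" if "\<And>K. z (K + n) = z K + 1" "\<And>K. z (bar K) = C - z K" "z I = z J" for z :: "int \<Rightarrow> real"
    using Y_surj_Sp[of z, OF that(1,2)] fx that(3) by blast
  have y\<kappa>: "y (\<kappa> K) = y K" for K using fy[OF yp yb yIJ] by (metis comp_apply)
  have \<kappa>A: "\<kappa> \<in> AP" using SP_AP \<kappa> .
  obtain c where c: "\<And>K. \<kappa> (bar K) = bar (\<kappa> K) + c * n" using SP_bar \<kappa> by blast
  obtain x where x: "Y x = y" using Y_surj[of y, OF yp] by blast
  have "y (\<kappa> (bar I)) = C - y I" using y\<kappa> yb by simp
  then have "y (bar (\<kappa> I)) + of_int c = C - y I" using Y_shift[of x "bar (\<kappa> I)" c] by (simp add: x c)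
  \<comment> \<open>A point of the symplectic space fixed by \<open>\<kappa>\<close> rules out a
    nonzero similitude factor.\<close>
  then have "c = 0" using yb y\<kappa> by simp
  then have \<kappa>b: "\<kappa> (bar K) = bar (\<kappa> K)" for K using c by simp
  have pert: "\<delta> (\<kappa> K) = \<delta> K" if \<delta>: "\<And>K. \<delta> (K + n) = \<delta> K" "\<And>K. \<delta> (bar K) = - \<delta> K" "\<delta> I = \<delta> J" for \<delta> :: "int \<Rightarrow> real" and K
  proof -
    have "(\<lambda>L. y L + \<delta> L) \<circ> \<kappa> = (\<lambda>L. y L + \<delta> L)" using \<delta> yp yIJ by (intro fy) (simp_all add: yb)
    from fun_cong[OF this, of K] show ?thesis using y\<kappa>[of K] by simp
  qed
  have fix1: "\<kappa> K = K" if "\<kappa> K \<simeq> K" for K using Y_fix_imp_eq[of x \<kappa> K] that y\<kappa> by (simp add: x)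
  let ?orb = "\<lambda>K. K \<simeq> I \<or> K \<simeq> J \<or> K \<simeq> bar I \<or> K \<simeq> bar J"
  have other: "\<kappa> K = K" if K: "\<not> ?orb K" for K
  proof -
    define \<delta> where "\<delta> L = ind K L - ind (bar K) L" for L
    have "\<delta> I = 0" "\<delta> J = 0" using K res_sym bar_res by (auto simp: \<delta>_def ind_def)
    then have "\<delta> (\<kappa> K) = \<delta> K" by (intro pert) (auto simp: \<delta>_def ind_per ind_bar bar_bar)
    also have "\<delta> K = 1" using bar_res(3)[of K] by (simp add: \<delta>_def ind_def)
    finally show ?thesis by (intro fix1) (simp add: \<delta>_def ind_def split: if_splits)
  qed
  have cl: "?orb (\<kappa> K)" if "?orb K" for K
  proof (rule ccontr)
    assume n: "\<not> ?orb (\<kappa> K)"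
    then have "\<kappa> (\<kappa> K) = \<kappa> K" using other by blast
    then have "\<kappa> K = K" using AP_eq[OF \<kappa>A] by blast
    then show False using n that by simp
  qed
  have cl2: "\<kappa> K \<simeq> I \<or> \<kappa> K \<simeq> J" if K: "K = I \<or> K = J" for K
  proof (cases "I \<simeq> bar J")
    case True
    have "J \<simeq> bar I" using True bar_res res_sym by blast
    then have "bar I \<simeq> J" "bar J \<simeq> I" using True res_sym by blast+
    then have "\<kappa> K \<simeq> bar I \<Longrightarrow> \<kappa> K \<simeq> J" "\<kappa> K \<simeq> bar J \<Longrightarrow> \<kappa> K \<simeq> I" using res_trans by blast+
    moreover have "?orb (\<kappa> K)" using K by (intro cl) auto
    ultimately show ?thesis by blast
  next
    case False
    \<comment> \<open>Antisymmetric, and equal to 1 exactly on the classes of \<open>I\<close> and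
      \<open>J\<close>; preserving it prevents a move into the mirrored classes.\<close>
    define \<delta> where "\<delta> L = ind I L + ind J L - ind (bar I) L - ind (bar J) L" for L
    have n: "\<not> I \<simeq> bar J" "\<not> J \<simeq> bar I" "\<not> I \<simeq> bar I" "\<not> J \<simeq> bar J" "\<not> J \<simeq> I"
      using False IJ bar_res res_sym by blast+
    have d1: "\<delta> I = 1" "\<delta> J = 1" using n IJ by (simp_all add: \<delta>_def ind_def)
    then have "\<delta> (\<kappa> K) = \<delta> K" by (intro pert) (auto simp: \<delta>_def ind_per ind_bar bar_bar)
    then have "\<delta> (\<kappa> K) = 1" using d1 K by auto
    then show ?thesis by (auto simp: \<delta>_def ind_def split: if_splits)
  qed
  have id: "\<pi> = id" if \<pi>: "\<pi> \<in> AP" "\<And>K. \<pi> (bar K) = bar (\<pi> K)" "\<pi> I = I" "\<pi> J = J" "\<And>K. \<not> ?orb K \<Longrightarrow> \<pi> K = K" for \<pi>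
  proof
    fix K
    have "\<pi> (bar I) = bar I" "\<pi> (bar J) = bar J" using \<pi> by simp_all
    then show "\<pi> K = id K" using \<pi>(3-5) AP_fixed_res[OF \<pi>(1)] by (cases "?orb K") auto
  qed
  consider "\<kappa> I \<simeq> I" | "\<kappa> I \<simeq> J" using cl2[of I] by auto
  then show ?thesis
  proof cases
    case 1
    then have I: "\<kappa> I = I" by (rule fix1)
    have "\<kappa> J = J" using cl2[of J] fix1[of J] AP_fixed_res'[OF \<kappa>A I, of J] by auto
    then show ?thesis using id[OF \<kappa>A \<kappa>b I _ other] by blast
  next
    case 2
    then obtain k where "\<kappa> I = J + k * n" by (rule resE)
    then have I: "\<kappa> I = J" using y\<kappa>[of I] Y_shift[of x J k] yIJ by (simp add: x)
    have "\<not> \<kappa> J \<simeq> J" using AP_res[OF \<kappa>A, of J I] I IJ res_sym by auto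
    then have "\<kappa> J \<simeq> I" using cl2[of J] by auto
    then obtain k where "\<kappa> J = I + k * n" by (rule resE)
    then have J: "\<kappa> J = I" using y\<kappa>[of J] Y_shift[of x I k] yIJ by (simp add: x)
    have ro: "rs I J K = K" if "\<not> ?orb K" for K using that by (simp add: rs_def rf_other)
    have "rs I J \<circ> \<kappa> = id"
      using AP_comp[OF rs_AP[OF IJ] \<kappa>A] \<kappa>b rs_bar[OF IJ] I J Sp.s_left[OF IJ] Sp.s_right[OF IJ] other ro by (intro id) auto
    then have "rs I J (\<kappa> K) = K" for K by (auto simp: fun_eq_iff)
    then have "\<kappa> K = rs I J K" for K using Sp.s_invol[OF IJ] by metis
    then show ?thesis by auto
  qed
qed

lemma base_point: "\<exists>x\<in>V_Sp m. \<forall>K. Y x K = of_int K / of_int n"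
proof -
  have "\<exists>x\<in>V_Sp m. Y x = (\<lambda>K. of_int K / of_int n)"
    using n_pos by (intro Y_surj_Sp[of _ "- 1 / of_int n"]) (auto simp: field_simps bar_def)
  then show ?thesis by metis
qed

lemma V_Sp_sub: "V_Sp m \<subseteq> V_GL m" using V_Sp_iff by blast

lemma GLm: "ewg_model n m AP rf (W_GL m) (V_GL m) (A_GL m)"
proof
  show "\<exists>x\<in>V_GL m. \<forall>K. Y x K = of_int K / of_int n" using base_point V_Sp_sub by blast
next
  fix x I J assume "\<not> I \<simeq> J" "Y x I = Y x J"
  then show "Y x \<circ> rf I J = Y x" using rf_linear[of "Y x" 1 I J, OF Y_per] by auto
qed (use aff_AP V_GL_act A_GL_iff classify_GL in auto)

lemma Spm: "ewg_model n m SP rs (W_Sp m) (V_Sp m) (A_Sp m)"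
proof
  fix x I J assume x: "x \<in> V_Sp m" "\<not> I \<simeq> J" "Y x I = Y x J"
  then obtain C where "\<And>K. Y x (bar K) = C - Y x K" using V_Sp_iff by blast
  then show "Y x \<circ> rs I J = Y x" using rs_linear[of "Y x" 1 C I J, OF Y_per] x by auto
next
  fix w x assume w: "w \<in> W_Sp m" and x: "x \<in> V_Sp m"
  obtain C where C: "\<And>K. Y x (bar K) = C - Y x K" using x V_Sp_iff by blast
  have wG: "w \<in> W_GL m" and wS: "aff w \<in> SP" using w W_Sp_iff by auto
  obtain c where c: "\<And>K. aff w (bar K) = bar (aff w K) + c * n" using wS SP_bar by blast
  have "Y (ewg_act w x) (bar K) = (C + of_int c) - Y (ewg_act w x) K" for K
    unfolding Y_act[OF wG] comp_apply c Y_shift C by simp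
  then show "ewg_act w x \<in> V_Sp m" using V_GL_act[OF wG] x V_Sp_iff by blast
next
  show "\<exists>x\<in>V_Sp m. \<forall>K. Y x K = of_int K / of_int n" by (rule base_point)
qed (use W_Sp_iff V_Sp_sub A_Sp_iff classify_Sp in auto)

end

sublocale gsp \<subseteq> GLm: ewg_model n m AP rf "W_GL m" "V_GL m" "A_GL m" by (rule GLm)
sublocale gsp \<subseteq> Spm: ewg_model n m SP rs "W_Sp m" "V_Sp m" "A_Sp m" by (rule Spm)

context gsp
begin

lemma Y_omega: "Y (omega m t) I = of_int ((I - t) div n)"
proof -
  define k where "k = I mod n"
  define c where "c = t mod n"
  have kc: "0 \<le> k" "k < n" "0 \<le> c" "c < n" using n_pos by (simp_all add: k_def c_def)
  have "I - t = (k - c) + (I div n - t div n) * n" by (simp add: k_def c_def algebra_simps)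
  then have 1: "(I - t) div n = (I div n - t div n) + (k - c) div n" using n_pos by (simp only: div_mult_self1)
  have 2: "(k - c) div n = (if k < c then - 1 else 0)"
  proof (cases "k < c")
    case True
    then have "(k - c) div n = -1" using kc by (intro int_div_pos_eq[of _ _ _ "k - c + n"]) auto
    then show ?thesis using True by simp
  qed (use kc in auto)
  have "Y (omega m t) I = (if k < c then - 1 else 0) - of_int (t div n) + of_int (I div n)"
    unfolding Y_def omega_def n_def[symmetric] k_def c_def using residue_less[of I] int_residue[of I] by simp
  then show ?thesis by (simp add: 1 2)
qed

lemma fixes_omega_iff: assumes "w \<in> W_GL m"
  shows "(\<forall>t\<in>T. ewg_act w (omega m t) = omega m t) \<longleftrightarrow> aff w \<in> PB T"
proof -
  have "ewg_act w (omega m t) = omega m t \<longleftrightarrow> (\<forall>I. (aff w I - t) div n = (I - t) div n)" for t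
  proof -
    have o: "omega m t \<in> V_GL m" by (simp add: V_GL_def omega_def)
    have "ewg_act w (omega m t) = omega m t \<longleftrightarrow> Y (omega m t) \<circ> aff w = Y (omega m t)"
      using GLm.act_eq[OF assms o] .
    then show ?thesis by (auto simp: fun_eq_iff Y_omega)
  qed
  then show ?thesis using aff_AP[OF assms] by (auto simp: PB_def blk_def)
qed

lemma W_GL_I_eq: "W_GL_I m I = GLm.para (pmI m I)"
  using fixes_omega_iff by (auto simp: W_GL_I_def GLm.para_def)

lemma W_Sp_I_eq: "W_Sp_I m I = Spm.para (pmI m I)"
  using fixes_omega_iff W_Sp_iff by (auto simp: W_Sp_I_def Spm.para_def)

lemma pmI_nonempty: "I \<noteq> {} \<Longrightarrow> pmI m I \<noteq> {}" by (auto simp: pmI_def)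

lemma pmI_uminus: "uminus ` pmI m I = pmI m I"
proof -
  have 1: "- i \<in> pmI m I" if "i \<in> pmI m I" for i
    using that mod_minus_cong[of i n] unfolding pmI_def n_def[symmetric] mem_Collect_eq by (metis minus_minus)
  show ?thesis
  proof
    show "pmI m I \<subseteq> uminus ` pmI m I" using 1 by (metis image_eqI minus_minus subsetI)
  qed (use 1 in auto)
qed

section \<open>Cocharacters as periodic functions\<close>

definition hat :: "(nat \<Rightarrow> int) \<Rightarrow> int \<Rightarrow> int" where "hat \<mu> K = \<mu> (nat (K mod n))"

lemma hat_per: "hat \<mu> \<in> per" by (simp add: per_def hat_def)

lemma aff_transl: "aff (transl \<mu>) = tau (hat \<mu>)"
  using int_residue by (auto simp: fun_eq_iff aff_def transl_def tau_def hat_def distrib_left)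

text \<open>Only the permutation part of \<open>v\<close> matters, since \<open>hat \<mu>\<close> is
  periodic. Hence the finite Weyl group orbit of \<mu> may be formed with all affine
  permutations.\<close>

lemma aff_transl_perm: assumes "v \<in> W_GL m" shows "aff (transl (perm_act (snd v) \<mu>)) = tau (hat \<mu> \<circ> aff v)"
  unfolding aff_transl by (rule arg_cong[of _ _ tau]) (auto simp: fun_eq_iff hat_def aff_mod_div[OF assms] perm_act_def)

lemma transl_W_GL: assumes "\<mu> \<in> Xstar m" "\<sigma> \<in> perms (2 * m)" shows "transl (perm_act \<sigma> \<mu>) \<in> W_GL m"
  using assms perms_inv[OF assms(2)] by (auto simp: W_GL_def transl_def perm_act_def Xstar_def perms_def)

lemma hat_bar: assumes "\<mu> \<in> Xstar m" obtains c where "\<And>K. hat \<mu> (bar K) = c - hat \<mu> K"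
proof -
  have "transl \<mu> \<in> W_Sp m" using assms by (simp add: W_Sp_def transl_def S_star_def perms_def)
  then have "tau (hat \<mu>) \<in> SP" using W_Sp_iff aff_transl by metis
  then obtain c where c: "\<And>K. tau (hat \<mu>) (bar K) = bar (tau (hat \<mu>) K) + c * n" using SP_bar by blast
  have "hat \<mu> (bar K) = c - hat \<mu> K" for K
  proof -
    have "n * hat \<mu> (bar K) = n * (c - hat \<mu> K)" using c[of K] by (simp add: tau_def bar_def algebra_simps)
    then show ?thesis using n_pos by simp
  qed
  then show ?thesis using that by blast
qed

lemma tau_SP: assumes "l \<in> per" "\<And>K. l (bar K) = c - l K" shows "tau l \<in> SP"
proof -
  have "tau l (bar K) = bar (tau l K) + c * n" for K
    unfolding tau_def assms(2) by (simp add: bar_def algebra_simps)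
  then show ?thesis using tau_AP[OF assms(1)] unfolding SP_def by blast
qed

lemma perm_elem: "\<sigma> \<in> perms (2 * m) \<Longrightarrow> ((\<lambda>_. 0), \<sigma>) \<in> W_GL m" "\<sigma> \<in> S_star m \<Longrightarrow> ((\<lambda>_. 0), \<sigma>) \<in> W_Sp m"
  by (auto simp: W_GL_def W_Sp_def Xstar_def)

lemma transl_W_Sp: assumes "\<mu> \<in> Xstar m" "\<sigma> \<in> S_star m" shows "transl (perm_act \<sigma> \<mu>) \<in> W_Sp m"
proof -
  let ?v = "((\<lambda>_. 0), \<sigma>) :: ewg"
  have v: "?v \<in> W_GL m" "aff ?v \<in> SP" using perm_elem(2)[OF assms(2)] W_Sp_iff by auto
  obtain c where c: "\<And>K. hat \<mu> (bar K) = c - hat \<mu> K" using hat_bar assms by blast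
  obtain d where d: "\<And>K. aff ?v (bar K) = bar (aff ?v K) + d * n" using SP_bar v by blast
  have "(hat \<mu> \<circ> aff ?v) (bar K) = c - (hat \<mu> \<circ> aff ?v) K" for K
    using per_shift[OF hat_per] by (simp add: d c)
  then have "tau (hat \<mu> \<circ> aff ?v) \<in> SP" using tau_SP per_comp[OF hat_per aff_AP[OF v(1)]] by blast
  moreover have "transl (perm_act \<sigma> \<mu>) \<in> W_GL m" using transl_W_GL assms by (simp add: S_star_def)
  ultimately show ?thesis using aff_transl_perm[OF v(1), of \<mu>] W_Sp_iff by simp
qed

lemma embed_coset: assumes "x \<in> W_Sp m" shows "embed m I (coset x (W_Sp_I m I)) = coset x (W_GL_I m I)"
proof -
  let ?T = "pmI m I"
  have xG: "x \<in> W_GL m" using assms W_Sp_iff by blast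
  show ?thesis unfolding W_GL_I_eq W_Sp_I_eq
  proof
    show "embed m I (coset x (Spm.para ?T)) \<subseteq> coset x (GLm.para ?T)"
    proof
      fix u assume "u \<in> embed m I (coset x (Spm.para ?T))"
      then obtain g p where g: "g \<in> coset x (Spm.para ?T)" "p \<in> GLm.para ?T" "u = ewg_mult g p"
        by (auto simp: embed_def W_GL_I_eq)
      obtain q where q: "g \<in> W_Sp m" "q \<in> PB ?T" "aff g = q \<circ> aff x" using g(1) Spm.mem_coset[OF assms] by blast
      have p: "p \<in> W_GL m" "aff p \<in> PB ?T" using g(2) by (auto simp: GLm.para_def)
      have gG: "g \<in> W_GL m" using q W_Sp_iff by blast
      have "aff u = (aff p \<circ> q) \<circ> aff x" using aff_mult[OF gG p(1)] g(3) q(3) by (simp add: comp_assoc)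
      then show "u \<in> coset x (GLm.para ?T)" using GLm.mem_coset[OF xG] g(3) mult_W_GL[OF gG p(1)] PB_comp[OF p(2) q(2)] PB_AP
        by blast
    qed
    show "coset x (GLm.para ?T) \<subseteq> embed m I (coset x (Spm.para ?T))"
    proof
      fix u assume "u \<in> coset x (GLm.para ?T)"
      then obtain p where p: "p \<in> GLm.para ?T" "u = ewg_mult x p" by (auto simp: coset_def)
      have "x \<in> coset x (Spm.para ?T)" using Spm.mem_coset[OF assms] assms Sp.G_id PB_id by (metis IntI id_comp)
      then show "u \<in> embed m I (coset x (Spm.para ?T))" using p unfolding embed_def W_GL_I_eq by blast
    qed
  qed
qed

text \<open>By uniqueness, \<open>q \<circ> x\<close> is the reduced element found inside the symplectic coset.\<close>
lemma red_in_SP: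
  assumes T: "T \<noteq> {}" "uminus ` T = T" and x: "x \<in> SP" and q: "q \<in> PB T" "red T (q \<circ> x)"
  shows "q \<in> SP"
proof -
  obtain p where p: "p \<in> SP \<inter> PB T" "red T (p \<circ> x)" using Sp.red_below[OF T(1) rs_PB[OF T(2)] x] by blast
  have pA: "p \<in> AP" using p PB_AP by blast
  have "q \<circ> inv p \<circ> (p \<circ> x) = q \<circ> x" using AP_inv_l[OF pA] by auto
  then have "q \<circ> inv p = id"
    using red_unique[OF T(1), of "p \<circ> x" "q \<circ> inv p"] AP_comp[OF pA SP_AP[OF x]] p q PB_comp PB_inv by simp
  then have "q (inv p (p K)) = p K" for K by (metis comp_apply id_apply)
  then have "q = p" using AP_inv_l[OF pA] by auto
  then show ?thesis using p by blast
qed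

text \<open>Descent produces some reduced element of the coset below \<open>x\<close>, and
  uniqueness identifies it with \<open>q \<circ> x\<close>.\<close>

lemma red_le: assumes T: "T \<noteq> {}" and x: "x \<in> AP" and q: "q \<in> PB T" "red T (q \<circ> x)" shows "q \<circ> x \<preceq>\<^sub>G x"
proof -
  obtain p where p: "p \<in> AP \<inter> PB T" "red T (p \<circ> x)" "p \<circ> x \<preceq>\<^sub>G x" using GL.red_below[OF T rf_PB x] by blast
  have pA: "p \<in> AP" using p by blast
  have "q \<circ> inv p \<circ> (p \<circ> x) = q \<circ> x" using AP_inv_l[OF pA] by auto
  then have "q \<circ> inv p = id"
    using red_unique[OF T, of "p \<circ> x" "q \<circ> inv p"] AP_comp[OF pA x] p q PB_comp PB_inv by simp
  then have "q (inv p (p K)) = p K" for K by (metis comp_apply id_apply)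
  then have "q = p" using AP_inv_l[OF pA] by auto
  then show ?thesis using p by blast
qed

text \<open>\<open>red\<close> and \<open>PB\<close> refer to blocks only, so symplectic reduced
  representatives are also reduced in GL, and the comparison carries over.\<close>

lemma coset_le_Sp_imp_GL:
  assumes T: "T \<noteq> {}" "uminus ` T = T" and x: "x \<in> W_Sp m" and y: "y \<in> W_Sp m"
    and le: "coset_le (W_Sp m) (2 * m) (V_Sp m) (A_Sp m) (coset x (Spm.para T)) (coset y (Spm.para T))"
  shows "coset_le (W_GL m) (2 * m) (V_GL m) (A_GL m) (coset x (GLm.para T)) (coset y (GLm.para T))"
proof -
  have "x \<in> W_GL m" "y \<in> W_GL m" using x y W_Sp_iff by auto
  moreover obtain q p where qp: "q \<in> SP \<inter> PB T" "p \<in> SP \<inter> PB T" "red T (q \<circ> aff x)" "red T (p \<circ> aff y)" "q \<circ> aff x \<preceq>\<^sub>S p \<circ> aff y"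
    using le Spm.coset_le_iff[OF T(1) rs_PB[OF T(2)] x y] by blast
  ultimately show ?thesis
    using GLm.coset_le_iff[OF T(1) rf_PB] Sp_le_imp_GL_le[OF qp(5)] SP_AP by blast
qed

text \<open>The comparison of cosets is loosened to \<open>u\<close> lying below the translation
  itself, where the symmetric bound applies, and then tightened to the reduced representative of the
  new translation. By then both elements are symplectic and the GL order restricts.\<close>

lemma adm_GL_imp_Sp:
  assumes T: "T \<noteq> {}" "uminus ` T = T" and \<mu>: "\<mu> \<in> Xstar m" and x: "x \<in> W_Sp m" and \<sigma>: "\<sigma> \<in> perms (2 * m)"
    and le: "coset_le (W_GL m) (2 * m) (V_GL m) (A_GL m) (coset x (GLm.para T)) (coset (transl (perm_act \<sigma> \<mu>)) (GLm.para T))"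
  shows "\<exists>\<tau>\<in>S_star m. coset_le (W_Sp m) (2 * m) (V_Sp m) (A_Sp m) (coset x (Spm.para T)) (coset (transl (perm_act \<tau> \<mu>)) (Spm.para T))"
proof -
  let ?v = "((\<lambda>_. 0), \<sigma>) :: ewg"
  have v: "?v \<in> W_GL m" using perm_elem \<sigma> by blast
  have av: "aff (transl (perm_act \<sigma> \<mu>)) = tau (hat \<mu> \<circ> aff ?v)" using aff_transl_perm[OF v] by simp
  have xG: "x \<in> W_GL m" and xS: "aff x \<in> SP" using x W_Sp_iff by auto
  have tG: "transl (perm_act \<sigma> \<mu>) \<in> W_GL m" using transl_W_GL \<mu> \<sigma> .
  obtain q p where qp: "q \<in> PB T" "p \<in> PB T" "red T (q \<circ> aff x)"
      "red T (p \<circ> aff (transl (perm_act \<sigma> \<mu>)))" "q \<circ> aff x \<preceq>\<^sub>G p \<circ> aff (transl (perm_act \<sigma> \<mu>))"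
    using le GLm.coset_le_iff[OF T(1) rf_PB xG tG] by blast
  define u where "u = q \<circ> aff x"
  have qS: "q \<in> SP" using red_in_SP[OF T xS qp(1,3)] .
  have uS: "u \<in> SP" using SP_comp[OF qS xS] by (simp add: u_def)
  have "u \<preceq>\<^sub>G tau (hat \<mu> \<circ> aff ?v)"
    using qp(5) red_le[OF T(1) aff_AP[OF tG] qp(2,4)] av by (simp add: u_def)
  moreover obtain c where c: "\<And>K. hat \<mu> (bar K) = c - hat \<mu> K" using hat_bar \<mu> by blast
  ultimately obtain \<kappa> where \<kappa>: "\<kappa> \<in> SP" "u \<preceq>\<^sub>G tau (hat \<mu> \<circ> \<kappa>)"
    using admissible_symmetric[OF uS hat_per c aff_AP[OF v]] by blast
  obtain w where w: "w \<in> W_GL m" "aff w = \<kappa>" using aff_surj[OF SP_AP[OF \<kappa>(1)]] by blast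
  have "w \<in> W_Sp m" using W_Sp_iff w \<kappa> by blast
  then have \<tau>: "snd w \<in> S_star m" by (simp add: W_Sp_def)
  define t where "t = transl (perm_act (snd w) \<mu>)"
  have tS: "t \<in> W_Sp m" using transl_W_Sp[OF \<mu> \<tau>] by (simp add: t_def)
  have at: "aff t \<in> SP" using tS W_Sp_iff by blast
  have "u \<preceq>\<^sub>G aff t" using \<kappa> w aff_transl_perm[OF w(1)] by (simp add: t_def)
  then obtain r where r: "r \<in> PB T" "red T (r \<circ> aff t)" "u \<preceq>\<^sub>G r \<circ> aff t"
    using le_red[OF T(1), of u] qp(3) SP_AP[OF uS] by (auto simp: u_def)
  have rS: "r \<in> SP" using red_in_SP[OF T at r(1,2)] .
  have "u \<preceq>\<^sub>S r \<circ> aff t" using GL_le_imp_Sp_le[OF r(3) uS SP_comp[OF rS at]] .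
  then have "coset_le (W_Sp m) (2 * m) (V_Sp m) (A_Sp m) (coset x (Spm.para T)) (coset t (Spm.para T))"
    using Spm.coset_le_iff[OF T(1) rs_PB[OF T(2)] x tS] qp r rS qS unfolding u_def by blast
  then show ?thesis using \<tau> by (auto simp: t_def)
qed

lemma Adm_embed:
  assumes I: "I \<noteq> {}" and \<mu>: "\<mu> \<in> Xstar m"
  shows "embed m I ` Adm_Sp m I \<mu> = Adm_GL m I \<mu> \<inter> embed m I ` quot (W_Sp m) (W_Sp_I m I)"
proof -
  note T = pmI_nonempty[OF I] pmI_uminus[of I]
  have S: "S_star m \<subseteq> perms (2 * m)" by (auto simp: S_star_def)
  have iff: "coset x (W_Sp_I m I) \<in> Adm_Sp m I \<mu> \<longleftrightarrow> embed m I (coset x (W_Sp_I m I)) \<in> Adm_GL m I \<mu>"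
    if x: "x \<in> W_Sp m" for x
  proof -
    let ?leS = "\<lambda>\<sigma>. coset_le (W_Sp m) (2 * m) (V_Sp m) (A_Sp m) (coset x (Spm.para (pmI m I)))
        (coset (transl (perm_act \<sigma> \<mu>)) (Spm.para (pmI m I)))"
    let ?leG = "\<lambda>\<sigma>. coset_le (W_GL m) (2 * m) (V_GL m) (A_GL m) (coset x (GLm.para (pmI m I)))
        (coset (transl (perm_act \<sigma> \<mu>)) (GLm.para (pmI m I)))"
    have "coset x (W_Sp_I m I) \<in> quot (W_Sp m) (W_Sp_I m I)" "coset x (W_GL_I m I) \<in> quot (W_GL m) (W_GL_I m I)"
      using x W_Sp_iff by (auto simp: quot_def)
    moreover have "coset x (W_Sp_I m I) \<in> Adm_Sp m I \<mu> \<longleftrightarrow> coset x (W_Sp_I m I) \<in> quot (W_Sp m) (W_Sp_I m I) \<and>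
        (\<exists>\<sigma>\<in>S_star m. ?leS \<sigma>)" unfolding W_Sp_I_eq Adm_Sp_def adm_def by blast
    moreover have "coset x (W_GL_I m I) \<in> Adm_GL m I \<mu> \<longleftrightarrow> coset x (W_GL_I m I) \<in> quot (W_GL m) (W_GL_I m I) \<and>
        (\<exists>\<sigma>\<in>perms (2 * m). ?leG \<sigma>)" unfolding W_GL_I_eq Adm_GL_def adm_def by blast
    moreover have "?leG \<sigma>" if "\<sigma> \<in> S_star m" "?leS \<sigma>" for \<sigma>
      using coset_le_Sp_imp_GL[OF T x transl_W_Sp[OF \<mu> that(1)] that(2)] .
    moreover have "\<exists>\<tau>\<in>S_star m. ?leS \<tau>" if "\<sigma> \<in> perms (2 * m)" "?leG \<sigma>" for \<sigma>
      using adm_GL_imp_Sp[OF T \<mu> x that] .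
    ultimately show ?thesis unfolding embed_coset[OF x] using S by (meson subsetD)
  qed
  have "Adm_Sp m I \<mu> \<subseteq> quot (W_Sp m) (W_Sp_I m I)" by (auto simp: Adm_Sp_def adm_def)
  then show ?thesis using iff by (fastforce simp: quot_def)
qed

end

theorem theorem6p3p1:
  fixes m :: nat and I :: "nat set" and \<mu> :: "nat \<Rightarrow> int"
  assumes "m \<ge> 1" and "I \<subseteq> {0..m}" and "I \<noteq> {}" and "\<mu> \<in> Xstar m"
  shows "embed m I ` Adm_Sp m I \<mu> =
         Adm_GL m I \<mu> \<inter> embed m I ` quot (W_Sp m) (W_Sp_I m I)"
proof -
  interpret gsp "int (2 * m)" m using assms(1) by unfold_locales auto
  show ?thesis by (rule Adm_embed[OF assms(3,4)])
qed

end
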